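(* Let $1\le p\le\infty$ and let $\lambda=(R,B)$ be a frequency of natural type. Then there is a unique into isometry $$\psi\colon\mathcal{H}_p(\lambda)\hookrightarrow\mathcal{H}_p,\qquad \sum a_ne^{-\lambda_ns}\mapsto\sum b_n n^{-s},$$ such that $a_n=b_{\mathfrak{p}^\alpha}$ for all $\alpha\in R$, where $\lambda_n=\sum_j\alpha_jb_j$. (In the last sum the $b_j$ are the elements of the basis $B$; they are not to be confused with the Dirichlet coefficients $b_n$ of the image series.)
   Context: A frequency is a strictly increasing sequence $\lambda=(\lambda_n)_{n\ge1}$ of non-negative real numbers tending to $\infty$. A $\lambda$-Dirichlet series is a formal sum $D=\sum a_n e^{-\lambda_n s}$ with complex coefficients $a_n$. A (finite or infinite) sequence $B=(b_j)$ of real numbers is a basis for $\lambda$ if it is $\mathbb{Q}$-linearly independent and each $\lambda_n$ is a finite sum $\lambda_n=\sum_k r^n_kb_k$ with rational coefficients (only finitely many $r_k^n\neq0$ for each $n$). The matrix $R=(r^n_k)_{n,k}$ is then the Bohr matrix of $\lambda$ with respect to $B$, and one writes $\lambda=(R,B)$; $\alpha\in R$ means that $\alpha$ is a row of $R$. $\lambda$ is of natural type if there is a basis $B$ such that all entries of $R$ are in $\mathbb{N}_0$; $\lambda=(R,B)$ of natural type refers to such a decomposition. $\mathfrak{p}=(p_j)$ is the sequence of prime numbers and $\mathfrak{p}^\alpha=\prod_jp_j^{\alpha_j}$. A Dirichlet group is a pair $(G,\beta)$ of a compact abelian group $G$ and a continuous homomorphism $\beta\colon\mathbb{R}\to G$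 with dense range. It is a $\lambda$-Dirichlet group if for every $n$ there is a (necessarily unique) character $h_{\lambda_n}\in\widehat{G}$ with $h_{\lambda_n}(\beta(t))=e^{-i\lambda_n t}$ for all $t\in\mathbb{R}$. $H_p^\lambda(G)$ is the space of all $f\in L_p(G)$ (Haar measure $m$) whose Fourier coefficients $\widehat f(\gamma)=\int_Gf\overline\gamma\,dm$ vanish unless $\gamma=h_{\lambda_n}$ for some $n$. $\mathcal{H}_p(\lambda)$ is the space of all $\lambda$-Dirichlet series $D=\sum a_ne^{-\lambda_ns}$ for which there is $f\in H_p^\lambda(G)$ with $\widehat f(h_{\lambda_n})=a_n$ for all $n$, with norm $\|D\|_p=\|f\|_p$; it does not depend on the choice of the $\lambda$-Dirichlet group. $\mathcal{H}_p=\mathcal{H}_p((\log n))$ is the Hardy space of ordinary Dirichlet series; equivalently, the isometric image of $H_p(\mathbb{T}^\infty)=\{f\in L_p(\mathbb{T}^\infty):\widehat f(\alpha)=0\text{ whenever some }\alpha_k<0\}$ under $f\mapsto\sum c_mm^{-s}$, $c_{\mathfrak{p}^\alpha}=\widehat f(\alpha)$.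
   Formalization: The isometry is also required to give b_k = 0 for every k not of the form p^α with α in R; uniqueness is among such maps. Without this, uniqueness fails at p = 1: for λ = (1,3,5,…), f ↦ f(z)(1+Re z) is a second isometry. *)

theory Defs
  imports "HOL-Probability.Probability" "HOL-Library.Extended_Nat"
    "HOL-Library.Infinite_Set" "HOL-Library.FuncSet"
    "HOL-Computational_Algebra.Primes"
begin

text \<open>
  Sequences are indexed from 0, so the entry at index \<open>n\<close> is the one with index \<open>n + 1\<close> in the
  usual notation.
\<close>

definition frequency :: "(nat \<Rightarrow> real) \<Rightarrow> bool" where
  "frequency l \<longleftrightarrow> strict_mono l \<and> (\<forall>n. 0 \<le> l n) \<and> filterlim l at_top sequentially"

definition log_freq :: "nat \<Rightarrow> real" where
  "log_freq n = ln (real (Suc n))"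

text \<open>
  A finite or infinite real sequence is a pair of a length \<open>L\<close> and a function \<open>B\<close>, of which only
  the values at \<open>j\<close> with \<open>enat j < L\<close> matter. Independence is that of the family, so it
  excludes repetitions.
\<close>

definition rat_independent :: "enat \<Rightarrow> (nat \<Rightarrow> real) \<Rightarrow> bool" where
  "rat_independent L B \<longleftrightarrow>
     (\<forall>F q. finite F \<and> (\<forall>j\<in>F. enat j < L) \<and> (\<Sum>j\<in>F. real_of_rat (q j) * B j) = 0
        \<longrightarrow> (\<forall>j\<in>F. q j = 0))"

definition represents :: "(nat \<Rightarrow> real) \<Rightarrow> enat \<Rightarrow> (nat \<Rightarrow> real) \<Rightarrow> (nat \<Rightarrow> nat \<Rightarrow> rat) \<Rightarrow> bool" where
  "represents l L B R \<longleftrightarrow>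
     (\<forall>n. finite {k. R n k \<noteq> 0} \<and> (\<forall>k. R n k \<noteq> 0 \<longrightarrow> enat k < L) \<and>
          l n = (\<Sum>k | R n k \<noteq> 0. real_of_rat (R n k) * B k))"

definition is_basis :: "(nat \<Rightarrow> real) \<Rightarrow> enat \<Rightarrow> (nat \<Rightarrow> real) \<Rightarrow> bool" where
  "is_basis l L B \<longleftrightarrow> rat_independent L B \<and> (\<exists>R. represents l L B R)"

definition bohr_matrix :: "(nat \<Rightarrow> real) \<Rightarrow> enat \<Rightarrow> (nat \<Rightarrow> real) \<Rightarrow> (nat \<Rightarrow> nat \<Rightarrow> rat) \<Rightarrow> bool" where
  "bohr_matrix l L B R \<longleftrightarrow> is_basis l L B \<and> represents l L B R"

definition natural_decomposition ::
    "(nat \<Rightarrow> real) \<Rightarrow> enat \<Rightarrow> (nat \<Rightarrow> real) \<Rightarrow> (nat \<Rightarrow> nat \<Rightarrow> nat) \<Rightarrow> bool" where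
  "natural_decomposition l L B R \<longleftrightarrow> bohr_matrix l L B (\<lambda>n k. of_nat (R n k))"

text \<open>Meaningful for finitely supported \<open>\<alpha>\<close>.\<close>

definition prime_monomial :: "(nat \<Rightarrow> nat) \<Rightarrow> nat" where
  "prime_monomial \<alpha> = (\<Prod>j | \<alpha> j \<noteq> 0. enumerate {q::nat. prime q} j ^ \<alpha> j)"

definition dirichlet_group :: "(real \<Rightarrow> 'g::{topological_ab_group_add,t2_space}) \<Rightarrow> bool" where
  "dirichlet_group \<beta> \<longleftrightarrow>
     compact (UNIV :: 'g set) \<and> continuous_on UNIV \<beta> \<and>
     (\<forall>s t. \<beta> (s + t) = \<beta> s + \<beta> t) \<and> closure (range \<beta>) = UNIV"

definition is_character :: "('g::topological_ab_group_add \<Rightarrow> complex) \<Rightarrow> bool" where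
  "is_character \<gamma> \<longleftrightarrow>
     continuous_on UNIV \<gamma> \<and> (\<forall>x. norm (\<gamma> x) = 1) \<and> (\<forall>x y. \<gamma> (x + y) = \<gamma> x * \<gamma> y)"

definition lifts_frequency ::
    "(real \<Rightarrow> 'g::topological_ab_group_add) \<Rightarrow> real \<Rightarrow> ('g \<Rightarrow> complex) \<Rightarrow> bool" where
  "lifts_frequency \<beta> x \<gamma> \<longleftrightarrow>
     is_character \<gamma> \<and> (\<forall>t. \<gamma> (\<beta> t) = exp (- \<i> * complex_of_real (x * t)))"

definition freq_dirichlet_group ::
    "(real \<Rightarrow> 'g::{topological_ab_group_add,t2_space}) \<Rightarrow> (nat \<Rightarrow> real) \<Rightarrow> bool" where
  "freq_dirichlet_group \<beta> l \<longleftrightarrow> dirichlet_group \<beta> \<and> (\<forall>n. \<exists>\<gamma>. lifts_frequency \<beta> (l n) \<gamma>)"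

text \<open>The description is unique because \<open>\<beta>\<close> has dense range.\<close>

definition freq_character ::
    "(real \<Rightarrow> 'g::topological_ab_group_add) \<Rightarrow> real \<Rightarrow> 'g \<Rightarrow> complex" where
  "freq_character \<beta> x = (THE \<gamma>. lifts_frequency \<beta> x \<gamma>)"

text \<open>
  Regularity is part of the definition since the group need not be metrizable: the normalised Haar
  measure is the unique translation invariant regular Borel probability measure.
\<close>

definition haar_measure :: "'g::topological_ab_group_add measure \<Rightarrow> bool" where
  "haar_measure m \<longleftrightarrow>
     sets m = sets borel \<and> prob_space m \<and>
     (\<forall>x. \<forall>A\<in>sets m. emeasure m ((+) x ` A) = emeasure m A) \<and>
     (\<forall>A\<in>sets m. emeasure m A = (SUP K\<in>{K. compact K \<and> K \<subseteq> A}. emeasure m K))"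

definition lp_space :: "'g measure \<Rightarrow> ennreal \<Rightarrow> ('g \<Rightarrow> complex) set" where
  "lp_space m p = {f \<in> borel_measurable m.
     if p = \<infinity> then esssup m (\<lambda>x. ennreal (norm (f x))) < \<infinity>
     else integrable m (\<lambda>x. norm (f x) powr enn2real p)}"

definition lp_norm :: "'g measure \<Rightarrow> ennreal \<Rightarrow> ('g \<Rightarrow> complex) \<Rightarrow> real" where
  "lp_norm m p f =
     (if p = \<infinity> then enn2real (esssup m (\<lambda>x. ennreal (norm (f x))))
      else (\<integral>x. norm (f x) powr enn2real p \<partial>m) powr (1 / enn2real p))"

definition fourier_coeff :: "'g measure \<Rightarrow> ('g \<Rightarrow> complex) \<Rightarrow> ('g \<Rightarrow> complex) \<Rightarrow> complex" where
  "fourier_coeff m f \<gamma> = (\<integral>x. f x * cnj (\<gamma> x) \<partial>m)"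

definition hardy_functions ::
    "'g::topological_ab_group_add measure \<Rightarrow> (real \<Rightarrow> 'g) \<Rightarrow> ennreal \<Rightarrow> (nat \<Rightarrow> real) \<Rightarrow> ('g \<Rightarrow> complex) set"
  where
  "hardy_functions m \<beta> p l = {f \<in> lp_space m p.
     \<forall>\<gamma>. is_character \<gamma> \<and> (\<forall>n. \<gamma> \<noteq> freq_character \<beta> (l n)) \<longrightarrow> fourier_coeff m f \<gamma> = 0}"

definition has_dirichlet_coeffs ::
    "'g::topological_ab_group_add measure \<Rightarrow> (real \<Rightarrow> 'g) \<Rightarrow> (nat \<Rightarrow> real) \<Rightarrow> ('g \<Rightarrow> complex) \<Rightarrow>
      (nat \<Rightarrow> complex) \<Rightarrow> bool" where
  "has_dirichlet_coeffs m \<beta> l f a \<longleftrightarrow>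
     (\<forall>n. fourier_coeff m f (freq_character \<beta> (l n)) = a n)"

text \<open>A formal Dirichlet series with frequency \<open>l\<close> is identified with its coefficient sequence.\<close>

definition hardy_series ::
    "'g::topological_ab_group_add measure \<Rightarrow> (real \<Rightarrow> 'g) \<Rightarrow> ennreal \<Rightarrow> (nat \<Rightarrow> real) \<Rightarrow> (nat \<Rightarrow> complex) set"
  where
  "hardy_series m \<beta> p l = {a. \<exists>f\<in>hardy_functions m \<beta> p l. has_dirichlet_coeffs m \<beta> l f a}"

text \<open>
  The representing function is unique up to null sets, since an integrable function on a compact
  abelian group is determined by its Fourier coefficients.
\<close>

definition hardy_norm ::
    "'g::topological_ab_group_add measure \<Rightarrow> (real \<Rightarrow> 'g) \<Rightarrow> ennreal \<Rightarrow> (nat \<Rightarrow> real) \<Rightarrow>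
      (nat \<Rightarrow> complex) \<Rightarrow> real" where
  "hardy_norm m \<beta> p l a =
     (THE r. \<exists>f\<in>hardy_functions m \<beta> p l. has_dirichlet_coeffs m \<beta> l f a \<and> r = lp_norm m p f)"

text \<open>
  A linear isometry, not necessarily onto, between spaces of coefficient sequences; \<open>\<psi>\<close> is
  extensional, so that equality of two such maps is equality on \<open>X\<close>.
\<close>

definition into_isometry ::
    "(nat \<Rightarrow> complex) set \<Rightarrow> ((nat \<Rightarrow> complex) \<Rightarrow> real) \<Rightarrow>
     (nat \<Rightarrow> complex) set \<Rightarrow> ((nat \<Rightarrow> complex) \<Rightarrow> real) \<Rightarrow>
     ((nat \<Rightarrow> complex) \<Rightarrow> (nat \<Rightarrow> complex)) \<Rightarrow> bool" where
  "into_isometry X NX Y NY \<psi> \<longleftrightarrow>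
     \<psi> \<in> X \<rightarrow>\<^sub>E Y \<and>
     (\<forall>a\<in>X. \<forall>a'\<in>X. \<psi> (\<lambda>n. a n + a' n) = (\<lambda>n. \<psi> a n + \<psi> a' n)) \<and>
     (\<forall>c. \<forall>a\<in>X. \<psi> (\<lambda>n. c * a n) = (\<lambda>n. c * \<psi> a n)) \<and>
     (\<forall>a\<in>X. NY (\<psi> a) = NX a)"

text \<open>
  For \<open>k \<ge> 1\<close>, the coefficient of \<open>k\<^sup>-\<^sup>s\<close> in an ordinary Dirichlet series, which sits at
  index \<open>k - 1\<close>.
\<close>

definition ordinary_coeff :: "(nat \<Rightarrow> complex) \<Rightarrow> nat \<Rightarrow> complex" where
  "ordinary_coeff b k = b (k - 1)"

text \<open>
  The series with coefficients \<open>b\<close> is obtained from the one with coefficients \<open>a\<close> by moving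
  the \<open>n\<close>-th coefficient to the integer whose prime exponents are the \<open>n\<close>-th row of \<open>R\<close>.
  The coefficients at all other integers are 0. Without that clause, an isometry with the
  transferred coefficients need not be unique: for \<open>p = 1\<close>, \<open>l n = 2 * n + 1\<close> and the basis
  consisting of 1 alone, \<open>f\<close> may also be sent to \<open>z \<mapsto> f z * (1 + Re z)\<close> on the circle.
\<close>

definition transfers_coeffs ::
    "(nat \<Rightarrow> nat \<Rightarrow> nat) \<Rightarrow> (nat \<Rightarrow> complex) \<Rightarrow> (nat \<Rightarrow> complex) \<Rightarrow> bool" where
  "transfers_coeffs R a b \<longleftrightarrow>
     (\<forall>n. ordinary_coeff b (prime_monomial (R n)) = a n) \<and>
     (\<forall>k\<ge>1. (\<forall>n. k \<noteq> prime_monomial (R n)) \<longrightarrow> ordinary_coeff b k = 0)"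

end

theory Submission
  imports Defs
begin

text \<open>
  A series of the first space is represented by an integrable function \<open>f\<close> on a compact abelian group,
  and its image has to be represented by a function \<open>g\<close> on another one, with the Fourier coefficients
  of \<open>f\<close> moved from the frequencies \<open>\<Sum>j. \<alpha> j * B j\<close> to \<open>\<Sum>j. \<alpha> j * ln (p j)\<close>, \<open>p j\<close> the primes, and with the
  same norm. Uniqueness is clear, since the coefficients of the image are prescribed.

  The map between the frequencies extends to an injective homomorphism on their integer
  combinations, because \<open>B\<close> is rationally independent and the logarithms of the primes are independent
  by unique factorisation (\<open>matched_frequencies_zero_iff\<close>). So it matches characters of the two groups,
  the trivial one only with the trivial one. The integral of a character is 1 if it is trivial
  and 0 otherwise; therefore corresponding polynomials in matched characters have the same
  integral, and, as these polynomials are closed under products and conjugation, their moduli have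
  the same distribution (\<open>paired_poly_norm_distribution\<close>). In particular the correspondence preserves
  the norm of \<open>L\<^sub>1\<close>. If \<open>f\<close> is a limit in \<open>L\<^sub>1\<close> of polynomials in its own characters, the
  corresponding polynomials converge to some \<open>g\<close>, and \<open>norm f\<close> and \<open>norm g\<close> have the same distribution
  (\<open>transfer_L1_limit\<close>). Then all their \<open>L\<^sub>p\<close> norms agree, also for \<open>p = \<infinity>\<close>, where approximation in
  norm would fail.

  It remains to approximate an integrable function on a compact abelian group in \<open>L\<^sub>1\<close> by polynomials
  in the characters of its spectrum (\<open>spectral_approximation\<close>). This also shows that the Fourier
  coefficients determine the function, so that the norm of a series is well defined. It rests on the
  Peter-Weyl theorem, in the form that a nonzero continuous function has a nonzero Fourier coefficient
  (\<open>continuous_fourier_nonzero\<close>). The character is found by the power method: the normalised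
  convolution powers of \<open>f * tilde f\<close>, where \<open>tilde f x = cnj (f (- x))\<close>, converge uniformly to an idempotent
  of the convolution algebra (\<open>top_eigenprojection\<close>), and a minimal idempotent below it is, up to a
  factor, a character (\<open>character_below_idem\<close>).
\<close>

section \<open>Haar measure on a compact abelian group\<close>

locale compact_haar =
  fixes m :: "'g::{topological_ab_group_add,t2_space} measure"
  assumes compact_group: "compact (UNIV :: 'g set)"
    and haar: "haar_measure m"
begin

sublocale prob_space m
  using haar by (simp add: haar_measure_def)

lemma sets_m: "sets m = sets borel"
  using haar by (simp add: haar_measure_def)

lemma space_m [simp]: "space m = UNIV"
  using sets_eq_imp_space_eq[OF sets_m] by simp

lemma measurable_continuous:
  fixes f :: "'g \<Rightarrow> 'b::topological_space"
  shows "continuous_on UNIV f \<Longrightarrow> f \<in> borel_measurable m"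
  using measurable_cong_sets[OF sets_m refl] borel_measurable_continuous_onI by blast

lemma continuous_bounded:
  fixes f :: "'g \<Rightarrow> 'b::real_normed_vector"
  assumes "continuous_on UNIV f"
  obtains C where "C > 0" "\<And>x. norm (f x) \<le> C"
  using compact_imp_bounded[OF compact_continuous_image[OF assms compact_group]]
  unfolding bounded_pos by auto

lemma integrable_continuous:
  fixes f :: "'g \<Rightarrow> 'b::{banach,second_countable_topology}"
  assumes "continuous_on UNIV f"
  shows "integrable m f"
proof -
  obtain C where "\<And>x. norm (f x) \<le> C" using continuous_bounded[OF assms] by blast
  then show ?thesis
    by (intro integrable_const_bound[of _ C] measurable_continuous[OF assms]) auto
qed

lemma integrable_mult_continuous:
  fixes f g :: "'g \<Rightarrow> complex"
  assumes "integrable m f" "continuous_on UNIV g"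
  shows "integrable m (\<lambda>x. f x * g x)" "integrable m (\<lambda>x. g x * f x)"
proof -
  obtain C where C: "\<And>x. norm (g x) \<le> C" using continuous_bounded[OF assms(2)] by blast
  have g: "g \<in> borel_measurable m" by (rule measurable_continuous[OF assms(2)])
  show "integrable m (\<lambda>x. g x * f x)"
  proof (rule Bochner_Integration.integrable_bound[where f = "\<lambda>x. C * norm (f x)"])
    show "integrable m (\<lambda>x. C * norm (f x))" using assms by simp
    show "AE x in m. norm (g x * f x) \<le> norm (C * norm (f x))"
      using C by (auto simp: norm_mult intro!: mult_right_mono order_trans[OF _ abs_ge_self])
  qed (use g assms in measurable)
  then show "integrable m (\<lambda>x. f x * g x)" by (simp add: mult.commute)
qed

lemma translate_measurable: "(\<lambda>x. x + y) \<in> m \<rightarrow>\<^sub>M m"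
proof -
  have "(\<lambda>x. x + y) \<in> borel_measurable m"
    by (intro measurable_continuous continuous_intros)
  then show ?thesis using measurable_cong_sets[OF refl sets_m] by blast
qed

lemma distr_translate: "distr m m (\<lambda>x. x + y) = m"
proof (rule measure_eqI)
  fix A assume "A \<in> sets (distr m m (\<lambda>x. x + y))"
  then have A: "A \<in> sets m" by simp
  have "(\<lambda>x. x + y) -` A = (+) (- y) ` A"
    by (force simp: image_iff)
  then show "emeasure (distr m m (\<lambda>x. x + y)) A = emeasure m A"
    unfolding emeasure_distr[OF translate_measurable A] space_m Int_UNIV_right
    using haar A by (simp only: haar_measure_def)
qed simp

lemma integral_translate:
  fixes f :: "'g \<Rightarrow> 'b::{banach,second_countable_topology}"
  assumes "f \<in> borel_measurable m"
  shows "(\<integral>x. f (x + y) \<partial>m) = (\<integral>x. f x \<partial>m)"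
  using integral_distr[OF translate_measurable assms, of y] by (simp add: distr_translate)

lemma uniformly_continuous:
  fixes f :: "'g \<Rightarrow> 'b::real_normed_vector"
  assumes "continuous_on UNIV f" "e > 0"
  obtains U where "open U" "0 \<in> U" "\<And>x u. u \<in> U \<Longrightarrow> norm (f (x + u) - f x) < e"
proof -
  define W where "W = {z :: 'g \<times> 'g. norm (f (snd z + fst z) - f (snd z)) < e}"
  have c: "continuous_on UNIV (\<lambda>z :: 'g \<times> 'g. norm (f (snd z + fst z) - f (snd z)))"
    by (intro continuous_intros continuous_on_compose2[OF assms(1)]) auto
  have "open W" unfolding W_def by (intro open_Collect_less c continuous_intros)
  moreover have "{0} \<times> UNIV \<subseteq> W" using assms(2) by (auto simp: W_def)
  ultimately obtain U where "open U" "0 \<in> U" "U \<times> UNIV \<subseteq> W"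
    using Elementary_Topology.tube_lemma[OF compact_group, of W 0] by blast
  then have "norm (f (x + u) - f x) < e" if "u \<in> U" for x u
    using that by (auto simp: W_def subset_iff)
  with \<open>open U\<close> \<open>0 \<in> U\<close> show ?thesis using that[of U] by blast
qed

section \<open>Iterated integrals with a convolution kernel\<close>

text \<open>
  A finite open cover becomes a finite Borel partition by going through its members one at a
  time; \<open>p\<close> labels each point with a member that contains it.
\<close>

lemma simple_selection:
  fixes O' :: "'g \<Rightarrow> 'g set"
  assumes "finite T" "\<And>t. open (O' t)" "(\<Union>t\<in>T. O' t) = UNIV"
  obtains p where "simple_function m p" "\<And>x. x \<in> O' (p x)"
proof -
  have "\<exists>p. simple_function m p \<and> (\<forall>x\<in>(\<Union>t\<in>T. O' t). x \<in> O' (p x))"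
    using assms(1)
  proof induction
    case empty
    show ?case by (intro exI[of _ "\<lambda>_. 0"]) auto
  next
    case (insert t T)
    then obtain p where p: "simple_function m p" "\<forall>x\<in>(\<Union>t\<in>T. O' t). x \<in> O' (p x)" by blast
    have "simple_function m (\<lambda>x. if x \<in> O' t then t else p x)"
      using assms(2)[of t] by (intro simple_function_If_set p simple_function_const) (simp add: sets_m)
    moreover have "\<forall>x\<in>(\<Union>t\<in>insert t T. O' t). x \<in> O' (if x \<in> O' t then t else p x)"
      using p by auto
    ultimately show ?case by (intro exI[of _ "\<lambda>x. if x \<in> O' t then t else p x"] conjI)
  qed
  then show ?thesis using that assms(3) by auto
qed

text \<open>
  By uniform continuity, moving \<open>x\<close> within a small neighbourhood changes \<open>b (x - y)\<close> little for
  all \<open>y\<close> at once, and by compactness finitely many representatives of \<open>x\<close> suffice.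
\<close>

lemma simple_kernel_approximation:
  fixes b :: "'g \<Rightarrow> complex"
  assumes "continuous_on UNIV b" "e > 0"
  obtains p where "simple_function m p" "\<And>x y. norm (b (x - y) - b (p x - y)) < e"
proof -
  obtain U where U: "open U" "0 \<in> U" "\<And>x u. u \<in> U \<Longrightarrow> norm (b (x + u) - b x) < e"
    using uniformly_continuous[OF assms] by blast
  define V where "V t = (\<lambda>x. x - t) -` U" for t
  have V: "open (V t)" for t
    unfolding V_def by (intro open_vimage U continuous_intros)
  obtain T where T: "finite T" "UNIV \<subseteq> (\<Union>t\<in>T. V t)"
  proof (rule compactE_image[OF compact_group, of UNIV V])
    show "UNIV \<subseteq> (\<Union>t\<in>UNIV. V t)" using U(2) by (auto simp: V_def)
  qed (use V in auto)
  have UN: "(\<Union>t\<in>T. V t) = UNIV" using T(2) by auto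
  obtain p where p: "simple_function m p" "\<And>x. x \<in> V (p x)"
    using simple_selection[OF T(1) V UN] by blast
  have "norm (b (x - y) - b (p x - y)) < e" for x y
    using U(3)[of "x - p x" "p x - y"] p(2)[of x] by (simp add: V_def)
  with p(1) show ?thesis using that by blast
qed

definition conv :: "('g \<Rightarrow> complex) \<Rightarrow> ('g \<Rightarrow> complex) \<Rightarrow> 'g \<Rightarrow> complex" where
  "conv f g x = (\<integral>y. f y * g (x - y) \<partial>m)"

lemma integrable_conv:
  fixes f g :: "'g \<Rightarrow> complex"
  assumes "integrable m f" "continuous_on UNIV g"
  shows "integrable m (\<lambda>y. f y * g (x - y))"
proof -
  have "continuous_on UNIV (\<lambda>y. g (x - y))"
    by (intro continuous_on_compose2[OF assms(2)] continuous_intros) auto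
  then show ?thesis by (rule integrable_mult_continuous(1)[OF assms(1)])
qed

lemma norm_conv_le:
  assumes "integrable m f" "continuous_on UNIV g" "\<And>x. norm (g x) \<le> C"
  shows "norm (conv f g x) \<le> (\<integral>y. norm (f y) \<partial>m) * C"
proof -
  have "norm (conv f g x) \<le> (\<integral>y. norm (f y * g (x - y)) \<partial>m)"
    unfolding conv_def by (rule integral_norm_bound)
  also have "\<dots> \<le> (\<integral>y. norm (f y) * C \<partial>m)"
    using assms by (intro integral_mono integrable_norm integrable_conv integrable_mult_left)
      (auto simp: norm_mult mult_left_mono)
  finally show ?thesis by simp
qed

lemma continuous_conv:
  assumes "integrable m f" "continuous_on UNIV g"
  shows "continuous_on UNIV (conv f g)"
proof -
  have "(conv f g \<longlongrightarrow> conv f g x) (nhds x)" for x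
  proof (rule tendstoI)
    fix e :: real assume e: "e > 0"
    define C where "C = (\<integral>y. norm (f y) \<partial>m) + 1"
    have C: "C > 0" unfolding C_def by (intro add_nonneg_pos integral_nonneg_AE) auto
    obtain U where U: "open U" "0 \<in> U" "\<And>x u. u \<in> U \<Longrightarrow> norm (g (x + u) - g x) < e / C"
      using uniformly_continuous[OF assms(2) divide_pos_pos[OF e C]] by blast
    have "eventually (\<lambda>z. z \<in> (\<lambda>z. z - x) -` U) (nhds x)"
      by (intro eventually_nhds_in_open open_vimage U continuous_intros) (use U in auto)
    then show "eventually (\<lambda>z. dist (conv f g z) (conv f g x) < e) (nhds x)"
    proof eventually_elim
      case (elim z)
      have "norm (conv f g z - conv f g x) = norm (\<integral>y. f y * (g (z - y) - g (x - y)) \<partial>m)"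
        unfolding conv_def
        by (subst Bochner_Integration.integral_diff[symmetric])
          (auto intro: integrable_conv assms simp: algebra_simps)
      also have "\<dots> \<le> (\<integral>y. norm (f y * (g (z - y) - g (x - y))) \<partial>m)"
        by (rule integral_norm_bound)
      also have "\<dots> \<le> (\<integral>y. norm (f y) * (e / C) \<partial>m)"
      proof (intro integral_mono integrable_norm integrable_mult_left)
        show "integrable m (\<lambda>y. f y * (g (z - y) - g (x - y)))"
          using integrable_conv[OF assms, of z] integrable_conv[OF assms, of x]
          by (simp add: algebra_simps)
        fix y
        have "norm (g (z - y) - g (x - y)) \<le> e / C"
          using U(3)[of "z - x" "x - y"] elim by simp
        then show "norm (f y * (g (z - y) - g (x - y))) \<le> norm (f y) * (e / C)"
          unfolding norm_mult by (rule mult_left_mono) simp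
      qed (use assms in auto)
      also have "\<dots> = (C - 1) * (e / C)" by (simp add: C_def)
      also have "\<dots> < e" using e C by (simp add: field_simps)
      finally show ?case by (simp add: dist_norm)
    qed
  qed
  then show ?thesis
    unfolding continuous_on_def using tendsto_mono[OF at_within_le_nhds] by blast
qed

text \<open>
  The group need not be metrizable, so a Borel set of its square need not belong to the product
  \<open>\<sigma>\<close>-algebra, and the kernel \<open>b (x - y)\<close> need not be measurable for the product measure.
  Fubini's theorem is therefore replaced by an approximation: once \<open>x\<close> is replaced by a simple
  function \<open>p x\<close> in the kernel, both iterated integrals are the same finite sum \<open>S\<close>.
\<close>

lemma Fubini_kernel:
  fixes a b c :: "'g \<Rightarrow> complex"
  assumes a: "integrable m a" and b: "continuous_on UNIV b" and c: "integrable m c"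
  shows "(\<integral>x. a x * (\<integral>y. b (x - y) * c y \<partial>m) \<partial>m) = (\<integral>y. (\<integral>x. a x * b (x - y) \<partial>m) * c y \<partial>m)"
    (is "?l = ?r")
proof -
  define A where "A = (\<integral>x. norm (a x) \<partial>m)"
  define C where "C = (\<integral>x. norm (c x) \<partial>m)"
  have AC: "A \<ge> 0" "C \<ge> 0" by (simp_all add: A_def C_def)
  have bm: "continuous_on UNIV (\<lambda>x. b (- x))"
    by (intro continuous_on_compose2[OF b] continuous_intros) auto
  have L: "(\<integral>y. b (x - y) * c y \<partial>m) = conv c b x" for x
    by (simp add: conv_def mult.commute)
  have Rr: "(\<integral>x. a x * b (x - y) \<partial>m) = conv a (\<lambda>x. b (- x)) y" for y
    by (simp add: conv_def)
  have il: "integrable m (\<lambda>x. a x * conv c b x)"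
    by (intro integrable_mult_continuous a continuous_conv b c)
  have ir: "integrable m (\<lambda>y. conv a (\<lambda>x. b (- x)) y * c y)"
    by (intro integrable_mult_continuous a continuous_conv bm c)
  have cont_b: "continuous_on UNIV (\<lambda>y. b (z - y))" "continuous_on UNIV (\<lambda>x. b (x - z))" for z
    by (intro continuous_on_compose2[OF b] continuous_intros; simp)+
  have "norm (?l - ?r) \<le> e * (2 * A * C)" if e: "e > 0" for e
  proof -
    obtain p where p: "simple_function m p" "\<And>x y. norm (b (x - y) - b (p x - y)) < e"
      using simple_kernel_approximation[OF b e] by blast
    have fin: "finite (range p)" using p(1) by (simp add: simple_function_def)
    have meas: "p -` {z} \<in> sets m" for z
    proof (cases "z \<in> range p")
      case True then show ?thesis using p(1) by (auto simp: simple_function_def)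
    next
      case False then have "p -` {z} = {}" by auto
      then show ?thesis by simp
    qed
    define S where "S = (\<Sum>z\<in>range p. (\<integral>x. a x * indicator (p -` {z}) x \<partial>m) * conv c b z)"
    have ind: "integrable m (\<lambda>x. a x * indicator (p -` {z}) x)" for z
    proof (rule iffD1[OF Bochner_Integration.integrable_cong[OF refl]])
      show "integrable m (\<lambda>x. indicator (p -` {z}) x *\<^sub>R a x)"
        by (rule integrable_mult_indicator[OF meas a])
    qed (auto simp: indicator_def)
    have split: "h (p x) = (\<Sum>z\<in>range p. indicator (p -` {z}) x * h z)" for x and h :: "'g \<Rightarrow> complex"
    proof -
      have "(\<Sum>z\<in>range p. indicator (p -` {z}) x * h z) = (\<Sum>z\<in>range p. if z = p x then h z else 0)"
        by (intro sum.cong) (auto simp: indicator_def)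
      then show ?thesis using fin by simp
    qed
    have apl: "a x * conv c b (p x) = (\<Sum>z\<in>range p. a x * indicator (p -` {z}) x * conv c b z)" for x
      by (subst split) (simp add: sum_distrib_left mult.assoc)
    have l': "integrable m (\<lambda>x. a x * conv c b (p x))" "(\<integral>x. a x * conv c b (p x) \<partial>m) = S"
      unfolding apl S_def using ind by simp_all
    have apr: "a x * b (p x - y) = (\<Sum>z\<in>range p. a x * indicator (p -` {z}) x * b (z - y))" for x y
      by (subst split[of "\<lambda>z. b (z - y)"]) (simp add: sum_distrib_left mult.assoc)
    have r0: "integrable m (\<lambda>x. a x * b (p x - y))"
      "(\<integral>x. a x * b (p x - y) \<partial>m) = (\<Sum>z\<in>range p. (\<integral>x. a x * indicator (p -` {z}) x \<partial>m) * b (z - y))" for y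
      unfolding apr using ind by simp_all
    have r': "integrable m (\<lambda>y. (\<integral>x. a x * b (p x - y) \<partial>m) * c y)"
      "(\<integral>y. (\<integral>x. a x * b (p x - y) \<partial>m) * c y \<partial>m) = S"
      unfolding r0 sum_distrib_right S_def conv_def mult.assoc
      using integrable_mult_continuous(2)[OF c cont_b(1)]
      by (simp_all add: mult.commute[of "c _"])
    have 1: "norm (?l - S) \<le> A * (e * C)"
    proof -
      have n: "norm (conv c b x - conv c b (p x)) \<le> e * C" for x
      proof -
        have "norm (conv c b x - conv c b (p x)) = norm (\<integral>y. c y * (b (x - y) - b (p x - y)) \<partial>m)"
          unfolding conv_def
          by (subst Bochner_Integration.integral_diff[symmetric])
            (auto intro: integrable_conv c b simp: algebra_simps)
        also have "\<dots> \<le> (\<integral>y. norm (c y * (b (x - y) - b (p x - y))) \<partial>m)"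
          by (rule integral_norm_bound)
        also have "\<dots> \<le> (\<integral>y. norm (c y) * e \<partial>m)"
          by (intro integral_mono integrable_norm integrable_mult_left integrable_mult_continuous
              continuous_intros cont_b c)
            (auto simp: norm_mult less_imp_le[OF p(2)] mult_left_mono c)
        finally show ?thesis by (simp add: C_def mult.commute)
      qed
      have "norm (?l - S) = norm (\<integral>x. a x * conv c b x - a x * conv c b (p x) \<partial>m)"
        unfolding L using il l' by simp
      also have "\<dots> \<le> (\<integral>x. norm (a x * conv c b x - a x * conv c b (p x)) \<partial>m)"
        by (rule integral_norm_bound)
      also have "\<dots> \<le> (\<integral>x. norm (a x) * (e * C) \<partial>m)"
        using il l' a n
        by (intro integral_mono integrable_norm Bochner_Integration.integrable_diff integrable_mult_left)
          (auto simp: norm_mult right_diff_distrib[symmetric] mult_left_mono)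
      finally show ?thesis by (simp add: A_def)
    qed
    have 2: "norm (?r - S) \<le> (A * e) * C"
    proof -
      have n: "norm (conv a (\<lambda>x. b (- x)) y - (\<integral>x. a x * b (p x - y) \<partial>m)) \<le> A * e" for y
      proof -
        have "norm (conv a (\<lambda>x. b (- x)) y - (\<integral>x. a x * b (p x - y) \<partial>m))
            = norm (\<integral>x. a x * b (x - y) - a x * b (p x - y) \<partial>m)"
          unfolding conv_def using r0(1)[of y] integrable_mult_continuous(1)[OF a cont_b(2)] by simp
        also have "\<dots> \<le> (\<integral>x. norm (a x * b (x - y) - a x * b (p x - y)) \<partial>m)"
          by (rule integral_norm_bound)
        also have "\<dots> \<le> (\<integral>x. norm (a x) * e \<partial>m)"
          using r0(1)[of y] a integrable_mult_continuous(1)[OF a cont_b(2)]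
          by (intro integral_mono integrable_norm integrable_mult_left
              Bochner_Integration.integrable_diff)
            (auto simp: norm_mult less_imp_le[OF p(2)] mult_left_mono right_diff_distrib[symmetric])
        finally show ?thesis by (simp add: A_def)
      qed
      have "norm (?r - S) = norm (\<integral>y. conv a (\<lambda>x. b (- x)) y * c y - (\<integral>x. a x * b (p x - y) \<partial>m) * c y \<partial>m)"
        unfolding Rr using ir r' by simp
      also have "\<dots> \<le> (\<integral>y. norm (conv a (\<lambda>x. b (- x)) y * c y - (\<integral>x. a x * b (p x - y) \<partial>m) * c y) \<partial>m)"
        by (rule integral_norm_bound)
      also have "\<dots> \<le> (\<integral>y. (A * e) * norm (c y) \<partial>m)"
        using ir r' c n
        by (intro integral_mono integrable_norm Bochner_Integration.integrable_diff integrable_mult_right)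
          (auto simp: norm_mult left_diff_distrib[symmetric] mult_right_mono)
      finally show ?thesis by (simp add: C_def)
    qed
    have "norm (?l - ?r) \<le> norm (?l - S) + norm (?r - S)"
      using norm_triangle_ineq4[of "?l - S" "?r - S"] by simp
    then show ?thesis using 1 2 by (simp add: algebra_simps)
  qed
  note bnd = this
  have "norm (?l - ?r) \<le> 0"
  proof (rule field_le_epsilon)
    fix e :: real assume e: "e > 0"
    have "norm (?l - ?r) \<le> e / (2 * A * C + 1) * (2 * A * C)"
      using AC e by (intro bnd divide_pos_pos add_nonneg_pos mult_nonneg_nonneg) auto
    also have "\<dots> \<le> e" using AC e by (simp add: divide_simps add_nonneg_pos)
    finally show "norm (?l - ?r) \<le> 0 + e" by simp
  qed
  then show ?thesis by simp
qed

section \<open>The convolution algebra of continuous functions\<close>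

lemma prob_UNIV [simp]: "prob UNIV = 1"
  using prob_space by simp

text \<open>
  The involution of the convolution algebra: convolution with \<open>tilde f\<close> is the adjoint of
  convolution with \<open>f\<close>.
\<close>

definition tilde :: "('g \<Rightarrow> complex) \<Rightarrow> 'g \<Rightarrow> complex" where
  "tilde f x = cnj (f (- x))"

definition sq_norm :: "('g \<Rightarrow> complex) \<Rightarrow> real" where
  "sq_norm f = (\<integral>x. (norm (f x))\<^sup>2 \<partial>m)"

abbreviation cont :: "('g \<Rightarrow> complex) \<Rightarrow> bool" where
  "cont f \<equiv> continuous_on UNIV f"

lemma cont_shift: "cont f \<Longrightarrow> cont (\<lambda>x. f (x + a))"
  by (rule continuous_on_compose2[of UNIV f]) (auto intro!: continuous_intros)

lemma cont_diff: "cont f \<Longrightarrow> cont (\<lambda>x. f (a - x))" "cont f \<Longrightarrow> cont (\<lambda>x. f (x - a))"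
  by (rule continuous_on_compose2[of UNIV f]; auto intro!: continuous_intros)+

lemma cont_reflect: "cont f \<Longrightarrow> cont (\<lambda>x. f (- x))"
  by (rule continuous_on_compose2[of UNIV f]) (auto intro!: continuous_intros)

lemma cont_tilde: "cont f \<Longrightarrow> cont (tilde f)"
  unfolding tilde_def by (intro continuous_intros cont_reflect)

lemma cont_conv: "cont f \<Longrightarrow> cont g \<Longrightarrow> cont (conv f g)"
  by (intro continuous_conv integrable_continuous)

lemma integral_shift:
  fixes f :: "'g \<Rightarrow> 'b::{banach,second_countable_topology}"
  shows "continuous_on UNIV f \<Longrightarrow> (\<integral>x. f (x + a) \<partial>m) = (\<integral>x. f x \<partial>m)"
  by (intro integral_translate measurable_continuous)

lemma integral_shift_diff:
  fixes f :: "'g \<Rightarrow> 'b::{banach,second_countable_topology}"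
  shows "continuous_on UNIV f \<Longrightarrow> (\<integral>x. f (x - a) \<partial>m) = (\<integral>x. f x \<partial>m)"
  using integral_shift[of f "- a"] by simp

text \<open>
  Invariance under translations implies invariance under reflection: integrating \<open>f (x - y)\<close> over
  both variables gives the integral of \<open>f\<close> if \<open>x\<close> comes first, and that of its reflection if
  \<open>y\<close> comes first.
\<close>

lemma integral_reflect:
  assumes "cont f"
  shows "(\<integral>x. f (- x) \<partial>m) = (\<integral>x. f x \<partial>m)"
proof -
  have "(\<integral>x. 1 * (\<integral>y. f (x - y) * 1 \<partial>m) \<partial>m) = (\<integral>y. (\<integral>x. 1 * f (x - y) \<partial>m) * 1 \<partial>m)"
    by (rule Fubini_kernel) (use assms in auto)
  moreover have "(\<integral>y. f (x - y) \<partial>m) = (\<integral>y. f (- y) \<partial>m)" for x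
    using integral_shift[OF cont_reflect[OF assms], of "- x"] by simp
  moreover have "(\<integral>x. f (x - y) \<partial>m) = (\<integral>x. f x \<partial>m)" for y
    by (rule integral_shift_diff[OF assms])
  ultimately show ?thesis by simp
qed

lemma integral_reflect_shift: "cont f \<Longrightarrow> (\<integral>y. f (x - y) \<partial>m) = (\<integral>y. f y \<partial>m)"
  using integral_shift[OF cont_reflect, of f "- x"] integral_reflect[of f] by simp

lemma conv_commute:
  assumes "cont f" "cont g"
  shows "conv f g = conv g f"
proof
  fix x
  have "(\<integral>y. f (x - y) * g (x - (x - y)) \<partial>m) = (\<integral>y. f y * g (x - y) \<partial>m)"
    by (rule integral_reflect_shift[of "\<lambda>y. f y * g (x - y)"])
      (intro continuous_intros assms cont_diff)
  then show "conv f g x = conv g f x" by (simp add: conv_def mult.commute)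
qed

lemma conv_assoc:
  assumes "integrable m f" "cont g" "cont h"
  shows "conv (conv f g) h = conv f (conv g h)"
proof
  fix x
  have "(\<integral>y. h (x - y) * (\<integral>z. g (y - z) * f z \<partial>m) \<partial>m)
      = (\<integral>z. (\<integral>y. h (x - y) * g (y - z) \<partial>m) * f z \<partial>m)"
    by (intro Fubini_kernel integrable_continuous cont_diff assms)
  moreover have "(\<integral>y. h (x - y) * g (y - z) \<partial>m) = conv g h (x - z)" for z
  proof -
    have "(\<integral>y. h (x - (y + z)) * g (y + z - z) \<partial>m) = (\<integral>y. h (x - y) * g (y - z) \<partial>m)"
      by (rule integral_shift[of "\<lambda>y. h (x - y) * g (y - z)"])
        (intro continuous_intros assms cont_diff)
    then show ?thesis by (simp add: conv_def mult.commute algebra_simps)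
  qed
  ultimately show "conv (conv f g) h x = conv f (conv g h) x"
    by (simp add: conv_def mult.commute)
qed

lemma conv_shift: "conv f (\<lambda>x. g (x + a)) = (\<lambda>x. conv f g (x + a))"
  by (simp add: conv_def fun_eq_iff algebra_simps)

lemma conv_add:
  assumes "integrable m f" "cont g" "cont h"
  shows "conv f (\<lambda>x. g x + h x) = (\<lambda>x. conv f g x + conv f h x)"
  unfolding conv_def distrib_left
  by (intro ext Bochner_Integration.integral_add integrable_conv assms)

lemma conv_diff:
  assumes "integrable m f" "cont g" "cont h"
  shows "conv f (\<lambda>x. g x - h x) = (\<lambda>x. conv f g x - conv f h x)"
  unfolding conv_def right_diff_distrib
  by (intro ext Bochner_Integration.integral_diff integrable_conv assms)

lemma conv_scale: "conv f (\<lambda>x. c * g x) = (\<lambda>x. c * conv f g x)"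
  by (simp add: conv_def fun_eq_iff mult.left_commute)

lemma tilde_tilde [simp]: "tilde (tilde f) = f"
  by (simp add: tilde_def fun_eq_iff)

lemma tilde_conv:
  assumes "cont f" "cont g"
  shows "tilde (conv f g) = conv (tilde f) (tilde g)"
proof
  fix x
  have "(\<integral>y. cnj (f (- y) * g (- x - - y)) \<partial>m) = (\<integral>y. cnj (f y * g (- x - y)) \<partial>m)"
    by (rule integral_reflect[of "\<lambda>y. cnj (f y * g (- x - y))"])
      (intro continuous_intros cont_diff assms)
  moreover have "- (x - y) = - x - - y" for y by simp
  ultimately show "tilde (conv f g) x = conv (tilde f) (tilde g) x"
    unfolding tilde_def conv_def by (subst Bochner_Integration.integral_cnj[symmetric]) simp
qed

lemma integrable_norm2: "cont f \<Longrightarrow> integrable m (\<lambda>x. (norm (f x))\<^sup>2)"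
  by (intro integrable_continuous continuous_intros)

lemma sq_norm_nonneg: "sq_norm f \<ge> 0"
  by (simp add: sq_norm_def)

text \<open>
  The Cauchy-Schwarz inequality in additive form, from the square of \<open>t * norm (f x) - norm (g x)\<close>.
  The weight \<open>t\<close> makes the bound useful when only one of the factors is small.
\<close>

lemma norm_integral_mult_le:
  assumes "cont f" "cont g" "t > 0"
  shows "norm (\<integral>x. f x * g x \<partial>m) \<le> (t * sq_norm f + sq_norm g / t) / 2"
proof -
  have "norm (\<integral>x. f x * g x \<partial>m) \<le> (\<integral>x. norm (f x * g x) \<partial>m)"
    by (rule integral_norm_bound)
  also have "\<dots> \<le> (\<integral>x. (t * (norm (f x))\<^sup>2 + (norm (g x))\<^sup>2 / t) / 2 \<partial>m)"
  proof (intro integral_mono)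
    show "integrable m (\<lambda>x. norm (f x * g x))"
      by (intro integrable_continuous continuous_intros assms)
    show "integrable m (\<lambda>x. (t * (norm (f x))\<^sup>2 + (norm (g x))\<^sup>2 / t) / 2)"
      by (intro integrable_continuous continuous_intros assms) (use assms in auto)
    fix x
    have "0 \<le> (t * norm (f x) - norm (g x))\<^sup>2" by simp
    then have "2 * t * (norm (f x) * norm (g x)) \<le> t * (t * (norm (f x))\<^sup>2) + (norm (g x))\<^sup>2"
      by (simp add: power2_diff power_mult_distrib algebra_simps power2_eq_square)
    then show "norm (f x * g x) \<le> (t * (norm (f x))\<^sup>2 + (norm (g x))\<^sup>2 / t) / 2"
      using assms(3) by (simp add: norm_mult field_simps)
  qed
  also have "\<dots> = (t * sq_norm f + sq_norm g / t) / 2"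
    unfolding sq_norm_def using assms by (simp add: integrable_norm2)
  finally show ?thesis .
qed

lemma conv_tilde_zero: "conv f (tilde f) 0 = of_real (sq_norm f)"
proof -
  have "f y * cnj (f y) = of_real ((norm (f y))\<^sup>2)" for y
    using complex_norm_square[of "f y"] by simp
  then show ?thesis by (simp add: conv_def tilde_def sq_norm_def del: of_real_power)
qed

lemma sq_norm_shift: "cont f \<Longrightarrow> sq_norm (\<lambda>x. f (x + a)) = sq_norm f"
  unfolding sq_norm_def by (rule integral_translate[of "\<lambda>x. (norm (f x))\<^sup>2"])
    (intro measurable_continuous continuous_intros)

lemma sq_norm_tilde:
  assumes "cont f"
  shows "sq_norm (\<lambda>y. tilde f (x - y)) = sq_norm f"
proof -
  have "sq_norm (\<lambda>y. tilde f (x - y)) = sq_norm (\<lambda>y. f (y + - x))"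
    by (simp add: sq_norm_def tilde_def)
  then show ?thesis by (simp only: sq_norm_shift[OF assms])
qed

text \<open>
  A function of the form \<open>f * tilde f\<close> is positive definite, so it is dominated by its value
  at 0, which is \<open>sq_norm f\<close>.
\<close>

lemma norm_conv_tilde_le:
  assumes "cont f"
  shows "norm (conv f (tilde f) x) \<le> sq_norm f"
proof -
  show ?thesis
    using sq_norm_tilde[OF assms, of x] norm_integral_mult_le[OF assms cont_diff(1)[OF cont_tilde[OF assms]], of 1 x]
    by (simp add: conv_def)
qed

text \<open>
  Finitely many translates of a nonempty open set cover the group, and all of them have the same
  measure.
\<close>

lemma emeasure_open_pos:
  assumes "open U" "x \<in> U"
  shows "emeasure m U > 0"
proof (rule ccontr)
  assume "\<not> emeasure m U > 0"
  then have 0: "emeasure m U = 0" by simp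
  have U: "U \<in> sets m" using assms by (simp add: sets_m)
  have op: "open ((\<lambda>y. y + t) -` U)" for t
    by (intro open_vimage assms continuous_intros)
  have z: "emeasure m ((\<lambda>y. y + t) -` U) = 0" for t
    using emeasure_distr[OF translate_measurable U, of t] 0 by (simp add: distr_translate)
  obtain T where T: "finite T" "UNIV \<subseteq> (\<Union>t\<in>T. (\<lambda>y. y + t) -` U)"
  proof (rule compactE_image[OF compact_group, of UNIV "\<lambda>t. (\<lambda>y. y + t) -` U"])
    show "UNIV \<subseteq> (\<Union>t\<in>UNIV. (\<lambda>y. y + t) -` U)"
    proof
      fix y show "y \<in> (\<Union>t\<in>UNIV. (\<lambda>y. y + t) -` U)"
        using assms(2) by (intro UN_I[of "x - y"]) auto
    qed
  qed (use op in auto)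
  have "(\<lambda>y. y + t) -` U \<in> null_sets m" for t
    using z op by (auto simp: null_sets_def sets_m)
  then have "(\<Union>t\<in>T. (\<lambda>y. y + t) -` U) \<in> null_sets m"
    using T(1) by (intro null_sets.finite_UN) auto
  moreover have "(\<Union>t\<in>T. (\<lambda>y. y + t) -` U) = UNIV" using T by auto
  ultimately have "emeasure m (space m) = 0" by auto
  then show False using emeasure_space_1 by simp
qed

lemma sq_norm_eq_0:
  assumes "cont f" "sq_norm f = 0"
  shows "f x = 0"
proof (rule ccontr)
  assume "f x \<noteq> 0"
  define U where "U = f -` (- {0})"
  have "open U" unfolding U_def by (intro open_vimage assms) auto
  then have pos: "emeasure m U > 0"
    using emeasure_open_pos[of U x] \<open>f x \<noteq> 0\<close> by (simp add: U_def)
  have "AE x in m. (norm (f x))\<^sup>2 = 0"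
    using assms integral_nonneg_eq_0_iff_AE[OF integrable_norm2[OF assms(1)]] by (simp add: sq_norm_def)
  then have "AE x in m. x \<notin> U" by (auto simp: U_def)
  moreover have "U \<in> sets m" using \<open>open U\<close> by (simp add: sets_m)
  ultimately have "emeasure m U = 0"
    by (simp add: AE_iff_measurable[of U m "\<lambda>x. x \<notin> U"])
  then show False using pos by simp
qed

lemma sq_norm_pos: "cont f \<Longrightarrow> f x \<noteq> 0 \<Longrightarrow> sq_norm f > 0"
  using sq_norm_eq_0 sq_norm_nonneg[of f] by fastforce

end

section \<open>The power method\<close>

text \<open>
  Here \<open>a n\<close> stands for the trace of the power \<open>n + 1\<close> of a positive compact operator, that is, for
  the sum of the powers of its eigenvalues; \<open>r\<close> is the largest eigenvalue and \<open>l\<close> its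
  multiplicity. The convexity assumption says that \<open>a (n + 1)\<^sup>2 \<le> a n * a (n + 2)\<close>, so the quotients
  of successive terms increase; submultiplicativity bounds them. It also gives \<open>r ^ (n + 1) \<le> a n\<close>,
  which prevents the normalised sequence from tending to 0.
\<close>

lemma power_sequence_limit:
  fixes a :: "nat \<Rightarrow> real"
  assumes pos: "a 0 > 0" "a 1 > 0"
    and convex: "\<And>n t. 2 * t * a (Suc n) \<le> a (Suc (Suc n)) + t\<^sup>2 * a n"
    and submult: "\<And>m n. a (m + n + 1) \<le> a m * a n"
  obtains r l where "r > 0" "l \<ge> 1" "(\<lambda>n. a n / r ^ Suc n) \<longlonglongrightarrow> l"
proof -
  have ap: "a n > 0 \<and> a (Suc n) > 0" for n
  proof (induction n)
    case (Suc n)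
    have "0 < 2 * (a (Suc n) / a n) * a (Suc n) - (a (Suc n) / a n)\<^sup>2 * a n"
      using Suc by (simp add: power2_eq_square)
    with convex[of "a (Suc n) / a n" n] Suc show ?case by simp
  qed (use pos in auto)
  then have ap: "a n > 0" for n by simp
  define q where "q n = a (Suc n) / a n" for n
  have qp: "q n > 0" for n using ap by (simp add: q_def)
  have "q n \<le> q (Suc n)" for n
    using convex[of "q n" n] ap[of n] ap[of "Suc n"]
    by (simp add: q_def power2_eq_square field_simps)
  then have inc: "incseq q" by (rule incseq_SucI)
  have qb: "q n \<le> a 0" for n
    using submult[of n 0] ap[of n] by (simp add: q_def field_simps)
  obtain r where r: "q \<longlonglongrightarrow> r" "\<And>n. q n \<le> r"
    using incseq_convergent[OF inc, of "a 0"] qb by blast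
  have rp: "r > 0" using qp[of 0] r(2)[of 0] by linarith
  define s where "s n = a n / r ^ Suc n" for n
  have "s (Suc n) \<le> s n" for n
  proof -
    have "s (Suc n) = s n * (q n / r)" using ap[of n] by (simp add: s_def q_def)
    also have "\<dots> \<le> s n * 1" using r(2)[of n] rp ap[of n]
      by (intro mult_left_mono) (auto simp: s_def)
    finally show ?thesis by simp
  qed
  then have dec: "decseq s" by (rule decseq_SucI)
  have lower: "1 \<le> s n" for n
  proof -
    have *: "q k ^ j * a k \<le> a (k + j)" for k j
    proof (induction j)
      case (Suc j)
      have "q k ^ Suc j * a k \<le> q k * a (k + j)" using Suc qp[of k] by simp
      also have "\<dots> \<le> q (k + j) * a (k + j)"
        using incseqD[OF inc, of k "k + j"] ap[of "k + j"] by simp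
      also have "\<dots> = a (k + Suc j)" using ap[of "k + j"] by (simp add: q_def)
      finally show ?case .
    qed simp
    have "q k ^ Suc n \<le> a n" for k
    proof -
      have "q k ^ Suc n * a k \<le> a (k + Suc n)" by (rule *)
      also have "\<dots> \<le> a n * a k" using submult[of n k] by (simp add: add.commute)
      finally show ?thesis using ap[of k] by simp
    qed
    moreover have "(\<lambda>k. q k ^ Suc n) \<longlonglongrightarrow> r ^ Suc n" by (intro tendsto_power r)
    ultimately have "r ^ Suc n \<le> a n" by (intro LIMSEQ_le_const2) auto
    then show ?thesis using rp by (simp add: s_def)
  qed
  obtain l where "s \<longlonglongrightarrow> l" using decseq_convergent[OF dec, of 1] lower by blast
  moreover from this have "l \<ge> 1" using lower by (intro LIMSEQ_le_const) auto
  ultimately show ?thesis using that[of r l] rp by (simp add: s_def[abs_def])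
qed

context compact_haar
begin

text \<open>
  The algebra has no unit to start from, so \<open>cpow f n\<close> is the convolution power of exponent
  \<open>n + 1\<close>.
\<close>

primrec cpow :: "('g \<Rightarrow> complex) \<Rightarrow> nat \<Rightarrow> 'g \<Rightarrow> complex" where
  "cpow f 0 = f"
| "cpow f (Suc n) = conv f (cpow f n)"

lemma cont_cpow: "cont f \<Longrightarrow> cont (cpow f n)"
  by (induction n) (simp_all add: cont_conv)

lemma conv_cpow: "cont f \<Longrightarrow> conv (cpow f k) (cpow f n) = cpow f (k + n + 1)"
  by (induction k) (simp_all add: conv_assoc cont_cpow integrable_continuous)

lemma tilde_cpow: "cont f \<Longrightarrow> tilde f = f \<Longrightarrow> tilde (cpow f n) = cpow f n"
  by (induction n) (simp_all add: tilde_conv cont_cpow)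

text \<open>
  With \<open>\<phi> = g * tilde g\<close>, an even power \<open>\<phi>\<^sup>2\<^sup>k\<close> is the positive square of \<open>\<phi>\<^sup>k\<close>, an odd power
  \<open>\<phi>\<^sup>2\<^sup>k\<^sup>+\<^sup>1\<close> that of \<open>\<phi>\<^sup>k * g\<close>; hence the induction in steps of two.
\<close>

lemma cpow_positive:
  assumes "cont g"
  shows "\<exists>q. cont q \<and> cpow (conv g (tilde g)) n = conv q (tilde q)"
proof -
  define \<phi> where "\<phi> = conv g (tilde g)"
  have c: "cont \<phi>" unfolding \<phi>_def by (intro cont_conv cont_tilde assms)
  have t: "tilde \<phi> = \<phi>"
    unfolding \<phi>_def using assms by (simp add: tilde_conv cont_tilde conv_commute)
  have "\<exists>q. cont q \<and> cpow \<phi> n = conv q (tilde q)"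
  proof (induction n rule: induct_nat_012)
    case 0 then show ?case using assms by (auto simp: \<phi>_def)
  next
    case 1 then show ?case using c t by auto
  next
    case (ge2 n)
    then obtain q where q: "cont q" "cpow \<phi> n = conv q (tilde q)" by blast
    have tq: "cont (tilde q)" by (intro cont_tilde q)
    have "conv (conv \<phi> q) (tilde (conv \<phi> q)) = conv (conv \<phi> q) (conv \<phi> (tilde q))"
      by (simp add: tilde_conv c q t)
    also have "\<dots> = conv \<phi> (conv (conv q \<phi>) (tilde q))"
      using c q tq by (simp add: conv_assoc cont_conv integrable_continuous)
    also have "\<dots> = conv \<phi> (conv \<phi> (conv q (tilde q)))"
      using c q tq by (simp add: conv_commute[of q \<phi>] conv_assoc integrable_continuous)
    finally have "cpow \<phi> (Suc (Suc n)) = conv (conv \<phi> q) (tilde (conv \<phi> q))"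
      by (simp add: q)
    then show ?case using cont_conv[OF c q(1)] by blast
  qed
  then show ?thesis by (simp add: \<phi>_def)
qed

lemma conv_tilde_zero_eq: "conv f (tilde g) 0 = (\<integral>x. f x * cnj (g x) \<partial>m)"
  by (simp add: conv_def tilde_def)

lemma sq_norm_diff:
  assumes "cont f" "cont g"
  shows "sq_norm (\<lambda>x. f x - of_real t * g x) = sq_norm f - 2 * t * Re (\<integral>x. f x * cnj (g x) \<partial>m) + t\<^sup>2 * sq_norm g"
proof -
  have *: "(norm (f x - of_real t * g x))\<^sup>2
      = (norm (f x))\<^sup>2 - 2 * t * Re (f x * cnj (g x)) + t\<^sup>2 * (norm (g x))\<^sup>2" for x
    unfolding cmod_power2 by (simp add: algebra_simps power2_eq_square)
  have i: "integrable m (\<lambda>x. f x * cnj (g x))"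
    by (intro integrable_continuous continuous_intros assms)
  have "sq_norm (\<lambda>x. f x - of_real t * g x)
      = sq_norm f - 2 * t * (\<integral>x. Re (f x * cnj (g x)) \<partial>m) + t\<^sup>2 * sq_norm g"
  proof -
    have "integrable m (\<lambda>x. Re (f x * cnj (g x)))" using i by (rule integrable_Re)
    then show ?thesis
      unfolding sq_norm_def *
      using integrable_norm2[OF assms(1)] integrable_norm2[OF assms(2)]
      by (simp del: times_complex.simps)
  qed
  then show ?thesis using integral_Re[OF i] by simp
qed

lemma conv_uniform_limit:
  assumes u: "uniform_limit UNIV u U sequentially" "\<And>n. cont (u n)" and h: "integrable m h"
  shows "(\<lambda>n. conv h (u n) x) \<longlonglongrightarrow> conv h U x"
proof (rule LIMSEQ_I)
  have U: "cont U"
    using uniform_limit_theorem[OF _ u(1)] u(2) by simp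
  fix e :: real assume e: "e > 0"
  define C where "C = (\<integral>y. norm (h y) \<partial>m) + 1"
  have C: "C > 0" unfolding C_def by (intro add_nonneg_pos integral_nonneg_AE) auto
  have "eventually (\<lambda>n. \<forall>x\<in>UNIV. dist (u n x) (U x) < e / C) sequentially"
    using u(1) divide_pos_pos[OF e C] unfolding uniform_limit_iff by blast
  then obtain N where N: "\<And>n x. n \<ge> N \<Longrightarrow> norm (u n x - U x) < e / C"
    by (auto simp: eventually_sequentially dist_norm)
  have "norm (conv h (u n) x - conv h U x) < e" if "n \<ge> N" for n
  proof -
    have "conv h (u n) x - conv h U x = conv h (\<lambda>x. u n x - U x) x"
      by (simp add: conv_diff[OF h u(2) U])
    also have "norm \<dots> \<le> (\<integral>y. norm (h y) \<partial>m) * (e / C)"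
      by (intro norm_conv_le h continuous_intros u(2) U less_imp_le[OF N[OF that]])
    also have "\<dots> = (C - 1) * (e / C)" by (simp add: C_def)
    also have "\<dots> < e" using e C by (simp add: field_simps)
    finally show ?thesis .
  qed
  then show "\<exists>N. \<forall>n\<ge>N. norm (conv h (u n) x - conv h U x) < e" by blast
qed

text \<open>
  Convolution with such a function is an orthogonal projection that commutes with translations; its
  rank is \<open>sq_norm e\<close>.
\<close>

definition idem :: "('g \<Rightarrow> complex) \<Rightarrow> bool" where
  "idem e \<longleftrightarrow> cont e \<and> tilde e = e \<and> conv e e = e"

text \<open>
  The power method. Convolution with \<open>\<phi> = g * tilde g\<close> is a positive operator, and its powers,
  normalised by those of the largest eigenvalue \<open>r\<close>, converge to the projection onto the
  corresponding eigenspace. The value of a power of \<open>\<phi>\<close> at 0 is the trace of the operator. As the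
  inner product of two powers is again such a value, \<open>power_sequence_limit\<close> yields \<open>r\<close> and shows
  that the normalised powers \<open>\<psi>\<close> form a Cauchy sequence in mean square. One more convolution with
  \<open>\<phi>\<close> turns this into uniform convergence, so the limit is continuous; it is nonzero because its
  value at 0 is the limit \<open>l \<ge> 1\<close>.
\<close>

lemma top_eigenprojection:
  assumes g: "cont g" and g0: "g x\<^sub>0 \<noteq> 0"
  obtains r :: real and e :: "'g \<Rightarrow> complex" where "r > 0" "idem e" "e 0 \<noteq> 0"
    "conv (conv g (tilde g)) e = (\<lambda>x. r * e x)"
proof -
  define \<phi> where "\<phi> = conv g (tilde g)"
  have c: "cont \<phi>" unfolding \<phi>_def by (intro cont_conv cont_tilde g)
  have t: "tilde \<phi> = \<phi>"
    unfolding \<phi>_def using g by (simp add: tilde_conv cont_tilde conv_commute)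
  define a where "a n = Re (cpow \<phi> n 0)" for n
  have cc: "cont (cpow \<phi> n)" and ic: "integrable m (cpow \<phi> n)" for n
    by (auto intro: cont_cpow integrable_continuous c)
  have pos: "\<exists>q. cont q \<and> cpow \<phi> n = conv q (tilde q)" for n
    unfolding \<phi>_def by (rule cpow_positive[OF g])
  have az: "cpow \<phi> n 0 = of_real (a n)" for n
    using pos[of n] by (auto simp: a_def conv_tilde_zero)
  have ab: "norm (cpow \<phi> n x) \<le> a n" for n x
    using pos[of n] norm_conv_tilde_le by (auto simp: a_def conv_tilde_zero)
  have inner: "(\<integral>x. cpow \<phi> k x * cnj (cpow \<phi> n x) \<partial>m) = of_real (a (k + n + 1))" for k n
    using conv_tilde_zero_eq[of "cpow \<phi> k" "cpow \<phi> n"]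
    by (simp only: tilde_cpow[OF c t] conv_cpow[OF c] az)
  obtain r l where r: "r > 0" "l \<ge> 1" and lim: "(\<lambda>n. a n / r ^ Suc n) \<longlonglongrightarrow> l"
  proof (rule power_sequence_limit[of a])
    show a0: "a 0 > 0"
      using sq_norm_pos[OF g g0] by (simp add: a_def \<phi>_def conv_tilde_zero)
    have "sq_norm \<phi> > 0" using a0 sq_norm_pos[OF c, of 0] by (force simp: a_def)
    moreover have "a 1 = sq_norm \<phi>"
      using conv_tilde_zero[of \<phi>] t by (simp add: a_def)
    ultimately show "a 1 > 0" by simp
    show "a (k + n + 1) \<le> a k * a n" for k n
    proof -
      have "a (k + n + 1) = norm (conv (cpow \<phi> k) (cpow \<phi> n) 0)"
        unfolding conv_cpow[OF c] az using ab[of "k + n + 1" 0]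
        by (smt (verit) norm_ge_zero norm_of_real)
      also have "\<dots> \<le> (\<integral>y. norm (cpow \<phi> k y) \<partial>m) * a n"
        by (intro norm_conv_le ic cc ab)
      also have "\<dots> \<le> (\<integral>y. a k \<partial>m) * a n"
      proof (intro mult_right_mono integral_mono)
        show "0 \<le> a n" using ab[of n 0] by (smt (verit) norm_ge_zero)
      qed (use ic ab in auto)
      finally show ?thesis by simp
    qed
    show "2 * t * a (Suc n) \<le> a (Suc (Suc n)) + t\<^sup>2 * a n" for n t
    proof -
      obtain q where q: "cont q" "cpow \<phi> n = conv q (tilde q)" using pos by blast
      have tq: "cont (tilde q)" by (intro cont_tilde q)
      define u where "u = conv \<phi> q"
      have u: "cont u" unfolding u_def by (intro cont_conv c q)
      have a0: "a n = sq_norm q" by (simp add: a_def q(2) conv_tilde_zero)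
      have "cpow \<phi> (Suc n) = conv u (tilde q)"
        unfolding u_def using c q tq by (simp add: conv_assoc integrable_continuous)
      then have a1: "a (Suc n) = Re (\<integral>x. u x * cnj (q x) \<partial>m)"
        by (simp only: a_def conv_tilde_zero_eq)
      have "cpow \<phi> (Suc (Suc n)) = conv \<phi> (conv u (tilde q))"
        using \<open>cpow \<phi> (Suc n) = conv u (tilde q)\<close> by simp
      also have "\<dots> = conv (conv u \<phi>) (tilde q)"
        using c q tq u conv_assoc[of \<phi> u "tilde q"] by (simp add: conv_commute[of u \<phi>] integrable_continuous)
      also have "\<dots> = conv u (tilde u)"
        unfolding u_def[of] using c q tq u by (simp add: conv_assoc tilde_conv t u_def integrable_continuous cont_conv)
      finally have a2: "a (Suc (Suc n)) = sq_norm u" by (simp only: a_def conv_tilde_zero) simp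
      have "0 \<le> sq_norm (\<lambda>x. u x - of_real t * q x)" by (rule sq_norm_nonneg)
      also have "\<dots> = a (Suc (Suc n)) - 2 * t * a (Suc n) + t\<^sup>2 * a n"
        unfolding a0 a1 a2 by (rule sq_norm_diff[OF u q(1)])
      finally show ?thesis by simp
    qed
  qed
  define s where "s n = a n / r ^ Suc n" for n
  have s: "s \<longlonglongrightarrow> l" using lim by (simp add: s_def[abs_def])
  define \<psi> where "\<psi> n x = cpow \<phi> n x / of_real (r ^ Suc n)" for n x
  have \<psi>c: "cont (\<psi> n)" for n
    unfolding \<psi>_def by (intro continuous_intros cc) (use r in auto)
  have \<psi>conv: "conv (\<psi> k) (\<psi> n) = \<psi> (k + n + 1)" for k n
  proof
    fix x
    have "conv (\<psi> k) (\<psi> n) x = conv (cpow \<phi> k) (cpow \<phi> n) x / of_real (r ^ Suc k * r ^ Suc n)"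
      unfolding conv_def \<psi>_def
      by (simp add: mult.commute mult.left_commute flip: integral_divide_zero)
    then show "conv (\<psi> k) (\<psi> n) x = \<psi> (k + n + 1) x"
      by (simp add: conv_cpow[OF c] \<psi>_def power_add mult_ac)
  qed
  have \<psi>step: "conv \<phi> (\<psi> n) x = r * \<psi> (Suc n) x" for n x
  proof -
    have "conv \<phi> (\<psi> n) x = conv \<phi> (cpow \<phi> n) x / of_real (r ^ Suc n)"
      unfolding conv_def \<psi>_def by (simp flip: integral_divide_zero)
    then show ?thesis using r(1) by (simp add: \<psi>_def)
  qed
  have \<psi>l2: "sq_norm (\<lambda>x. \<psi> k x - \<psi> n x) = s (2 * k + 1) - 2 * s (k + n + 1) + s (2 * n + 1)" for k n
  proof -
    have in\<psi>: "(\<integral>x. \<psi> k x * cnj (\<psi> n x) \<partial>m) = of_real (s (k + n + 1))" for k n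
    proof -
      have "(\<integral>x. \<psi> k x * cnj (\<psi> n x) \<partial>m)
          = (\<integral>x. cpow \<phi> k x * cnj (cpow \<phi> n x) \<partial>m) / of_real (r ^ Suc k * r ^ Suc n)"
        unfolding \<psi>_def by (simp add: mult.commute flip: integral_divide_zero)
      then show ?thesis unfolding inner by (simp add: s_def power_add mult_ac)
    qed
    have l: "sq_norm (\<psi> k) = s (2 * k + 1)" for k
    proof -
      have "complex_of_real (sq_norm (\<psi> k)) = of_real (s (k + k + 1))"
        using conv_tilde_zero[of "\<psi> k"] in\<psi>[of k k] by (simp only: conv_tilde_zero_eq)
      then show ?thesis by (simp only: of_real_eq_iff mult_2)
    qed
    show ?thesis using sq_norm_diff[OF \<psi>c \<psi>c, of k 1 n] by (simp add: in\<psi> l)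
  qed
  have "uniformly_Cauchy_on UNIV (\<lambda>n. \<psi> (Suc n))"
    unfolding uniformly_Cauchy_on_def
  proof (intro allI impI)
    fix e :: real assume e: "e > 0"
    \<comment> \<open>With the weight \<open>d\<close> in \<open>norm_integral_mult_le\<close>, the term with \<open>\<phi>\<close> stays below \<open>r * e\<close>,
      however small the mean square distance of the powers has to be in return.\<close>
    define d where "d = r * e / (sq_norm \<phi> + 1)"
    have d: "d > 0" "d * sq_norm \<phi> < r * e"
      using r(1) e sq_norm_nonneg[of \<phi>] by (auto simp: d_def divide_simps add_nonneg_pos intro!: divide_pos_pos)
    have "r * e * d / 4 > 0" using r(1) e d by simp
    then obtain N where N: "\<And>n. n \<ge> N \<Longrightarrow> norm (s n - l) < r * e * d / 4"
      using LIMSEQ_D[OF s] by blast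
    have "dist (\<psi> (Suc k) x) (\<psi> (Suc n) x) < e" if "k \<ge> N" "n \<ge> N" for k n x
    proof -
      have "norm (s (2 * k + 1) - l) < r * e * d / 4" "norm (s (2 * n + 1) - l) < r * e * d / 4"
        "norm (s (k + n + 1) - l) < r * e * d / 4"
        by (rule N; use that in simp)+
      then have "sq_norm (\<lambda>x. \<psi> k x - \<psi> n x) < r * e * d"
        unfolding \<psi>l2 real_norm_def by argo
      then have *: "sq_norm (\<lambda>x. \<psi> k x - \<psi> n x) / d < r * e" using d by (simp add: field_simps)
      have u: "cont (\<lambda>x. \<psi> k x - \<psi> n x)" by (intro continuous_intros \<psi>c)
      have "of_real r * (\<psi> (Suc k) x - \<psi> (Suc n) x) = conv \<phi> (\<lambda>x. \<psi> k x - \<psi> n x) x"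
        by (simp add: conv_diff[OF integrable_continuous[OF c] \<psi>c \<psi>c] \<psi>step right_diff_distrib)
      also have "\<dots> = conv (\<lambda>x. \<psi> k x - \<psi> n x) \<phi> x"
        by (simp only: conv_commute[OF c u])
      also have "\<dots> = (\<integral>y. \<phi> (x - y) * (\<psi> k y - \<psi> n y) \<partial>m)"
        by (simp add: conv_def mult.commute)
      also have "norm \<dots> \<le> (d * sq_norm (\<lambda>y. \<phi> (x - y)) + sq_norm (\<lambda>x. \<psi> k x - \<psi> n x) / d) / 2"
        by (intro norm_integral_mult_le cont_diff c u d)
      also have "sq_norm (\<lambda>y. \<phi> (x - y)) = sq_norm \<phi>"
        using sq_norm_tilde[OF c, of x] by (simp only: t)
      finally have "norm (of_real r * (\<psi> (Suc k) x - \<psi> (Suc n) x)) < r * e"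
        using * d by simp
      then have "r * norm (\<psi> (Suc k) x - \<psi> (Suc n) x) < r * e"
        using r(1) by (simp only: norm_mult norm_of_real)
      then show ?thesis using r(1) by (simp add: dist_norm)
    qed
    then show "\<exists>M. \<forall>x\<in>UNIV. \<forall>k\<ge>M. \<forall>n\<ge>M. dist (\<psi> (Suc k) x) (\<psi> (Suc n) x) < e" by blast
  qed
  then obtain e where e: "uniform_limit UNIV (\<lambda>n. \<psi> (Suc n)) e sequentially"
    using Cauchy_uniformly_convergent uniformly_convergent_on_def by blast
  have ec: "cont e"
    using uniform_limit_theorem[OF _ e] \<psi>c by simp
  have pl: "(\<lambda>n. \<psi> (Suc n) x) \<longlonglongrightarrow> e x" for x
    using tendsto_uniform_limitI[OF e, of x] by simp
  have pl': "(\<lambda>n. \<psi> (n + k + 1) x) \<longlonglongrightarrow> e x" for x k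
    using LIMSEQ_ignore_initial_segment[OF pl, of k x] by simp
  have "conv (\<psi> (Suc k)) e x = e x" for k x
  proof (rule LIMSEQ_unique)
    show "(\<lambda>n. conv (\<psi> (Suc k)) (\<psi> (Suc n)) x) \<longlonglongrightarrow> conv (\<psi> (Suc k)) e x"
      by (rule conv_uniform_limit[OF e \<psi>c integrable_continuous[OF \<psi>c]])
    show "(\<lambda>n. conv (\<psi> (Suc k)) (\<psi> (Suc n)) x) \<longlonglongrightarrow> e x"
      using pl'[of "k + 2" x] by (simp add: \<psi>conv add_ac)
  qed
  then have *: "conv e (\<psi> (Suc k)) x = e x" for k x
    by (simp add: conv_commute[OF ec \<psi>c])
  have "conv e e x = e x" for x
    using conv_uniform_limit[OF e \<psi>c integrable_continuous[OF ec], of x] unfolding *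
    by (rule LIMSEQ_unique[OF _ tendsto_const])
  moreover have "tilde e x = e x" for x
  proof (rule LIMSEQ_unique)
    show "(\<lambda>n. cnj (\<psi> (Suc n) (- x))) \<longlonglongrightarrow> tilde e x"
      unfolding tilde_def by (intro tendsto_cnj pl)
    have "cnj (\<psi> n (- x)) = \<psi> n x" for n
      using fun_cong[OF tilde_cpow[OF c t, of n], of x] by (simp add: tilde_def \<psi>_def)
    then show "(\<lambda>n. cnj (\<psi> (Suc n) (- x))) \<longlonglongrightarrow> e x" using pl[of x] by simp
  qed
  ultimately have "idem e" using ec by (simp add: idem_def fun_eq_iff)
  moreover have "e 0 \<noteq> 0"
  proof -
    have "\<psi> n 0 = of_real (s n)" for n by (simp add: \<psi>_def s_def az)
    then have "(\<lambda>n. of_real (s (Suc n))) \<longlonglongrightarrow> e 0" using pl[of 0] by simp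
    moreover have "(\<lambda>n. complex_of_real (s (Suc n))) \<longlonglongrightarrow> of_real l"
      by (intro tendsto_of_real LIMSEQ_Suc s)
    ultimately have "e 0 = of_real l" by (rule LIMSEQ_unique)
    then show ?thesis using r by simp
  qed
  moreover have "conv \<phi> e x = r * e x" for x
  proof (rule LIMSEQ_unique)
    show "(\<lambda>n. conv \<phi> (\<psi> (Suc n)) x) \<longlonglongrightarrow> conv \<phi> e x"
      by (rule conv_uniform_limit[OF e \<psi>c integrable_continuous[OF c]])
    show "(\<lambda>n. conv \<phi> (\<psi> (Suc n)) x) \<longlonglongrightarrow> r * e x"
      unfolding \<psi>step using pl'[of 1 x] by (intro tendsto_mult_left) simp
  qed
  ultimately show ?thesis using that[OF r(1)] by (simp add: \<phi>_def fun_eq_iff)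
qed

end

section \<open>Characters of a compact abelian group\<close>

context
  fixes \<gamma> :: "'g::topological_ab_group_add \<Rightarrow> complex"
  assumes \<gamma>: "is_character \<gamma>"
begin

lemma character_continuous: "continuous_on UNIV \<gamma>"
  and character_norm: "norm (\<gamma> x) = 1"
  and character_add: "\<gamma> (x + y) = \<gamma> x * \<gamma> y"
  using \<gamma> by (auto simp: is_character_def)

lemma character_zero: "\<gamma> 0 = 1"
  using character_add[of 0 0] character_norm[of 0] by auto

lemma character_minus: "\<gamma> (- x) = cnj (\<gamma> x)"
proof -
  have "\<gamma> x * \<gamma> (- x) = \<gamma> x * cnj (\<gamma> x)"
    using character_add[of x "- x"] character_zero complex_norm_square[of "\<gamma> x"] character_norm[of x]
    by simp
  then show ?thesis using character_norm[of x] by auto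
qed

lemma character_diff: "\<gamma> (x - y) = \<gamma> x * cnj (\<gamma> y)"
  using character_add[of x "- y"] by (simp add: character_minus)

lemma character_cnj_mult: "cnj (\<gamma> x) * \<gamma> x = 1" "\<gamma> x * cnj (\<gamma> x) = 1"
  using complex_norm_square[of "\<gamma> x"] character_norm[of x] by (simp_all add: mult.commute)

end

lemma is_character_one: "is_character (\<lambda>_. 1)"
  by (simp add: is_character_def)

lemma is_character_mult: "is_character \<gamma> \<Longrightarrow> is_character \<delta> \<Longrightarrow> is_character (\<lambda>x. \<gamma> x * \<delta> x)"
  by (auto simp: is_character_def norm_mult intro!: continuous_intros)

lemma is_character_cnj: "is_character \<gamma> \<Longrightarrow> is_character (\<lambda>x. cnj (\<gamma> x))"
  by (auto simp: is_character_def intro!: continuous_intros)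

context compact_haar
begin

lemma idem_zero: "idem e \<Longrightarrow> e 0 = of_real (sq_norm e)"
  using conv_tilde_zero[of e] by (simp add: idem_def)

lemma idem_norm_le: "idem e \<Longrightarrow> norm (e x) \<le> sq_norm e"
  using norm_conv_tilde_le[of e x] by (simp add: idem_def)

text \<open>
  The modulus of \<open>e\<close> is bounded by \<open>e 0 = sq_norm e\<close>, so its mean square \<open>sq_norm e\<close> is at most
  \<open>(sq_norm e)\<^sup>2\<close>.
\<close>

lemma idem_sq_norm_ge_1:
  assumes "idem e" "e x \<noteq> 0"
  shows "sq_norm e \<ge> 1"
proof -
  have c: "cont e" using assms by (simp add: idem_def)
  have pos: "sq_norm e > 0" by (rule sq_norm_pos[OF c assms(2)])
  have "sq_norm e \<le> (\<integral>x. (sq_norm e)\<^sup>2 \<partial>m)"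
    unfolding sq_norm_def[of e]
    by (subst (2) sq_norm_def[symmetric], intro integral_mono integrable_norm2 c)
      (auto intro!: power_mono idem_norm_le assms simp: sq_norm_def[symmetric])
  then have "sq_norm e * 1 \<le> sq_norm e * sq_norm e" by (simp add: power2_eq_square)
  then show ?thesis using pos by (simp only: mult_le_cancel_left_pos)
qed

text \<open>
  This is the projection onto the orthogonal complement of the range of \<open>e'\<close> in that of \<open>e\<close>.
\<close>

lemma idem_diff:
  assumes e: "idem e" and e': "idem e'" and ee': "conv e e' = e'"
  shows "idem (\<lambda>x. e x - e' x)"
proof -
  have c: "cont e" "cont e'" "cont (\<lambda>x. e x - e' x)"
    and i: "integrable m e" "integrable m e'" "integrable m (\<lambda>x. e x - e' x)"
    using e e' by (auto simp: idem_def intro!: continuous_intros integrable_continuous)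
  have sq: "conv e e = e" "conv e' e' = e'" using e e' by (auto simp: idem_def)
  let ?d = "\<lambda>x. e x - e' x"
  have 1: "conv e ?d = ?d"
    by (simp add: conv_diff i c sq ee')
  have 2: "conv e' ?d = (\<lambda>x. 0)"
    by (simp add: conv_diff i c sq conv_commute[OF c(2,1)] ee')
  have "conv ?d ?d = (\<lambda>x. conv ?d e x - conv ?d e' x)"
    by (rule conv_diff[OF i(3) c(1,2)])
  also have "\<dots> = ?d"
    using 1 2 by (simp add: conv_commute[OF c(3,1)] conv_commute[OF c(3,2)])
  finally have "conv ?d ?d = ?d" .
  moreover have "tilde ?d = ?d"
    using e e' by (simp add: idem_def tilde_def fun_eq_iff)
  ultimately show ?thesis using c by (simp add: idem_def)
qed

text \<open>
  Splitting off a proper part lowers \<open>sq_norm\<close> by at least 1, by \<open>idem_diff\<close> and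
  \<open>idem_sq_norm_ge_1\<close>. So an element whose \<open>sq_norm\<close> exceeds the infimum by less than 1 cannot be split.
\<close>

lemma minimal_idem:
  assumes e: "idem e" "e 0 \<noteq> 0"
  obtains \<psi> where "idem \<psi>" "\<psi> 0 \<noteq> 0" "conv e \<psi> = \<psi>"
    "\<forall>\<psi>'. idem \<psi>' \<and> \<psi>' 0 \<noteq> 0 \<and> conv \<psi> \<psi>' = \<psi>' \<longrightarrow> \<psi>' = \<psi>"
proof -
  define S where "S = {\<psi>. idem \<psi> \<and> \<psi> 0 \<noteq> 0 \<and> conv e \<psi> = \<psi>}"
  have ne: "sq_norm ` S \<noteq> {}" using e by (auto simp: S_def idem_def)
  have bd: "bdd_below (sq_norm ` S)" using sq_norm_nonneg by (auto intro: bdd_belowI[of _ 0])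
  obtain \<psi> where \<psi>: "\<psi> \<in> S" "sq_norm \<psi> < Inf (sq_norm ` S) + 1"
    using cInf_lessD[OF ne, of "Inf (sq_norm ` S) + 1"] by auto
  have "\<psi>' = \<psi>" if h: "idem \<psi>'" "\<psi>' 0 \<noteq> 0" "conv \<psi> \<psi>' = \<psi>'" for \<psi>'
  proof (rule ccontr)
    assume "\<psi>' \<noteq> \<psi>"
    then obtain x where "\<psi> x \<noteq> \<psi>' x" by (metis ext)
    then have x: "\<psi> x - \<psi>' x \<noteq> 0" by simp
    have id: "idem \<psi>" using \<psi> by (simp add: S_def)
    have d: "idem (\<lambda>x. \<psi> x - \<psi>' x)" by (rule idem_diff[OF id h(1,3)])
    have "complex_of_real (sq_norm (\<lambda>x. \<psi> x - \<psi>' x)) = of_real (sq_norm \<psi> - sq_norm \<psi>')"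
      using idem_zero[OF d] idem_zero[OF id] idem_zero[OF h(1)] by simp
    then have "sq_norm (\<lambda>x. \<psi> x - \<psi>' x) = sq_norm \<psi> - sq_norm \<psi>'" by (simp only: of_real_eq_iff)
    then have "sq_norm \<psi>' < Inf (sq_norm ` S)" using idem_sq_norm_ge_1[OF d x] \<psi>(2) by simp
    moreover have "\<psi>' \<in> S"
    proof -
      have "conv e \<psi>' = conv (conv e \<psi>) \<psi>'"
        using e id h by (simp add: conv_assoc idem_def integrable_continuous)
      also have "\<dots> = \<psi>'" using \<psi> h by (simp add: S_def)
      finally show ?thesis using h by (simp add: S_def)
    qed
    ultimately show False using cInf_lower[OF _ bd, of "sq_norm \<psi>'"] by simp
  qed
  with \<psi>(1) show ?thesis using that[of \<psi>] by (simp add: S_def)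
qed

text \<open>
  Let \<open>g = \<psi> + \<omega> L\<^sub>a \<psi>\<close>, with \<open>L\<^sub>a\<close> the translation by \<open>a\<close>. The top eigenprojection of
  \<open>\<theta> = g * tilde g\<close> lies below \<open>\<psi>\<close>, hence equals \<open>\<psi>\<close> by minimality, so \<open>\<theta>\<close> is a multiple of
  \<open>\<psi>\<close>. On the other hand \<open>\<theta>\<close> is \<open>2 \<psi>\<close> plus the left-hand side.
\<close>

lemma minimal_idem_eigen:
  assumes id: "idem \<psi>"
    and minimal: "\<forall>\<psi>'. idem \<psi>' \<and> \<psi>' 0 \<noteq> 0 \<and> conv \<psi> \<psi>' = \<psi>' \<longrightarrow> \<psi>' = \<psi>"
    and \<omega>: "norm \<omega> = 1"
  shows "\<exists>c. \<forall>x. \<omega> * \<psi> (x + a) + cnj \<omega> * \<psi> (x - a) = c * \<psi> x"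
proof -
  define g where "g x = \<psi> x + \<omega> * \<psi> (x + a)" for x
  have c: "cont \<psi>" and i: "integrable m \<psi>" and sq: "conv \<psi> \<psi> = \<psi>" and t: "tilde \<psi> = \<psi>"
    using id by (auto simp: idem_def intro: integrable_continuous)
  have gc: "cont g" unfolding g_def by (intro continuous_intros c cont_shift)
  have c': "cont (\<lambda>x. \<omega>' * \<psi> (x + b))" for b \<omega>'
    by (intro continuous_intros c cont_shift)
  have tg: "tilde g = (\<lambda>x. \<psi> x + cnj \<omega> * \<psi> (x + - a))"
  proof
    fix x
    have "cnj (\<psi> (- x)) = \<psi> x" "cnj (\<psi> (- (x - a))) = \<psi> (x - a)"
      using fun_cong[OF t, of x] fun_cong[OF t, of "x - a"] by (simp_all add: tilde_def)
    then show "tilde g x = \<psi> x + cnj \<omega> * \<psi> (x + - a)" by (simp add: tilde_def g_def)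
  qed
  have \<psi>g: "conv \<psi> g = g"
    unfolding g_def by (simp add: conv_add[OF i c c'] conv_scale conv_shift sq)
  define \<theta> where "\<theta> = conv g (tilde g)"
  have g\<psi>: "conv g \<psi> = g" using conv_commute[OF gc c] \<psi>g by simp
  have \<theta>: "\<theta> x = 2 * \<psi> x + (\<omega> * \<psi> (x + a) + cnj \<omega> * \<psi> (x - a))" for x
  proof -
    have "conv g (tilde g) = (\<lambda>x. g x + cnj \<omega> * g (x + - a))"
      unfolding tg using g\<psi>
      by (simp only: conv_add[OF integrable_continuous[OF gc] c c'] conv_scale conv_shift)
    then show ?thesis
      using complex_norm_square[of \<omega>] \<omega> by (simp add: \<theta>_def g_def algebra_simps)
  qed
  have \<theta>c: "cont \<theta>" unfolding \<theta>_def by (intro cont_conv gc cont_tilde)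
  \<comment> \<open>If \<open>g\<close> vanishes, the power method does not apply, but then \<open>\<theta> = 0\<close>.\<close>
  have "\<exists>c. \<forall>x. \<theta> x = c * \<psi> x"
  proof (cases "\<exists>x. g x \<noteq> 0")
    case True
    then obtain x\<^sub>0 where "g x\<^sub>0 \<noteq> 0" by blast
    then obtain r :: real and e :: "'g \<Rightarrow> complex" where r: "r > 0" "idem e" "e 0 \<noteq> 0" and re: "conv \<theta> e = (\<lambda>x. r * e x)"
      unfolding \<theta>_def by (rule top_eigenprojection[OF gc])
    have ec: "cont e" using r by (simp add: idem_def)
    have \<psi>\<theta>: "conv \<psi> \<theta> = \<theta>"
      unfolding \<theta>_def using conv_assoc[OF i gc cont_tilde[OF gc]] \<psi>g by simp
    have "(\<lambda>x. r * conv \<psi> e x) = conv \<psi> (conv \<theta> e)" by (simp add: re conv_scale)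
    also have "\<dots> = conv (conv \<psi> \<theta>) e" by (rule conv_assoc[OF i \<theta>c ec, symmetric])
    also have "\<dots> = (\<lambda>x. r * e x)" by (simp add: \<psi>\<theta> re)
    finally have "conv \<psi> e = e" using r(1) by (simp add: fun_eq_iff)
    then have "e = \<psi>" using minimal r(2,3) by blast
    then have "\<theta> = (\<lambda>x. r * \<psi> x)" using re \<psi>\<theta> conv_commute[OF \<theta>c c] by simp
    then show ?thesis by (intro exI[of _ "of_real r"]) simp
  next
    case False
    then have "g = (\<lambda>x. 0)" by auto
    then have "\<theta> x = 0" for x by (simp add: \<theta>_def conv_def)
    then show ?thesis by (intro exI[of _ 0]) simp
  qed
  then obtain c where "\<And>x. \<theta> x = c * \<psi> x" by blast
  then have "\<omega> * \<psi> (x + a) + cnj \<omega> * \<psi> (x - a) = (c - 2) * \<psi> x" for x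
    using \<theta>[of x] by (simp add: algebra_simps)
  then show ?thesis by blast
qed

text \<open>
  The choices \<open>\<omega> = 1\<close> and \<open>\<omega> = \<i>\<close> in \<open>minimal_idem_eigen\<close> separate the translates by \<open>a\<close>
  and by \<open>- a\<close>, so every translation multiplies a minimal idempotent by a constant. Divided by its
  value at 0 it is a character.
\<close>

lemma character_below_idem:
  assumes e: "idem e" "e 0 \<noteq> 0"
  obtains \<xi> where "is_character \<xi>" "conv e \<xi> = \<xi>"
proof -
  obtain \<psi> where id: "idem \<psi>" and z: "\<psi> 0 \<noteq> 0" and e\<psi>: "conv e \<psi> = \<psi>"
    and minimal: "\<forall>\<psi>'. idem \<psi>' \<and> \<psi>' 0 \<noteq> 0 \<and> conv \<psi> \<psi>' = \<psi>' \<longrightarrow> \<psi>' = \<psi>"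
    using minimal_idem[OF e] by metis
  have shift: "\<exists>c. \<forall>x. \<psi> (x + a) = c * \<psi> x" for a
  proof -
    obtain c1 where 1: "\<And>x. \<psi> (x + a) + \<psi> (x - a) = c1 * \<psi> x"
      using minimal_idem_eigen[OF id minimal, of 1 a] by auto
    obtain c2 where 2: "\<And>x. \<i> * \<psi> (x + a) - \<i> * \<psi> (x - a) = c2 * \<psi> x"
      using minimal_idem_eigen[OF id minimal, of \<i> a] by auto
    have "\<psi> (x + a) = (c1 - \<i> * c2) / 2 * \<psi> x" for x
    proof -
      have "2 * \<psi> (x + a) = (\<psi> (x + a) + \<psi> (x - a)) - \<i> * (\<i> * \<psi> (x + a) - \<i> * \<psi> (x - a))"
        by (simp add: algebra_simps)
      also have "\<dots> = (c1 - \<i> * c2) * \<psi> x" unfolding 1 2 by (simp add: algebra_simps)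
      finally show ?thesis by (simp add: mult.commute)
    qed
    then show ?thesis by blast
  qed
  define \<xi> where "\<xi> x = (1 / \<psi> 0) * \<psi> x" for x
  have c: "cont \<psi>" using id by (simp add: idem_def)
  have add: "\<xi> (x + a) = \<xi> x * \<xi> a" for x a
  proof -
    obtain k where k: "\<And>x. \<psi> (x + a) = k * \<psi> x" using shift by blast
    have "\<psi> a = k * \<psi> 0" using k[of 0] by simp
    then show ?thesis using k[of x] z by (simp add: \<xi>_def)
  qed
  have "\<xi> 0 = 1" using z by (simp add: \<xi>_def)
  have le: "norm (\<xi> x) \<le> 1" for x
  proof -
    have "norm (\<psi> 0) = sq_norm \<psi>" using idem_zero[OF id] sq_norm_nonneg[of \<psi>] by simp
    then show ?thesis using idem_norm_le[OF id, of x] z sq_norm_nonneg[of \<psi>] by (simp add: \<xi>_def norm_divide divide_simps)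
  qed
  have "norm (\<xi> x) = 1" for x
  proof -
    have "norm (\<xi> x) * norm (\<xi> (- x)) = 1"
      using add[of x "- x"] \<open>\<xi> 0 = 1\<close> by (simp flip: norm_mult)
    then show ?thesis
      using le[of x] le[of "- x"] mult_left_le[of "norm (\<xi> (- x))" "norm (\<xi> x)"] by simp
  qed
  moreover have "cont \<xi>" unfolding \<xi>_def by (intro continuous_intros c)
  ultimately have "is_character \<xi>" using add by (simp add: is_character_def)
  moreover have "conv e \<xi> = \<xi>" unfolding \<xi>_def by (simp only: conv_scale e\<psi>)
  ultimately show ?thesis using that by blast
qed

lemma conv_character:
  assumes "is_character \<gamma>"
  shows "conv f \<gamma> = (\<lambda>x. fourier_coeff m f \<gamma> * \<gamma> x)"
  unfolding conv_def fourier_coeff_def character_diff[OF assms]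
  by (simp add: mult_ac)

text \<open>
  The core of the Peter-Weyl theorem. A character \<open>\<xi>\<close> in the range of the top eigenprojection of
  \<open>f * tilde f\<close> satisfies \<open>f * tilde f * \<xi> = r \<xi>\<close> with \<open>r > 0\<close>, and the left-hand side is a
  multiple of the Fourier coefficient of \<open>f\<close> at \<open>\<xi>\<close>.
\<close>

theorem continuous_fourier_nonzero:
  assumes f: "cont f" "f x \<noteq> 0"
  obtains \<xi> where "is_character \<xi>" "fourier_coeff m f \<xi> \<noteq> 0"
proof -
  obtain r :: real and e :: "'g \<Rightarrow> complex" where r: "r > 0" "idem e" "e 0 \<noteq> 0"
    and re: "conv (conv f (tilde f)) e = (\<lambda>x. r * e x)"
    by (rule top_eigenprojection[OF f])
  obtain \<xi> where \<xi>: "is_character \<xi>" "conv e \<xi> = \<xi>"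
    using character_below_idem[OF r(2,3)] by blast
  have c: "cont e" "cont \<xi>" "cont (tilde f)"
    using r \<xi> character_continuous cont_tilde[OF f(1)] by (auto simp: idem_def)
  define \<phi> where "\<phi> = conv f (tilde f)"
  have \<phi>c: "cont \<phi>" unfolding \<phi>_def by (intro cont_conv f c)
  have "conv \<phi> \<xi> = conv (conv \<phi> e) \<xi>"
    using conv_assoc[OF integrable_continuous[OF \<phi>c] c(1,2)] \<xi> by simp
  also have "\<dots> = conv \<xi> (\<lambda>x. r * e x)"
    using re c by (simp add: \<phi>_def conv_commute[of \<xi>] continuous_on_mult_left)
  also have "\<dots> = (\<lambda>x. r * \<xi> x)"
    using \<xi>(2) conv_commute[OF c(2,1)] by (simp add: conv_scale)
  finally have 1: "conv \<phi> \<xi> 0 = r" by (simp add: character_zero[OF \<xi>(1)])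
  have "conv \<phi> \<xi> = conv f (conv (tilde f) \<xi>)"
    unfolding \<phi>_def by (rule conv_assoc[OF integrable_continuous[OF f(1)] c(3,2)])
  also have "\<dots> = (\<lambda>x. fourier_coeff m (tilde f) \<xi> * (fourier_coeff m f \<xi> * \<xi> x))"
    by (simp add: conv_character[OF \<xi>(1)] conv_scale)
  finally have "fourier_coeff m f \<xi> \<noteq> 0" using 1 r(1) by auto
  with \<xi>(1) show ?thesis using that by blast
qed

end

section \<open>Density of trigonometric polynomials\<close>

text \<open>
  The domain is arbitrary because spans are needed both on a group and on the disjoint sum of two
  groups.
\<close>

inductive_set cspan :: "('a \<Rightarrow> complex) set \<Rightarrow> ('a \<Rightarrow> complex) set" for X where
  zero: "(\<lambda>_. 0) \<in> cspan X"
| step: "\<gamma> \<in> X \<Longrightarrow> f \<in> cspan X \<Longrightarrow> (\<lambda>x. c * \<gamma> x + f x) \<in> cspan X"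

lemma cspan_add:
  assumes "f \<in> cspan X" "g \<in> cspan X"
  shows "(\<lambda>x. f x + g x) \<in> cspan X"
  using assms(1)
proof induction
  case zero then show ?case using assms(2) by simp
next
  case (step \<gamma> f c)
  then show ?case using cspan.step[of \<gamma> X "\<lambda>x. f x + g x" c] by (simp add: add.assoc)
qed

lemma cspan_scale:
  assumes "f \<in> cspan X"
  shows "(\<lambda>x. c * f x) \<in> cspan X"
  using assms
proof induction
  case zero then show ?case using cspan.zero by simp
next
  case (step \<gamma> f d)
  then show ?case using cspan.step[of \<gamma> X "\<lambda>x. c * f x" "c * d"] by (simp add: algebra_simps)
qed

lemma cspan_base: "\<gamma> \<in> X \<Longrightarrow> \<gamma> \<in> cspan X"
  using cspan.step[OF _ cspan.zero, of \<gamma> X 1] by simp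

lemma cspan_mult:
  assumes X: "\<And>\<gamma> \<delta>. \<gamma> \<in> X \<Longrightarrow> \<delta> \<in> X \<Longrightarrow> (\<lambda>x. \<gamma> x * \<delta> x) \<in> X"
    and f: "f \<in> cspan X" and g: "g \<in> cspan X"
  shows "(\<lambda>x. f x * g x) \<in> cspan X"
proof -
  have *: "(\<lambda>x. \<gamma> x * g x) \<in> cspan X" if "\<gamma> \<in> X" for \<gamma>
    using g
  proof induction
    case zero then show ?case using cspan.zero by simp
  next
    case (step \<delta> g c)
    then show ?case
      using cspan.step[OF X[OF that step(1)], of "\<lambda>x. \<gamma> x * g x" c] by (simp add: algebra_simps)
  qed
  show ?thesis using f
  proof induction
    case zero then show ?case using cspan.zero by simp
  next
    case (step \<gamma> f c)
    then show ?case
      using cspan_add[OF cspan_scale[OF *[OF step(1)], of c] step(3)] by (simp add: algebra_simps)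
  qed
qed

lemma cspan_cnj:
  assumes X: "\<And>\<gamma>. \<gamma> \<in> X \<Longrightarrow> (\<lambda>x. cnj (\<gamma> x)) \<in> X"
    and f: "f \<in> cspan X"
  shows "(\<lambda>x. cnj (f x)) \<in> cspan X"
  using f
proof induction
  case zero then show ?case using cspan.zero by simp
next
  case (step \<gamma> f c)
  then show ?case using cspan.step[OF X[OF step(1)], of "\<lambda>x. cnj (f x)" "cnj c"] by simp
qed

lemma cspan_sum:
  "finite F \<Longrightarrow> (\<And>i. i \<in> F \<Longrightarrow> f i \<in> cspan X) \<Longrightarrow> (\<lambda>x. \<Sum>i\<in>F. f i x) \<in> cspan X"
  by (induction F rule: finite_induct) (auto intro: cspan.zero cspan_add)

lemma cspan_const:
  assumes "(\<lambda>_. 1) \<in> X"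
  shows "(\<lambda>_. c) \<in> cspan X"
  using cspan.step[OF assms cspan.zero, of c] by simp

lemma cspan_normal_form:
  assumes "f \<in> cspan X"
  obtains F c where "finite F" "F \<subseteq> X" "f = (\<lambda>x. \<Sum>\<gamma>\<in>F. c \<gamma> * \<gamma> x)"
proof -
  have "\<exists>F c. finite F \<and> F \<subseteq> X \<and> f = (\<lambda>x. \<Sum>\<gamma>\<in>F. c \<gamma> * \<gamma> x)"
    using assms
  proof induction
    case zero then show ?case by (intro exI[of _ "{}"]) simp
  next
    case (step \<gamma> f d)
    then obtain F c where F: "finite F" "F \<subseteq> X" "f = (\<lambda>x. \<Sum>\<gamma>\<in>F. c \<gamma> * \<gamma> x)" by blast
    show ?case
    proof (cases "\<gamma> \<in> F")
      case True
      have "d * \<gamma> x + f x = (\<Sum>\<delta>\<in>F. (c(\<gamma> := c \<gamma> + d)) \<delta> * \<delta> x)" for x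
        using F True by (simp add: sum.remove[of F \<gamma>] algebra_simps)
      then show ?thesis using F by blast
    next
      case False
      have "d * \<gamma> x + f x = (\<Sum>\<delta>\<in>insert \<gamma> F. (c(\<gamma> := d)) \<delta> * \<delta> x)" for x
        using F False by (auto intro!: sum.cong)
      then show ?thesis using F step(1) by (intro exI[of _ "insert \<gamma> F"] exI[of _ "c(\<gamma> := d)"]) auto
    qed
  qed
  then show ?thesis using that by blast
qed

abbreviation trig_polys :: "('g::topological_ab_group_add \<Rightarrow> complex) set" where
  "trig_polys \<equiv> cspan (Collect is_character)"

lemma trig_poly_mult: "f \<in> trig_polys \<Longrightarrow> g \<in> trig_polys \<Longrightarrow> (\<lambda>x. f x * g x) \<in> trig_polys"
  by (rule cspan_mult) (auto intro: is_character_mult)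

lemma trig_poly_const: "(\<lambda>_. c) \<in> trig_polys"
  by (rule cspan_const) (simp add: is_character_one)

lemma trig_poly_continuous:
  fixes f :: "'g::{topological_ab_group_add,t2_space} \<Rightarrow> complex"
  assumes "f \<in> trig_polys"
  shows "continuous_on UNIV f"
  using assms by induction (auto intro!: continuous_intros simp: is_character_def)

lemma trig_poly_Re:
  assumes "is_character \<gamma>"
  shows "(\<lambda>x. of_real (Re (\<gamma> x))) \<in> trig_polys"
proof -
  have "(\<lambda>x. 1/2 * \<gamma> x + (1/2 * cnj (\<gamma> x))) \<in> trig_polys"
    using assms by (intro cspan.step cspan_scale cspan_base) (auto intro: is_character_cnj)
  also have "(\<lambda>x. 1/2 * \<gamma> x + (1/2 * cnj (\<gamma> x))) = (\<lambda>x. of_real (Re (\<gamma> x)))"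
    by (auto simp: complex_eq_iff)
  finally show ?thesis .
qed

lemma trig_poly_Im:
  assumes "is_character \<gamma>"
  shows "(\<lambda>x. of_real (Im (\<gamma> x))) \<in> trig_polys"
proof -
  have "(\<lambda>x. (-\<i>/2) * \<gamma> x + (\<i>/2 * cnj (\<gamma> x))) \<in> trig_polys"
    using assms by (intro cspan.step cspan_scale cspan_base) (auto intro: is_character_cnj)
  also have "(\<lambda>x. (-\<i>/2) * \<gamma> x + (\<i>/2 * cnj (\<gamma> x))) = (\<lambda>x. of_real (Im (\<gamma> x)))"
    by (auto simp: complex_eq_iff)
  finally show ?thesis .
qed

context compact_haar
begin

lemma integral_character:
  assumes "is_character \<gamma>"
  shows "(\<integral>x. \<gamma> x \<partial>m) = (if \<gamma> = (\<lambda>_. 1) then 1 else 0)"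
proof (cases "\<gamma> = (\<lambda>_. 1)")
  case False
  then obtain a where "\<gamma> a \<noteq> 1" by (metis ext)
  have "(\<integral>x. \<gamma> (x + a) \<partial>m) = (\<integral>x. \<gamma> x \<partial>m)"
    by (rule integral_shift[OF character_continuous[OF assms]])
  then have "(\<integral>x. \<gamma> x \<partial>m) * \<gamma> a = (\<integral>x. \<gamma> x \<partial>m)"
    by (simp add: character_add[OF assms])
  with \<open>\<gamma> a \<noteq> 1\<close> False show ?thesis by simp
qed simp

lemma fourier_coeff_character:
  assumes "is_character \<gamma>" "is_character \<delta>"
  shows "fourier_coeff m \<gamma> \<delta> = (if \<gamma> = \<delta> then 1 else 0)"
proof -
  have "(\<lambda>x. \<gamma> x * cnj (\<delta> x)) = (\<lambda>_. 1) \<longleftrightarrow> \<gamma> = \<delta>"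
  proof
    assume *: "(\<lambda>x. \<gamma> x * cnj (\<delta> x)) = (\<lambda>_. 1)"
    have "\<gamma> x * cnj (\<delta> x) * \<delta> x = \<delta> x" for x
      using fun_cong[OF *, of x] by simp
    then show "\<gamma> = \<delta>" by (simp add: fun_eq_iff mult.assoc character_cnj_mult[OF assms(2)])
  qed (simp add: character_cnj_mult[OF assms(2)])
  then show ?thesis
    unfolding fourier_coeff_def
    using integral_character[OF is_character_mult[OF assms(1) is_character_cnj[OF assms(2)]]] by simp
qed

lemma urysohn:
  assumes "closed S" "closed T" "S \<inter> T = {}"
  obtains u :: "'g \<Rightarrow> real" where "continuous_on UNIV u" "\<And>x. 0 \<le> u x" "\<And>x. u x \<le> 1"
    "\<And>x. x \<in> S \<Longrightarrow> u x = 0" "\<And>x. x \<in> T \<Longrightarrow> u x = 1"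
proof -
  have "Hausdorff_space (euclidean :: 'g topology)"
    unfolding Hausdorff_space_def disjnt_def using hausdorff by simp blast
  then have n: "normal_space (euclidean :: 'g topology)"
    by (intro compact_Hausdorff_or_regular_imp_normal_space disjI1)
      (simp_all add: compact_space_def compact_group)
  obtain u where u: "continuous_map euclidean (top_of_set {0..1::real}) u" "u ` S \<subseteq> {0}" "u ` T \<subseteq> {1}"
    by (rule Urysohn_lemma[OF n, of S T 0 1]) (use assms in \<open>auto simp: disjnt_def\<close>)
  then have "continuous_on UNIV u" "u \<in> UNIV \<rightarrow> {0..1}" by (auto simp: continuous_map_in_subtopology)
  then show ?thesis using that[of u] u by (auto simp: image_subset_iff Pi_iff)
qed

text \<open>
  If no character separated \<open>x\<close> from \<open>y\<close>, the difference between a continuous function and its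
  translate by \<open>x - y\<close> would have only vanishing Fourier coefficients, hence vanish. A Urysohn
  function that distinguishes 0 from \<open>x - y\<close> excludes this.
\<close>

lemma characters_separate:
  fixes x y :: 'g
  assumes "x \<noteq> y"
  obtains \<xi> where "is_character \<xi>" "\<xi> x \<noteq> \<xi> y"
proof -
  have "\<exists>\<xi>. is_character \<xi> \<and> \<xi> x \<noteq> \<xi> y"
  proof (rule ccontr)
    assume neg: "\<not> ?thesis"
    define a where "a = x - y"
    have a: "\<xi> a = 1" if "is_character \<xi>" for \<xi>
      using neg that character_cnj_mult[OF that] by (auto simp: a_def character_diff)
    obtain u :: "'g \<Rightarrow> real" where u: "continuous_on UNIV u" "u 0 = 0" "u a = 1"
    proof (rule urysohn[of "{0}" "{a}"])
      show "{0} \<inter> {a} = {}" using assms by (auto simp: a_def)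
    qed auto
    define f where "f z = complex_of_real (u z)" for z
    have f: "cont f" unfolding f_def by (intro continuous_intros u)
    define h where "h z = f (z + a) - f z" for z
    have h: "cont h" unfolding h_def by (intro continuous_intros f cont_shift)
    have "h 0 \<noteq> 0" by (simp add: h_def f_def u)
    then obtain \<xi> where \<xi>: "is_character \<xi>" "fourier_coeff m h \<xi> \<noteq> 0"
      using continuous_fourier_nonzero[OF h] by blast
    have fc: "cont (\<lambda>z. f z * cnj (\<xi> z))"
      by (intro continuous_intros f character_continuous \<xi>)
    have "fourier_coeff m h \<xi> = (\<integral>z. f (z + a) * cnj (\<xi> (z + a)) - f z * cnj (\<xi> z) \<partial>m)"
      by (simp add: fourier_coeff_def h_def character_add[OF \<xi>(1)] a[OF \<xi>(1)] algebra_simps)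
    also have "\<dots> = (\<integral>z. f (z + a) * cnj (\<xi> (z + a)) \<partial>m) - (\<integral>z. f z * cnj (\<xi> z) \<partial>m)"
      by (intro Bochner_Integration.integral_diff integrable_continuous fc cont_shift[OF fc])
    also have "\<dots> = 0" using integral_shift[OF fc] by simp
    finally show False using \<xi> by simp
  qed
  then show ?thesis using that by blast
qed

lemma trig_poly_dense:
  fixes u :: "'g \<Rightarrow> real"
  assumes "continuous_on UNIV u" "e > 0"
  obtains t where "t \<in> trig_polys" "\<And>x. norm (of_real (u x) - t x) < e"
proof -
  interpret R: function_ring_on "{u :: 'g \<Rightarrow> real. (\<lambda>x. of_real (u x)) \<in> trig_polys}" UNIV
  proof
    show "continuous_on UNIV u" if "u \<in> {u. (\<lambda>x. of_real (u x)) \<in> trig_polys}" for u :: "'g \<Rightarrow> real"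
    proof -
      have "continuous_on UNIV (\<lambda>x. Re (of_real (u x)))"
        using that by (intro continuous_intros trig_poly_continuous) simp
      then show ?thesis by simp
    qed
    show "\<exists>u\<in>{u. (\<lambda>x. of_real (u x)) \<in> trig_polys}. u x \<noteq> u y" if "x \<noteq> y" for x y :: 'g
    proof -
      obtain \<xi> where \<xi>: "is_character \<xi>" "\<xi> x \<noteq> \<xi> y" using characters_separate[OF \<open>x \<noteq> y\<close>] by blast
      then have "Re (\<xi> x) \<noteq> Re (\<xi> y) \<or> Im (\<xi> x) \<noteq> Im (\<xi> y)" by (simp add: complex_eq_iff)
      then show ?thesis using trig_poly_Re[OF \<xi>(1)] trig_poly_Im[OF \<xi>(1)] by auto
    qed
  qed (auto simp: compact_group trig_poly_const intro: cspan_add trig_poly_mult)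
  obtain g where "(\<lambda>x. of_real (g x)) \<in> trig_polys" "\<And>x. \<bar>u x - g x\<bar> < e"
    using R.Stone_Weierstrass_basic[OF assms] by auto
  then show ?thesis using that[of "\<lambda>x. of_real (g x)"] by (simp flip: of_real_diff)
qed

lemma inner_regular:
  assumes "A \<in> sets m" "d > 0"
  obtains K where "compact K" "K \<subseteq> A" "prob A - d < prob K"
proof -
  have "\<exists>K. compact K \<and> K \<subseteq> A \<and> prob A - d < prob K"
  proof (rule ccontr)
    assume neg: "\<not> ?thesis"
    then have le: "prob K \<le> prob A - d" if "compact K" "K \<subseteq> A" for K using that by (meson not_le)
    from le[of "{}"] have nn: "0 \<le> prob A - d" by simp
    have "ennreal (prob A) = (SUP K\<in>{K. compact K \<and> K \<subseteq> A}. emeasure m K)"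
      using haar assms(1) by (simp add: haar_measure_def emeasure_eq_measure)
    also have "\<dots> \<le> ennreal (prob A - d)"
      by (intro SUP_least) (auto simp: emeasure_eq_measure intro!: ennreal_leI le)
    finally show False using nn assms(2) by (simp add: ennreal_le_iff)
  qed
  then show ?thesis using that by blast
qed

lemma integrable_trig_poly: "t \<in> trig_polys \<Longrightarrow> integrable m t"
  by (intro integrable_continuous trig_poly_continuous)

text \<open>
  For an indicator function, inner regularity provides compact sets that almost exhaust the set and
  its complement, and a Urysohn function between them is uniformly close to a trigonometric
  polynomial.
\<close>

lemma trig_poly_dense_L1:
  fixes f :: "'g \<Rightarrow> complex"
  assumes "integrable m f"
  shows "\<forall>e>0. \<exists>t\<in>trig_polys. (\<integral>x. norm (f x - t x) \<partial>m) < e"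
  using assms
proof induction
  case (base A c)
  show ?case
  proof (intro allI impI)
    fix e :: real assume e: "e > 0"
    \<comment> \<open>Three errors of size \<open>d\<close>: the two parts missed by the compact sets, and the uniform error
      of the polynomial.\<close>
    define d where "d = e / (3 * (norm c + 1))"
    have d: "d > 0" unfolding d_def using e by (intro divide_pos_pos mult_pos_pos add_nonneg_pos) auto
    have A: "A \<in> sets borel" using base by (simp add: sets_m)
    obtain K where K: "compact K" "K \<subseteq> A" "prob A - d < prob K"
      using inner_regular[OF base(1) d] by blast
    obtain C where C: "compact C" "C \<subseteq> - A" "prob (- A) - d < prob C"
      using inner_regular[of "- A", OF _ d] A by (auto simp: sets_m)
    have cl: "closed K" "closed C" using K C by (auto intro: compact_imp_closed)
    have disj: "C \<inter> K = {}" using K C by auto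
    obtain u :: "'g \<Rightarrow> real" where u: "continuous_on UNIV u" "\<And>x. 0 \<le> u x" "\<And>x. u x \<le> 1"
      "\<And>x. x \<in> C \<Longrightarrow> u x = 0" "\<And>x. x \<in> K \<Longrightarrow> u x = 1"
      using urysohn[OF cl(2,1) disj] by blast
    obtain t where t: "t \<in> trig_polys" "\<And>x. norm (of_real (u x) - t x) < d"
      using trig_poly_dense[OF u(1) d] by blast
    have KC: "K \<in> sets m" "C \<in> sets m" using cl by (auto simp: sets_m)
    have "norm (indicator A x *\<^sub>R c - c * t x) \<le> norm c * (indicator (- (K \<union> C)) x + d)" for x
    proof -
      have "norm (complex_of_real (indicator A x) - u x) \<le> indicator (- (K \<union> C)) x"
        using u(2-5)[of x] K(2) C(2) by (auto simp: indicator_def norm_of_real simp flip: of_real_diff)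
      then have "norm (complex_of_real (indicator A x) - t x) \<le> indicator (- (K \<union> C)) x + d"
        using t(2)[of x] norm_triangle_ineq[of "complex_of_real (indicator A x) - u x" "u x - t x"] by simp
      moreover have "indicator A x *\<^sub>R c - c * t x = c * (complex_of_real (indicator A x) - t x)"
        by (simp add: scaleR_conv_of_real algebra_simps)
      ultimately show ?thesis by (simp only: norm_mult) (intro mult_left_mono, auto)
    qed
    then have "(\<integral>x. norm (indicator A x *\<^sub>R c - c * t x) \<partial>m)
        \<le> (\<integral>x. norm c * (indicator (- (K \<union> C)) x + d) \<partial>m)"
      using base(1) KC t(1)
      by (intro integral_mono integrable_norm Bochner_Integration.integrable_diff integrable_mult_right
          Bochner_Integration.integrable_add integrable_real_indicator integrable_indicator
          integrable_trig_poly) (auto simp: sets_m emeasure_eq_measure)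
    also have "\<dots> = norm c * (prob (- (K \<union> C)) + d)"
      using KC by (subst integral_mult_right_zero, subst Bochner_Integration.integral_add)
        (auto simp: sets_m emeasure_eq_measure)
    also have "\<dots> \<le> norm c * (3 * d)"
    proof (intro mult_left_mono)
      have "prob (- (K \<union> C)) = 1 - (prob K + prob C)"
        using prob_compl[of "K \<union> C"] KC finite_measure_Union[of K C] disj
        by (simp add: Compl_eq_Diff_UNIV Int_commute)
      moreover have "prob (- A) = 1 - prob A"
        using prob_compl[OF base(1)] by (simp add: Compl_eq_Diff_UNIV)
      ultimately show "prob (- (K \<union> C)) + d \<le> 3 * d" using K(3) C(3) by simp
    qed simp
    also have "\<dots> = e * (norm c / (norm c + 1))" by (simp add: d_def divide_simps add_nonneg_eq_0_iff)
    also have "\<dots> < e"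
    proof -
      have "norm c / (norm c + 1) < 1"
        by (simp add: divide_simps add_nonneg_pos)
      then show ?thesis using mult_strict_left_mono[OF _ e, of "norm c / (norm c + 1)" 1] by simp
    qed
    finally show "\<exists>t\<in>trig_polys. (\<integral>x. norm (indicator A x *\<^sub>R c - t x) \<partial>m) < e"
      using cspan_scale[OF t(1), of c] by (intro bexI[of _ "\<lambda>x. c * t x"])
  qed
next
  case (add f g)
  show ?case
  proof (intro allI impI)
    fix e :: real assume "e > 0"
    then obtain s t where s: "s \<in> trig_polys" "(\<integral>x. norm (f x - s x) \<partial>m) < e / 2"
      and t: "t \<in> trig_polys" "(\<integral>x. norm (g x - t x) \<partial>m) < e / 2"
      using add(3,4)[rule_format, of "e / 2"] by auto
    have st: "integrable m (\<lambda>x. f x - s x)" "integrable m (\<lambda>x. g x - t x)"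
      using add s t integrable_trig_poly by auto
    have "(\<integral>x. norm (f x + g x - (s x + t x)) \<partial>m) \<le> (\<integral>x. norm (f x - s x) + norm (g x - t x) \<partial>m)"
    proof (intro integral_mono)
      show "norm (f x + g x - (s x + t x)) \<le> norm (f x - s x) + norm (g x - t x)" for x
        using norm_triangle_ineq[of "f x - s x" "g x - t x"] by (simp add: algebra_simps)
      show "integrable m (\<lambda>x. norm (f x + g x - (s x + t x)))"
        using integrable_norm[OF Bochner_Integration.integrable_add[OF st]] by (simp add: algebra_simps)
    qed (use st in auto)
    also have "\<dots> < e" using s t st by simp
    finally show "\<exists>t\<in>trig_polys. (\<integral>x. norm (f x + g x - t x) \<partial>m) < e"
      using cspan_add[OF s(1) t(1)] by (intro bexI[of _ "\<lambda>x. s x + t x"])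
  qed
next
  case (lim f s)
  show ?case
  proof (intro allI impI)
    fix e :: real assume e: "e > 0"
    have "(\<lambda>i. \<integral>x. norm (f x - s i x) \<partial>m) \<longlonglongrightarrow> (\<integral>x. 0 \<partial>m)"
    proof (rule integral_dominated_convergence[where w = "\<lambda>x. 3 * norm (f x)"])
      show "AE x in m. (\<lambda>i. norm (f x - s i x)) \<longlonglongrightarrow> 0"
      proof (intro AE_I2 tendsto_norm_zero)
        fix x assume "x \<in> space m"
        from tendsto_diff[OF tendsto_const[of "f x"] lim(2)[OF this]]
        show "(\<lambda>i. f x - s i x) \<longlonglongrightarrow> 0" by simp
      qed
      show "AE x in m. norm (norm (f x - s i x)) \<le> 3 * norm (f x)" for i
      proof (intro AE_I2)
        fix x assume "x \<in> space m"
        then show "norm (norm (f x - s i x)) \<le> 3 * norm (f x)"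
          using lim(3)[of x i] norm_triangle_ineq4[of "f x" "s i x"] by simp
      qed
    qed (use lim in auto)
    then obtain i where i: "(\<integral>x. norm (f x - s i x) \<partial>m) < e / 2"
      using order_tendstoD(2)[of _ 0 sequentially "e / 2"] e
      by (auto simp: eventually_sequentially)
    obtain t where t: "t \<in> trig_polys" "(\<integral>x. norm (s i x - t x) \<partial>m) < e / 2"
      using lim(5)[of i] e by (auto dest: spec[of _ "e / 2"])
    have st: "integrable m (\<lambda>x. f x - s i x)" "integrable m (\<lambda>x. s i x - t x)"
      using lim t integrable_trig_poly by auto
    have "(\<integral>x. norm (f x - t x) \<partial>m) \<le> (\<integral>x. norm (f x - s i x) + norm (s i x - t x) \<partial>m)"
    proof (intro integral_mono)
      show "norm (f x - t x) \<le> norm (f x - s i x) + norm (s i x - t x)" for x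
        using norm_triangle_ineq[of "f x - s i x" "s i x - t x"] by simp
      show "integrable m (\<lambda>x. norm (f x - t x))"
        using lim t integrable_trig_poly by auto
    qed (use st in auto)
    also have "\<dots> < e" using i t st by simp
    finally show "\<exists>t\<in>trig_polys. (\<integral>x. norm (f x - t x) \<partial>m) < e"
      using t(1) by blast
  qed
qed

section \<open>Approximation within the spectrum\<close>

text \<open>
  A substitute for an approximate identity that stays within the trigonometric polynomials: \<open>w\<close> has
  values in \<open>{0..1}\<close> and equals 1 exactly where all members of \<open>F\<close> do, so the normalised powers of
  \<open>w\<close> concentrate near that set.
\<close>

lemma concentrated_kernel:
  fixes F :: "('g \<Rightarrow> complex) set"
  assumes F: "finite F" "\<And>\<gamma>. \<gamma> \<in> F \<Longrightarrow> is_character \<gamma>" and e: "e > 0"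
  obtains k :: "'g \<Rightarrow> real" where "(\<lambda>x. of_real (k x)) \<in> trig_polys" "\<And>x. k x \<ge> 0"
    "(\<integral>x. k x \<partial>m) = 1"
    "\<And>\<gamma>. \<gamma> \<in> F \<Longrightarrow> norm (fourier_coeff m (\<lambda>x. of_real (k x)) \<gamma> - 1) \<le> e"
proof -
  define w where "w x = (\<Prod>\<gamma>\<in>F. (1 + Re (\<gamma> x)) / 2)" for x
  have fac: "0 \<le> (1 + Re (\<gamma> x)) / 2" "(1 + Re (\<gamma> x)) / 2 \<le> 1" if "\<gamma> \<in> F" for \<gamma> x
    using abs_Re_le_cmod[of "\<gamma> x"] character_norm[OF F(2)[OF that], of x] by auto
  have w0: "w x \<ge> 0" "w x \<le> 1" for x
    unfolding w_def using fac by (auto intro!: prod_nonneg prod_le_1)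
  have wz: "w 0 = 1" unfolding w_def using F by (simp add: character_zero)
  have wc: "continuous_on UNIV w"
    unfolding w_def by (intro continuous_intros character_continuous F) auto
  have wt: "(\<lambda>x. complex_of_real (w x)) \<in> trig_polys"
    unfolding w_def using F
  proof (induction rule: finite_induct)
    case empty then show ?case by (simp add: trig_poly_const[of 1, simplified])
  next
    case (insert \<gamma> F)
    have "(\<lambda>x. 1/2 + 1/2 * complex_of_real (Re (\<gamma> x))) \<in> trig_polys"
      using insert by (intro cspan_add cspan_scale trig_poly_const trig_poly_Re) auto
    also have "(\<lambda>x. 1/2 + 1/2 * complex_of_real (Re (\<gamma> x))) = (\<lambda>x. complex_of_real ((1 + Re (\<gamma> x)) / 2))"
      by (simp add: fun_eq_iff add_divide_distrib)
    finally have 1: "(\<lambda>x. complex_of_real ((1 + Re (\<gamma> x)) / 2)) \<in> trig_polys" .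
    have "(\<lambda>x. complex_of_real (\<Prod>\<gamma>\<in>F. (1 + Re (\<gamma> x)) / 2)) \<in> trig_polys"
      using insert by blast
    note 2 = trig_poly_mult[OF 1 this]
    have eq: "(\<Prod>\<gamma>\<in>insert \<gamma> F. (1 + Re (\<gamma> x)) / 2) = (1 + Re (\<gamma> x)) / 2 * (\<Prod>\<gamma>\<in>F. (1 + Re (\<gamma> x)) / 2)" for x
      using insert(1,2) by simp
    show ?case unfolding eq of_real_mult by (rule 2)
  qed
  have wnt: "(\<lambda>x. complex_of_real (w x ^ n)) \<in> trig_polys" for n
  proof (induction n)
    case 0 then show ?case by (simp add: trig_poly_const[of 1, simplified])
  next
    case (Suc n) then show ?case using trig_poly_mult[OF wt Suc] by simp
  qed
  \<comment> \<open>Where \<open>w > 1 - \<delta>\<close>, every factor of \<open>w\<close> exceeds \<open>1 - \<delta>\<close>, so that \<open>(norm (\<gamma> x - 1))\<^sup>2 \<le> 4 * \<delta>\<close>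
    for all \<open>\<gamma>\<close> in \<open>F\<close>.\<close>
  define \<delta> where "\<delta> = min (1/2) (e\<^sup>2 / 16)"
  have \<delta>: "\<delta> > 0" "\<delta> \<le> 1/2" "4 * \<delta> \<le> (e / 2)\<^sup>2"
    using e by (auto simp: \<delta>_def power_divide)
  have close: "norm (\<gamma> x - 1) \<le> e / 2" if "\<gamma> \<in> F" "w x > 1 - \<delta>" for \<gamma> x
  proof -
    have "w x \<le> (1 + Re (\<gamma> x)) / 2"
    proof -
      have "w x = (1 + Re (\<gamma> x)) / 2 * (\<Prod>\<gamma>\<in>F - {\<gamma>}. (1 + Re (\<gamma> x)) / 2)"
        unfolding w_def by (rule prod.remove[OF F(1) that(1)])
      also have "\<dots> \<le> (1 + Re (\<gamma> x)) / 2 * 1"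
      proof (intro mult_left_mono prod_le_1)
        show "0 \<le> (1 + Re (\<delta> x)) / 2 \<and> (1 + Re (\<delta> x)) / 2 \<le> 1" if "\<delta> \<in> F - {\<gamma>}" for \<delta>
          using fac[of \<delta> x] that by blast
      qed (rule fac(1)[OF that(1)])
      finally show ?thesis by simp
    qed
    then have "2 - 2 * Re (\<gamma> x) \<le> 4 * \<delta>" using that(2) by simp
    moreover have "(norm (\<gamma> x - 1))\<^sup>2 = 2 - 2 * Re (\<gamma> x)"
    proof -
      have "(Re (\<gamma> x))\<^sup>2 + (Im (\<gamma> x))\<^sup>2 = 1"
        using character_norm[OF F(2)[OF that(1)], of x] cmod_power2[of "\<gamma> x"] by simp
      then show ?thesis unfolding cmod_power2 by (simp add: power2_eq_square algebra_simps)
    qed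
    ultimately have "(norm (\<gamma> x - 1))\<^sup>2 \<le> (e / 2)\<^sup>2" using \<delta>(3) by simp
    then show ?thesis by (rule power2_le_imp_le) (use e in simp)
  qed
  define V where "V = {x. w x > 1 - \<delta> / 2}"
  have V: "open V" unfolding V_def by (intro open_Collect_less wc continuous_intros)
  have Vm: "V \<in> sets m" using V by (simp add: sets_m)
  have v: "prob V > 0"
    using emeasure_open_pos[OF V, of 0] wz \<delta>(1) by (simp add: V_def emeasure_eq_measure)
  define I where "I n = (\<integral>x. w x ^ n \<partial>m)" for n
  have wi: "integrable m (\<lambda>x. w x ^ n)" for n
    by (intro integrable_continuous continuous_intros wc)
  have Ige: "I n \<ge> (1 - \<delta> / 2) ^ n * prob V" for n
  proof -
    have "(\<integral>x. (1 - \<delta> / 2) ^ n * indicator V x \<partial>m) \<le> I n"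
      unfolding I_def
    proof (rule integral_mono)
      show "(1 - \<delta> / 2) ^ n * indicator V x \<le> w x ^ n" for x
        using w0[of x] \<delta> by (auto simp: indicator_def V_def intro!: power_mono)
    qed (use wi Vm in \<open>auto simp: emeasure_eq_measure\<close>)
    then show ?thesis using Vm by simp
  qed
  have Ipos: "I n > 0" for n
    using Ige[of n] mult_pos_pos[OF zero_less_power[of "1 - \<delta> / 2" n] v] \<delta> by simp
  \<comment> \<open>The powers of \<open>w\<close> are at most \<open>(1 - \<delta>) ^ n\<close> where \<open>w \<le> 1 - \<delta>\<close>, while their integral is at least
    a multiple of \<open>(1 - \<delta> / 2) ^ n\<close>.\<close>
  define q where "q = (1 - \<delta>) / (1 - \<delta> / 2)"
  have q: "0 \<le> q" "q < 1" using \<delta> by (auto simp: q_def divide_simps)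
  obtain n where n: "q ^ n < e * prob V / 4"
    using real_arch_pow_inv[of "e * prob V / 4" q] q(2) e v by auto
  have small: "2 * (1 - \<delta>) ^ n / I n \<le> e / 2"
  proof -
    have "2 * (1 - \<delta>) ^ n / I n \<le> 2 * (1 - \<delta>) ^ n / ((1 - \<delta> / 2) ^ n * prob V)"
      using Ige[of n] Ipos[of n] v \<delta> by (intro divide_left_mono mult_pos_pos) auto
    also have "\<dots> = 2 * q ^ n / prob V" by (simp add: q_def power_divide)
    also have "\<dots> \<le> e / 2" using n v by (simp add: field_simps)
    finally show ?thesis .
  qed
  define k where "k x = w x ^ n / I n" for x
  have kc: "continuous_on UNIV k"
    unfolding k_def using Ipos[of n] by (intro continuous_intros wc) simp
  have "(\<lambda>x. of_real (1 / I n) * complex_of_real (w x ^ n)) \<in> trig_polys"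
    by (rule cspan_scale[OF wnt])
  then have "(\<lambda>x. complex_of_real (k x)) \<in> trig_polys" by (simp add: k_def)
  moreover have k0: "k x \<ge> 0" for x using w0 Ipos[of n] by (simp add: k_def)
  moreover have k1: "(\<integral>x. k x \<partial>m) = 1" using Ipos[of n] by (simp add: k_def I_def)
  moreover have "norm (fourier_coeff m (\<lambda>x. of_real (k x)) \<gamma> - 1) \<le> e" if \<gamma>: "\<gamma> \<in> F" for \<gamma>
  proof -
    have \<gamma>c: "continuous_on UNIV \<gamma>" by (rule character_continuous[OF F(2)[OF \<gamma>]])
    have i: "integrable m (\<lambda>x. of_real (k x) * cnj (\<gamma> x))" "integrable m (\<lambda>x. complex_of_real (k x))"
      by (intro integrable_continuous continuous_intros kc \<gamma>c)+
    have "fourier_coeff m (\<lambda>x. of_real (k x)) \<gamma> - 1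
        = (\<integral>x. of_real (k x) * cnj (\<gamma> x) \<partial>m) - (\<integral>x. of_real (k x) \<partial>m)"
      by (simp add: fourier_coeff_def k1)
    also have "\<dots> = (\<integral>x. of_real (k x) * cnj (\<gamma> x) - of_real (k x) \<partial>m)"
      by (rule Bochner_Integration.integral_diff[symmetric, OF i])
    also have "norm \<dots> \<le> (\<integral>x. norm (of_real (k x) * cnj (\<gamma> x) - of_real (k x)) \<partial>m)"
      by (rule integral_norm_bound)
    also have "\<dots> \<le> (\<integral>x. k x * (e / 2) + e / 2 \<partial>m)"
    proof (rule integral_mono)
      fix x
      have "norm (of_real (k x) * cnj (\<gamma> x) - of_real (k x)) = norm (of_real (k x) * cnj (\<gamma> x - 1))"
        by (simp add: algebra_simps)
      also have "\<dots> = k x * norm (\<gamma> x - 1)"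
        using k0[of x] by (simp only: norm_mult norm_of_real complex_mod_cnj abs_of_nonneg)
      also have "\<dots> \<le> k x * (e / 2) + e / 2"
      proof (cases "w x > 1 - \<delta>")
        case True
        then have "k x * norm (\<gamma> x - 1) \<le> k x * (e / 2)"
          using k0 close[OF \<gamma>] by (intro mult_left_mono)
        then show ?thesis using e by linarith
      next
        case False
        have "norm (\<gamma> x - 1) \<le> 2"
          using norm_triangle_ineq4[of "\<gamma> x" 1] character_norm[OF F(2)[OF \<gamma>], of x] by simp
        then have "k x * norm (\<gamma> x - 1) \<le> k x * 2"
          using k0 by (intro mult_left_mono)
        also have "\<dots> \<le> 2 * (1 - \<delta>) ^ n / I n"
          using False w0[of x] Ipos[of n] by (auto simp: k_def intro!: divide_right_mono power_mono)
        also have "\<dots> \<le> e / 2" by (rule small)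
        finally show ?thesis using mult_nonneg_nonneg[OF k0[of x], of "e / 2"] e by linarith
      qed
      finally show "norm (of_real (k x) * cnj (\<gamma> x) - of_real (k x)) \<le> k x * (e / 2) + e / 2" .
    qed (use i integrable_continuous[OF kc] in auto)
    also have "\<dots> = e"
      using k1 integrable_continuous[OF kc] by simp
    finally show ?thesis .
  qed
  ultimately show ?thesis using that by blast
qed

lemma conv_sum_characters:
  assumes "integrable m f" "finite F" "\<And>\<gamma>. \<gamma> \<in> F \<Longrightarrow> is_character \<gamma>"
  shows "conv f (\<lambda>x. \<Sum>\<gamma>\<in>F. b \<gamma> * \<gamma> x) = (\<lambda>x. \<Sum>\<gamma>\<in>F. b \<gamma> * fourier_coeff m f \<gamma> * \<gamma> x)"
proof
  fix x
  have "conv f (\<lambda>x. \<Sum>\<gamma>\<in>F. b \<gamma> * \<gamma> x) x = (\<integral>y. (\<Sum>\<gamma>\<in>F. b \<gamma> * (f y * \<gamma> (x - y))) \<partial>m)"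
    by (simp add: conv_def sum_distrib_left mult_ac)
  also have "\<dots> = (\<Sum>\<gamma>\<in>F. b \<gamma> * conv f \<gamma> x)"
    using assms by (simp add: integrable_conv character_continuous conv_def)
  also have "\<dots> = (\<Sum>\<gamma>\<in>F. b \<gamma> * fourier_coeff m f \<gamma> * \<gamma> x)"
    using assms by (intro sum.cong) (auto simp: conv_character)
  finally show "conv f (\<lambda>x. \<Sum>\<gamma>\<in>F. b \<gamma> * \<gamma> x) x = (\<Sum>\<gamma>\<in>F. b \<gamma> * fourier_coeff m f \<gamma> * \<gamma> x)" .
qed

text \<open>
  A special case of Young's inequality: the kernel is nonnegative with integral 1, and the two
  integrations are interchanged by \<open>Fubini_kernel\<close>.
\<close>

lemma conv_kernel_contraction:
  fixes k :: "'g \<Rightarrow> real"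
  assumes u: "integrable m u" and k: "continuous_on UNIV k" "\<And>x. k x \<ge> 0" "(\<integral>x. k x \<partial>m) = 1"
  shows "(\<integral>x. norm (conv u (\<lambda>x. of_real (k x)) x) \<partial>m) \<le> (\<integral>x. norm (u x) \<partial>m)"
proof -
  have kc: "cont (\<lambda>x. of_real (k x))" by (intro continuous_intros k)
  define N where "N x = (\<integral>y. norm (u y) * k (x - y) \<partial>m)" for x
  have nu: "integrable m (\<lambda>x. complex_of_real (norm (u x)))" using u by simp
  have cN: "complex_of_real (N x) = conv (\<lambda>x. of_real (norm (u x))) (\<lambda>x. of_real (k x)) x" for x
    unfolding N_def conv_def by (subst integral_complex_of_real[symmetric]) simp
  have Nc: "continuous_on UNIV N"
  proof -
    have "continuous_on UNIV (\<lambda>x. Re (complex_of_real (N x)))"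
      unfolding cN by (intro continuous_intros continuous_conv nu kc)
    then show ?thesis by simp
  qed
  have "complex_of_real (\<integral>x. N x \<partial>m) = (\<integral>x. 1 * (\<integral>y. of_real (k (x - y)) * of_real (norm (u y)) \<partial>m) \<partial>m)"
    by (subst integral_complex_of_real[symmetric]) (simp add: cN conv_def mult.commute)
  also have "\<dots> = (\<integral>y. (\<integral>x. 1 * of_real (k (x - y)) \<partial>m) * of_real (norm (u y)) \<partial>m)"
    by (rule Fubini_kernel[OF _ kc nu]) simp
  also have "\<dots> = (\<integral>y. of_real (norm (u y)) \<partial>m)"
  proof -
    have "(\<integral>x. complex_of_real (k (x - y)) \<partial>m) = 1" for y
      using integral_shift_diff[OF k(1), of y] k(3) by simp
    then show ?thesis by simp
  qed
  finally have N: "(\<integral>x. N x \<partial>m) = (\<integral>x. norm (u x) \<partial>m)"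
    by (simp only: integral_complex_of_real of_real_eq_iff)
  have "(\<integral>x. norm (conv u (\<lambda>x. of_real (k x)) x) \<partial>m) \<le> (\<integral>x. N x \<partial>m)"
  proof (rule integral_mono)
    show "norm (conv u (\<lambda>x. of_real (k x)) x) \<le> N x" for x
    proof -
      have "norm (conv u (\<lambda>x. of_real (k x)) x) \<le> (\<integral>y. norm (u y * of_real (k (x - y))) \<partial>m)"
        unfolding conv_def by (rule integral_norm_bound)
      then show ?thesis using k(2) by (simp add: N_def norm_mult)
    qed
    show "integrable m (\<lambda>x. norm (conv u (\<lambda>x. of_real (k x)) x))"
      by (intro integrable_norm integrable_continuous continuous_conv u kc)
  qed (rule integrable_continuous[OF Nc])
  then show ?thesis by (simp only: N)
qed

text \<open>
  Choose a trigonometric polynomial \<open>t\<close> close to \<open>f\<close> and a kernel \<open>K\<close> that is concentrated for the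
  characters of \<open>t\<close>. The coefficients of \<open>f * K\<close> are multiples of those of \<open>f\<close>, so \<open>f * K\<close> is a
  trigonometric polynomial with characters in the spectrum of \<open>f\<close>. It is close to \<open>f\<close> because
  \<open>t * K\<close> is close to \<open>t\<close> and convolution with \<open>K\<close> does not increase the norm of \<open>t - f\<close>.
\<close>

theorem spectral_approximation:
  fixes f :: "'g \<Rightarrow> complex"
  assumes f: "integrable m f" and e: "e > 0"
  obtains F c where "finite F" "\<And>\<gamma>. \<gamma> \<in> F \<Longrightarrow> is_character \<gamma>"
    "\<And>\<gamma>. \<gamma> \<in> F \<Longrightarrow> fourier_coeff m f \<gamma> = 0 \<Longrightarrow> c \<gamma> = 0"
    "(\<integral>x. norm (f x - (\<Sum>\<gamma>\<in>F. c \<gamma> * \<gamma> x)) \<partial>m) < e"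
proof -
  obtain t where t: "t \<in> trig_polys" "(\<integral>x. norm (f x - t x) \<partial>m) < e / 3"
    using trig_poly_dense_L1[OF f] e by (auto dest: spec[of _ "e / 3"])
  obtain T a where T: "finite T" "T \<subseteq> Collect is_character" and ta: "t = (\<lambda>x. \<Sum>\<gamma>\<in>T. a \<gamma> * \<gamma> x)"
    using cspan_normal_form[OF t(1)] by blast
  define A where "A = (\<Sum>\<gamma>\<in>T. norm (a \<gamma>)) + 1"
  have A: "A > 0" unfolding A_def by (intro add_nonneg_pos sum_nonneg) auto
  obtain k :: "'g \<Rightarrow> real" where k: "(\<lambda>x. of_real (k x)) \<in> trig_polys" "\<And>x. k x \<ge> 0"
    "(\<integral>x. k x \<partial>m) = 1"
    and kT: "\<And>\<gamma>. \<gamma> \<in> T \<Longrightarrow> norm (fourier_coeff m (\<lambda>x. of_real (k x)) \<gamma> - 1) \<le> e / (3 * A)"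
    by (rule concentrated_kernel[of T "e / (3 * A)"]) (use T e A in auto)
  let ?K = "\<lambda>x. complex_of_real (k x)"
  obtain F b where F: "finite F" "F \<subseteq> Collect is_character" and Kb: "?K = (\<lambda>x. \<Sum>\<gamma>\<in>F. b \<gamma> * \<gamma> x)"
    using cspan_normal_form[OF k(1)] by blast
  have Kc: "cont ?K" by (rule trig_poly_continuous[OF k(1)])
  have kc: "continuous_on UNIV k"
    using continuous_on_Re[OF Kc] by simp
  have tc: "cont t" by (rule trig_poly_continuous[OF t(1)])
  have ti: "integrable m t" by (rule integrable_continuous[OF tc])
  have fK: "conv f ?K = (\<lambda>x. \<Sum>\<gamma>\<in>F. b \<gamma> * fourier_coeff m f \<gamma> * \<gamma> x)"
    unfolding Kb by (rule conv_sum_characters[OF f F(1)]) (use F in auto)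
  have tK: "norm (t x - conv t ?K x) \<le> e / 3" for x
  proof -
    have "conv t ?K = conv ?K t" by (rule conv_commute[OF tc Kc])
    also have "\<dots> = (\<lambda>x. \<Sum>\<gamma>\<in>T. a \<gamma> * fourier_coeff m ?K \<gamma> * \<gamma> x)"
      unfolding ta by (rule conv_sum_characters[OF integrable_continuous[OF Kc] T(1)]) (use T in auto)
    finally have "t x - conv t ?K x = (\<Sum>\<gamma>\<in>T. - (a \<gamma> * (fourier_coeff m ?K \<gamma> - 1) * \<gamma> x))"
      by (simp add: ta sum_subtractf[symmetric] algebra_simps)
    also have "norm \<dots> \<le> (\<Sum>\<gamma>\<in>T. norm (a \<gamma>) * (e / (3 * A)))"
    proof (rule sum_norm_le)
      fix \<gamma> assume \<gamma>: "\<gamma> \<in> T"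
      then have "norm (\<gamma> x) = 1" using T character_norm by auto
      then show "norm (- (a \<gamma> * (fourier_coeff m ?K \<gamma> - 1) * \<gamma> x)) \<le> norm (a \<gamma>) * (e / (3 * A))"
        unfolding norm_minus_cancel norm_mult using kT[OF \<gamma>] by (simp add: mult_left_mono del: times_divide_eq_right)
    qed
    also have "\<dots> = (A - 1) * (e / (3 * A))" by (simp only: A_def sum_distrib_right[symmetric]) simp
    also have "\<dots> \<le> e / 3" using A e by (simp add: field_simps)
    finally show ?thesis .
  qed
  define u where "u x = t x - f x" for x
  have u: "integrable m u" unfolding u_def using ti f by simp
  have uK: "conv u ?K x = conv t ?K x - conv f ?K x" for x
    unfolding conv_def u_def left_diff_distrib
    by (intro Bochner_Integration.integral_diff integrable_conv ti f Kc)
  have ci: "integrable m (conv h ?K)" if "integrable m h" for h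
    by (intro integrable_continuous continuous_conv that Kc)
  have "(\<integral>x. norm (f x - conv f ?K x) \<partial>m) \<le> (\<integral>x. norm (f x - t x) + e / 3 + norm (conv u ?K x) \<partial>m)"
  proof (rule integral_mono)
    fix x
    have "f x - conv f ?K x = (f x - t x) + (t x - conv t ?K x) + conv u ?K x" by (simp add: uK)
    also have "norm \<dots> \<le> norm (f x - t x) + norm (t x - conv t ?K x) + norm (conv u ?K x)"
      by (intro norm_triangle_le add_mono norm_triangle_ineq) auto
    finally show "norm (f x - conv f ?K x) \<le> norm (f x - t x) + e / 3 + norm (conv u ?K x)"
      using tK[of x] by simp
  qed (use f ti ci u in auto)
  also have "\<dots> = (\<integral>x. norm (f x - t x) \<partial>m) + e / 3 + (\<integral>x. norm (conv u ?K x) \<partial>m)"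
    using f ti ci[OF u] by simp
  also have "(\<integral>x. norm (conv u ?K x) \<partial>m) \<le> (\<integral>x. norm (u x) \<partial>m)"
    by (rule conv_kernel_contraction[OF u kc k(2,3)])
  also have "(\<integral>x. norm (u x) \<partial>m) = (\<integral>x. norm (f x - t x) \<partial>m)"
    by (simp add: u_def norm_minus_commute)
  finally have "(\<integral>x. norm (f x - conv f ?K x) \<partial>m) < e" using t(2) by simp
  then show ?thesis
    using that[of F "\<lambda>\<gamma>. b \<gamma> * fourier_coeff m f \<gamma>"] F by (auto simp: fK)
qed

text \<open>
  The approximating polynomials of \<open>spectral_approximation\<close> are zero.
\<close>

theorem fourier_uniqueness:
  fixes f :: "'g \<Rightarrow> complex"
  assumes f: "integrable m f" and z: "\<And>\<gamma>. is_character \<gamma> \<Longrightarrow> fourier_coeff m f \<gamma> = 0"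
  shows "AE x in m. f x = 0"
proof -
  have "(\<integral>x. norm (f x) \<partial>m) \<le> 0 + e" if e: "e > 0" for e
  proof -
    obtain F c where F: "finite F" "\<And>\<gamma>. \<gamma> \<in> F \<Longrightarrow> is_character \<gamma>"
      "\<And>\<gamma>. \<gamma> \<in> F \<Longrightarrow> fourier_coeff m f \<gamma> = 0 \<Longrightarrow> c \<gamma> = 0"
      "(\<integral>x. norm (f x - (\<Sum>\<gamma>\<in>F. c \<gamma> * \<gamma> x)) \<partial>m) < e"
      using spectral_approximation[OF f e] by blast
    have "(\<Sum>\<gamma>\<in>F. c \<gamma> * \<gamma> x) = 0" for x
      using F z by (intro sum.neutral) auto
    then show ?thesis using F(4) by simp
  qed
  then have "(\<integral>x. norm (f x) \<partial>m) \<le> 0" by (rule field_le_epsilon)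
  then have "(\<integral>x. norm (f x) \<partial>m) = 0" by (intro antisym) auto
  then show ?thesis
    using integral_nonneg_eq_0_iff_AE[OF integrable_norm[OF f]] by simp
qed

end

section \<open>Matched characters on two groups\<close>

lemma AE_summable_of_integrals:
  fixes u :: "nat \<Rightarrow> 'a \<Rightarrow> complex"
  assumes i: "\<And>k. integrable M (u k)" and s: "summable (\<lambda>k. \<integral>x. norm (u k x) \<partial>M)"
  shows "AE x in M. summable (\<lambda>k. norm (u k x))"
proof -
  have [measurable]: "u k \<in> borel_measurable M" for k using i by auto
  have "(\<integral>\<^sup>+x. (\<Sum>k. ennreal (norm (u k x))) \<partial>M) = (\<Sum>k. \<integral>\<^sup>+x. ennreal (norm (u k x)) \<partial>M)"
    by (rule nn_integral_suminf) simp
  also have "\<dots> = (\<Sum>k. ennreal (\<integral>x. norm (u k x) \<partial>M))"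
    by (intro arg_cong[where f = suminf] ext nn_integral_eq_integral integrable_norm i) auto
  also have "\<dots> \<noteq> \<infinity>" using s by (simp add: ennreal_suminf_neq_top)
  finally have "AE x in M. (\<Sum>k. ennreal (norm (u k x))) \<noteq> \<infinity>"
    by (intro nn_integral_noteq_infinite) auto
  then show ?thesis
    by eventually_elim (auto intro: summable_suminf_not_top)
qed

text \<open>
  \<open>X\<close> is a group of pairs of characters; by the last assumption it is the graph of an isomorphism
  between two groups of characters. A pair is regarded as a single function on the disjoint sum of
  the two groups, so that a polynomial in matched characters is formed on both sides at once.
\<close>

locale paired_groups = G: compact_haar m + H: compact_haar m'
  for m :: "'g::{topological_ab_group_add,t2_space} measure"
    and m' :: "'h::{topological_ab_group_add,t2_space} measure" +
  fixes X :: "(('g \<Rightarrow> complex) \<times> ('h \<Rightarrow> complex)) set"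
  assumes character: "(\<gamma>, \<gamma>') \<in> X \<Longrightarrow> is_character \<gamma> \<and> is_character \<gamma>'"
    and one: "((\<lambda>_. 1), (\<lambda>_. 1)) \<in> X"
    and mult: "(\<gamma>, \<gamma>') \<in> X \<Longrightarrow> (\<delta>, \<delta>') \<in> X \<Longrightarrow> ((\<lambda>x. \<gamma> x * \<delta> x), (\<lambda>x. \<gamma>' x * \<delta>' x)) \<in> X"
    and conj: "(\<gamma>, \<gamma>') \<in> X \<Longrightarrow> ((\<lambda>x. cnj (\<gamma> x)), (\<lambda>x. cnj (\<gamma>' x))) \<in> X"
    and trivial: "(\<gamma>, \<gamma>') \<in> X \<Longrightarrow> \<gamma> = (\<lambda>_. 1) \<longleftrightarrow> \<gamma>' = (\<lambda>_. 1)"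
begin

definition paired_characters :: "('g + 'h \<Rightarrow> complex) set" where
  "paired_characters = (\<lambda>(\<gamma>, \<gamma>'). case_sum \<gamma> \<gamma>') ` X"

abbreviation paired_polys :: "('g + 'h \<Rightarrow> complex) set" where
  "paired_polys \<equiv> cspan paired_characters"

lemma paired_charactersI: "(\<gamma>, \<gamma>') \<in> X \<Longrightarrow> case_sum \<gamma> \<gamma>' \<in> paired_characters"
  by (force simp: paired_characters_def)

lemma paired_charactersE:
  assumes "w \<in> paired_characters"
  obtains \<gamma> \<gamma>' where "(\<gamma>, \<gamma>') \<in> X" "w = case_sum \<gamma> \<gamma>'"
  using assms by (auto simp: paired_characters_def)

lemma paired_poly_continuous:
  assumes "w \<in> paired_polys"
  shows "continuous_on UNIV (\<lambda>x. w (Inl x)) \<and> continuous_on UNIV (\<lambda>x. w (Inr x))"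
  using assms
proof induction
  case (step \<gamma> f c)
  then obtain \<delta> \<delta>' where *: "(\<delta>, \<delta>') \<in> X" "\<gamma> = case_sum \<delta> \<delta>'" by (elim paired_charactersE)
  then have "continuous_on UNIV \<delta>" "continuous_on UNIV \<delta>'"
    using character character_continuous by blast+
  then show ?case using step by (auto simp: * intro!: continuous_intros)
qed simp

lemma paired_poly_mult:
  assumes "v \<in> paired_polys" "w \<in> paired_polys"
  shows "(\<lambda>x. v x * w x) \<in> paired_polys"
proof (rule cspan_mult[OF _ assms])
  fix \<gamma> \<delta> assume "\<gamma> \<in> paired_characters" "\<delta> \<in> paired_characters"
  then obtain \<gamma>1 \<gamma>2 \<delta>1 \<delta>2 where *: "(\<gamma>1, \<gamma>2) \<in> X" "\<gamma> = case_sum \<gamma>1 \<gamma>2" "(\<delta>1, \<delta>2) \<in> X" "\<delta> = case_sum \<delta>1 \<delta>2"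
    by (elim paired_charactersE)
  have "(\<lambda>x. \<gamma> x * \<delta> x) = case_sum (\<lambda>x. \<gamma>1 x * \<delta>1 x) (\<lambda>x. \<gamma>2 x * \<delta>2 x)"
    by (auto simp: * fun_eq_iff split: sum.splits)
  then show "(\<lambda>x. \<gamma> x * \<delta> x) \<in> paired_characters"
    using paired_charactersI[OF mult[OF *(1,3)]] by simp
qed

lemma paired_poly_cnj:
  assumes "w \<in> paired_polys"
  shows "(\<lambda>x. cnj (w x)) \<in> paired_polys"
proof (rule cspan_cnj[OF _ assms])
  fix \<gamma> assume "\<gamma> \<in> paired_characters"
  then obtain \<gamma>1 \<gamma>2 where *: "(\<gamma>1, \<gamma>2) \<in> X" "\<gamma> = case_sum \<gamma>1 \<gamma>2"
    by (elim paired_charactersE)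
  have "(\<lambda>x. cnj (\<gamma> x)) = case_sum (\<lambda>x. cnj (\<gamma>1 x)) (\<lambda>x. cnj (\<gamma>2 x))"
    by (auto simp: * fun_eq_iff split: sum.splits)
  then show "(\<lambda>x. cnj (\<gamma> x)) \<in> paired_characters"
    using paired_charactersI[OF conj[OF *(1)]] by simp
qed

lemma paired_poly_const: "(\<lambda>_. c) \<in> paired_polys"
proof (rule cspan_const)
  have "case_sum (\<lambda>_. 1) (\<lambda>_. 1) = (\<lambda>_::'g + 'h. 1 :: complex)"
    by (auto simp: fun_eq_iff split: sum.splits)
  then show "(\<lambda>_. 1) \<in> paired_characters" using paired_charactersI[OF one] by simp
qed

text \<open>
  The integral of a character depends only on whether it is trivial, so it is the same for the two
  members of a pair.
\<close>

lemma paired_poly_integral: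
  assumes "w \<in> paired_polys"
  shows "(\<integral>x. w (Inl x) \<partial>m) = (\<integral>x. w (Inr x) \<partial>m')"
  using assms
proof induction
  case (step w f c)
  then obtain \<gamma> \<gamma>' where *: "(\<gamma>, \<gamma>') \<in> X" "w = case_sum \<gamma> \<gamma>'" by (elim paired_charactersE)
  have ch: "is_character \<gamma>" "is_character \<gamma>'" using character[OF *(1)] by auto
  have i: "integrable m \<gamma>" "integrable m' \<gamma>'" "integrable m (\<lambda>x. f (Inl x))" "integrable m' (\<lambda>x. f (Inr x))"
    using ch paired_poly_continuous[OF step(2)]
    by (auto intro: G.integrable_continuous H.integrable_continuous character_continuous)
  have "(\<integral>x. \<gamma> x \<partial>m) = (\<integral>x. \<gamma>' x \<partial>m')"
    using G.integral_character[OF ch(1)] H.integral_character[OF ch(2)] trivial[OF *(1)] by simp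
  then show ?case using i step(3) by (simp add: *)
qed simp

lemma paired_poly_real_polynomial:
  assumes "(\<lambda>x. complex_of_real (v x)) \<in> paired_polys" "real_polynomial_function (g :: real \<Rightarrow> real)"
  shows "(\<lambda>x. complex_of_real (g (v x))) \<in> paired_polys"
  using assms(2)
proof induction
  case (linear f)
  then obtain c where "f = (\<lambda>x. x * c)" using real_bounded_linear by blast
  then show ?case using cspan_scale[OF assms(1), of "of_real c"] by (simp add: mult.commute)
next
  case (const c) show ?case by (rule paired_poly_const)
next
  case (add f g) then show ?case using cspan_add by fastforce
next
  case (mult f g) then show ?case using paired_poly_mult by fastforce
qed

text \<open>
  Every polynomial in \<open>(norm w)\<^sup>2 = w * cnj w\<close> is again a matched polynomial, so all even moments of
  \<open>norm w\<close> agree on the two groups. As \<open>w\<close> is bounded, the Weierstrass approximation theorem extends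
  this to all continuous functions of \<open>norm w\<close>.
\<close>

lemma paired_poly_norm_distribution:
  fixes h :: "real \<Rightarrow> real"
  assumes w: "w \<in> paired_polys" and h: "continuous_on UNIV h"
  shows "(\<integral>x. h (norm (w (Inl x))) \<partial>m) = (\<integral>x. h (norm (w (Inr x))) \<partial>m')"
proof -
  have wc: "continuous_on UNIV (\<lambda>x. w (Inl x))" "continuous_on UNIV (\<lambda>x. w (Inr x))"
    using paired_poly_continuous[OF w] by auto
  obtain C1 where C1: "C1 > 0" "\<And>x. norm (w (Inl x)) \<le> C1" using G.continuous_bounded[OF wc(1)] by blast
  obtain C2 where C2: "C2 > 0" "\<And>x. norm (w (Inr x)) \<le> C2" using H.continuous_bounded[OF wc(2)] by blast
  define C where "C = max C1 C2"
  have C: "norm (w z) \<le> C" for z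
    by (cases z) (use C1 C2 in \<open>auto simp: C_def le_max_iff_disj\<close>)
  have v: "(\<lambda>z. complex_of_real ((norm (w z))\<^sup>2)) \<in> paired_polys"
  proof -
    have "(\<lambda>z. w z * cnj (w z)) \<in> paired_polys" by (intro paired_poly_mult paired_poly_cnj w)
    then show ?thesis by (simp only: complex_norm_square)
  qed
  have hc: "continuous_on UNIV (\<lambda>x. h (norm (w (Inl x))))" "continuous_on UNIV (\<lambda>x. h (norm (w (Inr x))))"
    by (intro continuous_on_compose2[OF h] continuous_intros wc; simp)+
  have "\<bar>(\<integral>x. h (norm (w (Inl x))) \<partial>m) - (\<integral>x. h (norm (w (Inr x))) \<partial>m')\<bar> \<le> 0 + e" if e: "e > 0" for e
  proof -
    have "continuous_on {0..C\<^sup>2} (\<lambda>s. h (sqrt s))"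
      by (intro continuous_on_compose2[OF h] continuous_intros) auto
    then obtain g where g: "real_polynomial_function g" "\<And>s. s \<in> {0..C\<^sup>2} \<Longrightarrow> \<bar>h (sqrt s) - g s\<bar> < e / 2"
      using Stone_Weierstrass_real_polynomial_function[of "{0..C\<^sup>2}" "\<lambda>s. h (sqrt s)" "e / 2"] e by auto
    have le: "\<bar>h (norm (w z)) - g ((norm (w z))\<^sup>2)\<bar> \<le> e / 2" for z
      using g(2)[of "(norm (w z))\<^sup>2"] C[of z] by (simp add: power_mono less_imp_le)
    have gp: "(\<lambda>z. complex_of_real (g ((norm (w z))\<^sup>2))) \<in> paired_polys"
      by (rule paired_poly_real_polynomial[OF v g(1)])
    have gc: "continuous_on UNIV (\<lambda>x. g ((norm (w (Inl x)))\<^sup>2))" "continuous_on UNIV (\<lambda>x. g ((norm (w (Inr x)))\<^sup>2))"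
      using paired_poly_continuous[OF gp] continuous_on_Re by fastforce+
    have "complex_of_real (\<integral>x. g ((norm (w (Inl x)))\<^sup>2) \<partial>m) = of_real (\<integral>x. g ((norm (w (Inr x)))\<^sup>2) \<partial>m')"
      using paired_poly_integral[OF gp] by (simp only: integral_complex_of_real)
    then have eq: "(\<integral>x. g ((norm (w (Inl x)))\<^sup>2) \<partial>m) = (\<integral>x. g ((norm (w (Inr x)))\<^sup>2) \<partial>m')"
      by (simp only: of_real_eq_iff)
    have 1: "\<bar>(\<integral>x. h (norm (w (Inl x))) \<partial>m) - (\<integral>x. g ((norm (w (Inl x)))\<^sup>2) \<partial>m)\<bar> \<le> e / 2"
    proof -
      have "\<bar>(\<integral>x. h (norm (w (Inl x))) \<partial>m) - (\<integral>x. g ((norm (w (Inl x)))\<^sup>2) \<partial>m)\<bar>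
          = \<bar>\<integral>x. h (norm (w (Inl x))) - g ((norm (w (Inl x)))\<^sup>2) \<partial>m\<bar>"
        using G.integrable_continuous[OF hc(1)] G.integrable_continuous[OF gc(1)] by simp
      also have "\<dots> \<le> (\<integral>x. \<bar>h (norm (w (Inl x))) - g ((norm (w (Inl x)))\<^sup>2)\<bar> \<partial>m)"
        by (rule integral_abs_bound)
      also have "\<dots> \<le> (\<integral>x. e / 2 \<partial>m)"
        using G.integrable_continuous[OF hc(1)] G.integrable_continuous[OF gc(1)] le
        by (intro integral_mono) auto
      finally show ?thesis by simp
    qed
    have 2: "\<bar>(\<integral>x. h (norm (w (Inr x))) \<partial>m') - (\<integral>x. g ((norm (w (Inr x)))\<^sup>2) \<partial>m')\<bar> \<le> e / 2"
    proof -
      have "\<bar>(\<integral>x. h (norm (w (Inr x))) \<partial>m') - (\<integral>x. g ((norm (w (Inr x)))\<^sup>2) \<partial>m')\<bar>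
          = \<bar>\<integral>x. h (norm (w (Inr x))) - g ((norm (w (Inr x)))\<^sup>2) \<partial>m'\<bar>"
        using H.integrable_continuous[OF hc(2)] H.integrable_continuous[OF gc(2)] by simp
      also have "\<dots> \<le> (\<integral>x. \<bar>h (norm (w (Inr x))) - g ((norm (w (Inr x)))\<^sup>2)\<bar> \<partial>m')"
        by (rule integral_abs_bound)
      also have "\<dots> \<le> (\<integral>x. e / 2 \<partial>m')"
        using H.integrable_continuous[OF hc(2)] H.integrable_continuous[OF gc(2)] le
        by (intro integral_mono) auto
      finally show ?thesis by simp
    qed
    show ?thesis using 1 2 eq by linarith
  qed
  then have "\<bar>(\<integral>x. h (norm (w (Inl x))) \<partial>m) - (\<integral>x. h (norm (w (Inr x))) \<partial>m')\<bar> \<le> 0"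
    by (rule field_le_epsilon)
  then show ?thesis by simp
qed

lemma paired_poly_iexp:
  assumes w: "w \<in> paired_polys"
  shows "(\<integral>x. iexp (t * norm (w (Inl x))) \<partial>m) = (\<integral>x. iexp (t * norm (w (Inr x))) \<partial>m')"
proof -
  have wc: "continuous_on UNIV (\<lambda>x. w (Inl x))" "continuous_on UNIV (\<lambda>x. w (Inr x))"
    using paired_poly_continuous[OF w] by auto
  have i: "integrable m (\<lambda>x. iexp (t * norm (w (Inl x))))" "integrable m' (\<lambda>x. iexp (t * norm (w (Inr x))))"
    by (intro G.integrable_continuous H.integrable_continuous continuous_intros wc)+
  have c: "(\<integral>x. cos (t * norm (w (Inl x))) \<partial>m) = (\<integral>x. cos (t * norm (w (Inr x))) \<partial>m')"
    by (rule paired_poly_norm_distribution[OF w]) (intro continuous_intros)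
  have s: "(\<integral>x. sin (t * norm (w (Inl x))) \<partial>m) = (\<integral>x. sin (t * norm (w (Inr x))) \<partial>m')"
    by (rule paired_poly_norm_distribution[OF w]) (intro continuous_intros)
  have re: "Re (iexp y) = cos y" and im: "Im (iexp y) = sin y" for y
    by (simp_all add: Re_exp Im_exp)
  show ?thesis
  proof (rule complex_eqI)
    show "Re (\<integral>x. iexp (t * norm (w (Inl x))) \<partial>m) = Re (\<integral>x. iexp (t * norm (w (Inr x))) \<partial>m')"
      unfolding integral_Re[OF i(1), symmetric] integral_Re[OF i(2), symmetric] re by (rule c)
    show "Im (\<integral>x. iexp (t * norm (w (Inl x))) \<partial>m) = Im (\<integral>x. iexp (t * norm (w (Inr x))) \<partial>m')"
      unfolding integral_Im[OF i(1), symmetric] integral_Im[OF i(2), symmetric] im by (rule s)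
  qed
qed

text \<open>
  The distances of the approximants in mean are the same on both groups, so they form a Cauchy
  sequence on the second one as well, with limit \<open>g\<close>. The geometric rate makes both sequences
  converge almost everywhere, hence the characteristic functions of the distributions of their
  moduli converge by dominated convergence.
\<close>

lemma transfer_L1_limit:
  fixes f :: "'g \<Rightarrow> complex"
  assumes w: "\<And>k. w k \<in> paired_polys" and f: "integrable m f"
    and close: "\<And>k. (\<integral>x. norm (f x - w k (Inl x)) \<partial>m) < (1/2) ^ k"
  shows "\<exists>g. integrable m' g \<and>
    (\<forall>\<delta>. is_character \<delta> \<longrightarrow>
      (\<lambda>k. fourier_coeff m' (\<lambda>x. w k (Inr x)) \<delta>) \<longlonglongrightarrow> fourier_coeff m' g \<delta>) \<and>
    distr m borel (\<lambda>x. norm (f x)) = distr m' borel (\<lambda>x. norm (g x))"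
proof -
  have wc: "continuous_on UNIV (\<lambda>x. w k (Inl x))" "continuous_on UNIV (\<lambda>x. w k (Inr x))" for k
    using paired_poly_continuous[OF w] by auto
  have wi: "integrable m (\<lambda>x. w k (Inl x))" "integrable m' (\<lambda>x. w k (Inr x))" for k
    by (intro G.integrable_continuous H.integrable_continuous wc)+
  \<comment> \<open>The limit is obtained as a telescoping series.\<close>
  define v where "v k x = w (Suc k) (Inr x) - w k (Inr x)" for k x
  have vi: "integrable m' (v k)" for k unfolding v_def using wi by simp
  have vn: "(\<integral>x. norm (v k x) \<partial>m') \<le> 2 * (1/2) ^ k" for k
  proof -
    have d: "(\<lambda>z. w (Suc k) z + (-1) * w k z) \<in> paired_polys"
      by (intro cspan_add cspan_scale w)
    have "(\<integral>x. norm (v k x) \<partial>m') = (\<integral>x. norm (w (Suc k) (Inl x) - w k (Inl x)) \<partial>m)"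
      using paired_poly_norm_distribution[OF d continuous_on_id] by (simp add: v_def)
    also have "\<dots> \<le> (\<integral>x. norm (f x - w k (Inl x)) + norm (f x - w (Suc k) (Inl x)) \<partial>m)"
    proof (rule integral_mono)
      show "norm (w (Suc k) (Inl x) - w k (Inl x)) \<le> norm (f x - w k (Inl x)) + norm (f x - w (Suc k) (Inl x))" for x
        using norm_triangle_ineq4[of "f x - w k (Inl x)" "f x - w (Suc k) (Inl x)"] by simp
    qed (use f wi in auto)
    also have "\<dots> = (\<integral>x. norm (f x - w k (Inl x)) \<partial>m) + (\<integral>x. norm (f x - w (Suc k) (Inl x)) \<partial>m)"
      using f wi by simp
    also have "\<dots> \<le> (1/2) ^ k + (1/2) ^ Suc k"
      using close[of k] close[of "Suc k"] by (intro add_mono) auto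
    also have "\<dots> \<le> 2 * (1/2) ^ k" by simp
    finally show ?thesis .
  qed
  have geo: "summable (\<lambda>k. 2 * (1/2 :: real) ^ k)" by (intro summable_mult summable_geometric) simp
  have vs: "summable (\<lambda>k. \<integral>x. norm (v k x) \<partial>m')"
    by (rule summable_comparison_test'[OF geo]) (use vn in auto)
  have vae: "AE x in m'. summable (\<lambda>k. norm (v k x))"
    by (rule AE_summable_of_integrals[OF vi vs])
  define g where "g x = w 0 (Inr x) + (\<Sum>k. v k x)" for x
  have gi: "integrable m' g"
    unfolding g_def using integrable_suminf[OF vi vae vs] wi by simp
  have tel: "w 0 (Inr x) + (\<Sum>k<n. v k x) = w n (Inr x)" for n x
    by (induction n) (simp_all add: v_def add.assoc[symmetric])
  have gl: "AE x in m'. (\<lambda>k. w k (Inr x)) \<longlonglongrightarrow> g x"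
    using vae
  proof eventually_elim
    case (elim x)
    have "(\<lambda>n. w 0 (Inr x) + (\<Sum>k<n. v k x)) \<longlonglongrightarrow> g x"
      unfolding g_def by (intro tendsto_intros summable_LIMSEQ summable_norm_cancel[OF elim])
    then show ?case by (simp only: tel)
  qed
  have fs: "summable (\<lambda>k. \<integral>x. norm (f x - w k (Inl x)) \<partial>m)"
    by (rule summable_comparison_test'[of "\<lambda>k. (1/2 :: real) ^ k"])
      (use close in \<open>auto intro!: summable_geometric less_imp_le\<close>)
  have "AE x in m. summable (\<lambda>k. norm (f x - w k (Inl x)))"
    by (rule AE_summable_of_integrals[OF _ fs]) (use f wi in auto)
  then have fl: "AE x in m. (\<lambda>k. w k (Inl x)) \<longlonglongrightarrow> f x"
  proof eventually_elim
    case (elim x)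
    from tendsto_diff[OF tendsto_const[of "f x"] tendsto_norm_zero_cancel[OF summable_LIMSEQ_zero[OF elim]]]
    show ?case by simp
  qed
  have coeff: "(\<lambda>k. fourier_coeff m' (\<lambda>x. w k (Inr x)) \<delta>) \<longlonglongrightarrow> fourier_coeff m' g \<delta>"
    if \<delta>: "is_character \<delta>" for \<delta>
  proof -
    have dc: "continuous_on UNIV (\<lambda>x. cnj (\<delta> x))" by (intro continuous_intros character_continuous \<delta>)
    have nd: "norm (v k x * cnj (\<delta> x)) = norm (v k x)" for k x
      by (simp add: norm_mult character_norm[OF \<delta>])
    have vdi: "integrable m' (\<lambda>x. v k x * cnj (\<delta> x))" for k
      by (rule H.integrable_mult_continuous(1)[OF vi dc])
    have sums: "(\<lambda>k. \<integral>x. v k x * cnj (\<delta> x) \<partial>m') sums (\<integral>x. (\<Sum>k. v k x * cnj (\<delta> x)) \<partial>m')"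
      by (rule sums_integral[OF vdi]) (simp_all only: nd vae vs)
    have wd: "integrable m' (\<lambda>x. w k (Inr x) * cnj (\<delta> x))" for k
      by (rule H.integrable_mult_continuous(1)[OF wi(2) dc])
    have S: "integrable m' (\<lambda>x. (\<Sum>k. v k x) * cnj (\<delta> x))"
      by (rule H.integrable_mult_continuous(1)[OF integrable_suminf[OF vi vae vs] dc])
    have "(\<integral>x. (\<Sum>k. v k x * cnj (\<delta> x)) \<partial>m') = (\<integral>x. (\<Sum>k. v k x) * cnj (\<delta> x) \<partial>m')"
    proof (rule integral_cong_AE)
      show "AE x in m'. (\<Sum>k. v k x * cnj (\<delta> x)) = (\<Sum>k. v k x) * cnj (\<delta> x)"
        using vae by eventually_elim (simp add: suminf_mult2 summable_norm_cancel)
      show "(\<lambda>x. \<Sum>k. v k x * cnj (\<delta> x)) \<in> borel_measurable m'"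
        using vdi by (intro borel_measurable_suminf) auto
      show "(\<lambda>x. (\<Sum>k. v k x) * cnj (\<delta> x)) \<in> borel_measurable m'"
        using S by auto
    qed
    then have lim: "fourier_coeff m' g \<delta>
        = fourier_coeff m' (\<lambda>x. w 0 (Inr x)) \<delta> + (\<integral>x. (\<Sum>k. v k x * cnj (\<delta> x)) \<partial>m')"
      unfolding fourier_coeff_def g_def distrib_right using wd S by simp
    have part: "fourier_coeff m' (\<lambda>x. w n (Inr x)) \<delta>
        = fourier_coeff m' (\<lambda>x. w 0 (Inr x)) \<delta> + (\<Sum>k<n. \<integral>x. v k x * cnj (\<delta> x) \<partial>m')" for n
    proof (induction n)
      case (Suc n)
      have "(\<integral>x. v n x * cnj (\<delta> x) \<partial>m')
          = fourier_coeff m' (\<lambda>x. w (Suc n) (Inr x)) \<delta> - fourier_coeff m' (\<lambda>x. w n (Inr x)) \<delta>"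
        unfolding fourier_coeff_def v_def left_diff_distrib using wd by simp
      with Suc show ?case by simp
    qed simp
    show ?thesis
      unfolding lim using sums
      by (subst part) (intro tendsto_add tendsto_const, simp add: sums_def)
  qed
  have law: "distr m borel (\<lambda>x. norm (f x)) = distr m' borel (\<lambda>x. norm (g x))"
  proof (rule Levy_uniqueness)
    have mf [measurable]: "(\<lambda>x. norm (f x)) \<in> borel_measurable m"
      by (rule measurable_compose[OF borel_measurable_integrable[OF f] borel_measurable_norm])
    have mg [measurable]: "(\<lambda>x. norm (g x)) \<in> borel_measurable m'"
      by (rule measurable_compose[OF borel_measurable_integrable[OF gi] borel_measurable_norm])
    have mw [measurable]: "(\<lambda>x. norm (w k (Inl x))) \<in> borel_measurable m"
      "(\<lambda>x. norm (w k (Inr x))) \<in> borel_measurable m'" for k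
      by (rule measurable_compose[OF borel_measurable_integrable borel_measurable_norm], rule wi)+
    show "real_distribution (distr m borel (\<lambda>x. norm (f x)))" by (rule G.real_distribution_distr[OF mf])
    show "real_distribution (distr m' borel (\<lambda>x. norm (g x)))" by (rule H.real_distribution_distr[OF mg])
    show "char (distr m borel (\<lambda>x. norm (f x))) = char (distr m' borel (\<lambda>x. norm (g x)))"
    proof
      fix t
      have 1: "(\<lambda>k. \<integral>x. iexp (t * norm (w k (Inl x))) \<partial>m) \<longlonglongrightarrow> (\<integral>x. iexp (t * norm (f x)) \<partial>m)"
      proof (rule integral_dominated_convergence[where w = "\<lambda>_. 1"])
        show "AE x in m. (\<lambda>k. iexp (t * norm (w k (Inl x)))) \<longlonglongrightarrow> iexp (t * norm (f x))"
          using fl by eventually_elim (intro tendsto_intros)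
      qed (simp_all, measurable)
      have 2: "(\<lambda>k. \<integral>x. iexp (t * norm (w k (Inr x))) \<partial>m') \<longlonglongrightarrow> (\<integral>x. iexp (t * norm (g x)) \<partial>m')"
      proof (rule integral_dominated_convergence[where w = "\<lambda>_. 1"])
        show "AE x in m'. (\<lambda>k. iexp (t * norm (w k (Inr x)))) \<longlonglongrightarrow> iexp (t * norm (g x))"
          using gl by eventually_elim (intro tendsto_intros)
      qed (simp_all, measurable)
      have "(\<integral>x. iexp (t * norm (f x)) \<partial>m) = (\<integral>x. iexp (t * norm (g x)) \<partial>m')"
        by (rule LIMSEQ_unique[OF 1]) (use 2 in \<open>simp only: paired_poly_iexp[OF w]\<close>)
      then show "char (distr m borel (\<lambda>x. norm (f x))) t = char (distr m' borel (\<lambda>x. norm (g x))) t"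
        unfolding char_def using mf mg by (simp add: integral_distr)
    qed
  qed
  from gi coeff law show ?thesis by (intro exI[of _ g] conjI allI impI)
qed

end

section \<open>Distribution of the modulus and the Lebesgue norms\<close>

lemma lp_space_measurable: "f \<in> lp_space M p \<Longrightarrow> f \<in> borel_measurable M"
  by (simp add: lp_space_def)

lemma one_le_enn2real: "1 \<le> p \<Longrightarrow> p \<noteq> \<infinity> \<Longrightarrow> 1 \<le> enn2real p"
  by (cases p) (auto simp: ennreal_1[symmetric] simp del: ennreal_1)

lemma lp_space_integrable:
  assumes M: "prob_space M" and p: "1 \<le> p" and f: "f \<in> lp_space M p"
  shows "integrable M f"
proof -
  interpret prob_space M by (rule M)
  have fm: "f \<in> borel_measurable M" by (rule lp_space_measurable[OF f])
  show ?thesis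
  proof (cases "p = \<infinity>")
    case True
    define C where "C = esssup M (\<lambda>x. ennreal (norm (f x)))"
    have "C < \<infinity>" using f True by (simp add: lp_space_def C_def)
    moreover have "AE x in M. ennreal (norm (f x)) \<le> C" unfolding C_def by (rule esssup_AE)
    ultimately have "AE x in M. norm (f x) \<le> enn2real C"
      using enn2real_mono[of "ennreal (norm (f x))" C for x] by (auto elim!: eventually_mono)
    then show ?thesis using fm by (rule integrable_const_bound)
  next
    case False
    define q where "q = enn2real p"
    have q: "q \<ge> 1" unfolding q_def by (rule one_le_enn2real[OF p False])
    have i: "integrable M (\<lambda>x. 1 + norm (f x) powr q)"
      using f False by (simp add: lp_space_def q_def)
    show ?thesis
    proof (rule Bochner_Integration.integrable_bound[OF i fm])
      have "norm (f x) \<le> 1 + norm (f x) powr q" for x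
      proof (cases "norm (f x) \<le> 1")
        case True
        then show ?thesis by (simp add: add_increasing2)
      next
        case False
        then have "norm (f x) powr 1 \<le> norm (f x) powr q" using q by (intro powr_mono) auto
        then show ?thesis using False by simp
      qed
      then show "AE x in M. norm (f x) \<le> norm (1 + norm (f x) powr q)"
        by (intro AE_I2) (simp add: add_nonneg_nonneg)
    qed
  qed
qed

lemma lp_space_add:
  assumes f: "f \<in> lp_space M p" and g: "g \<in> lp_space M p"
  shows "(\<lambda>x. f x + g x) \<in> lp_space M p"
proof -
  note [measurable] = lp_space_measurable[OF f] lp_space_measurable[OF g]
  show ?thesis
  proof (cases "p = \<infinity>")
    case True
    let ?F = "esssup M (\<lambda>x. ennreal (norm (f x)))" and ?G = "esssup M (\<lambda>x. ennreal (norm (g x)))"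
    have "esssup M (\<lambda>x. ennreal (norm (f x + g x))) \<le> ?F + ?G"
    proof (rule esssup_I)
      show "AE x in M. ennreal (norm (f x + g x)) \<le> ?F + ?G"
        using esssup_AE[of "\<lambda>x. ennreal (norm (f x))" M] esssup_AE[of "\<lambda>x. ennreal (norm (g x))" M]
      proof eventually_elim
        case (elim x)
        have "ennreal (norm (f x + g x)) \<le> ennreal (norm (f x)) + ennreal (norm (g x))"
          by (simp add: norm_triangle_ineq ennreal_leI flip: ennreal_plus)
        then show ?case using add_mono[OF elim] by (rule order_trans)
      qed
    qed simp
    also have "\<dots> < \<infinity>" using f g True by (simp add: lp_space_def)
    finally show ?thesis using True by (simp add: lp_space_def)
  next
    case False
    define q where "q = enn2real p"
    have q: "q \<ge> 0" by (simp add: q_def)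
    have i: "integrable M (\<lambda>x. 2 powr q * (norm (f x) powr q + norm (g x) powr q))"
      using f g False by (simp add: lp_space_def q_def)
    have "integrable M (\<lambda>x. norm (f x + g x) powr q)"
    proof (rule Bochner_Integration.integrable_bound[OF i])
      have "norm (f x + g x) powr q \<le> 2 powr q * (norm (f x) powr q + norm (g x) powr q)" for x
      proof -
        have "norm (f x + g x) \<le> 2 * max (norm (f x)) (norm (g x))"
          using norm_triangle_ineq[of "f x" "g x"] by simp
        then have "norm (f x + g x) powr q \<le> (2 * max (norm (f x)) (norm (g x))) powr q"
          using q by (intro powr_mono2) auto
        also have "\<dots> = 2 powr q * max (norm (f x)) (norm (g x)) powr q"
          by (rule powr_mult)
        also have "\<dots> \<le> 2 powr q * (norm (f x) powr q + norm (g x) powr q)"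
          by (intro mult_left_mono) (auto simp: max_def)
        finally show ?thesis .
      qed
      then show "AE x in M. norm (norm (f x + g x) powr q)
          \<le> norm (2 powr q * (norm (f x) powr q + norm (g x) powr q))"
        by (intro AE_I2) simp
    qed measurable
    then show ?thesis using False by (simp add: lp_space_def q_def)
  qed
qed

lemma lp_space_scale:
  assumes f: "f \<in> lp_space M p"
  shows "(\<lambda>x. c * f x) \<in> lp_space M p"
proof -
  note [measurable] = lp_space_measurable[OF f]
  show ?thesis
  proof (cases "p = \<infinity>")
    case True
    let ?F = "esssup M (\<lambda>x. ennreal (norm (f x)))"
    have "esssup M (\<lambda>x. ennreal (norm (c * f x))) \<le> ennreal (norm c) * ?F"
    proof (rule esssup_I)
      show "AE x in M. ennreal (norm (c * f x)) \<le> ennreal (norm c) * ?F"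
        using esssup_AE[of "\<lambda>x. ennreal (norm (f x))" M]
        by eventually_elim (simp add: norm_mult ennreal_mult mult_left_mono)
    qed simp
    also have "\<dots> < \<infinity>" using f True by (simp add: lp_space_def ennreal_mult_less_top)
    finally show ?thesis using True by (simp add: lp_space_def)
  next
    case False
    then show ?thesis using f by (simp add: lp_space_def norm_mult powr_mult)
  qed
qed

text \<open>
  For every exponent, infinity included, membership and norm depend only on the distribution of the
  modulus.
\<close>

lemma lp_space_norm_distr:
  assumes f: "f \<in> lp_space M p" and g: "g \<in> borel_measurable N"
    and d: "distr M borel (\<lambda>x. norm (f x)) = distr N borel (\<lambda>x. norm (g x))"
  shows "g \<in> lp_space N p" and "lp_norm N p g = lp_norm M p f"
proof -
  have fm: "(\<lambda>x. norm (f x)) \<in> borel_measurable M" and gm: "(\<lambda>x. norm (g x)) \<in> borel_measurable N"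
    using lp_space_measurable[OF f] g by auto
  have "(AE x in M. ennreal (norm (f x)) \<le> z) \<longleftrightarrow> (AE x in N. ennreal (norm (g x)) \<le> z)" for z
    using AE_distr_iff[OF fm, of "\<lambda>y. ennreal y \<le> z"] AE_distr_iff[OF gm, of "\<lambda>y. ennreal y \<le> z"]
    unfolding d by simp
  then have e: "esssup M (\<lambda>x. ennreal (norm (f x))) = esssup N (\<lambda>x. ennreal (norm (g x)))"
    using fm gm by (simp add: esssup_eq_AE)
  have i: "integrable M (\<lambda>x. norm (f x) powr q) \<longleftrightarrow> integrable N (\<lambda>x. norm (g x) powr q)" for q
    using integrable_distr_eq[OF fm, of "\<lambda>y. y powr q"] integrable_distr_eq[OF gm, of "\<lambda>y. y powr q"]
    unfolding d by simp
  have n: "(\<integral>x. norm (f x) powr q \<partial>M) = (\<integral>x. norm (g x) powr q \<partial>N)" for q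
    using integral_distr[OF fm, of "\<lambda>y. y powr q"] integral_distr[OF gm, of "\<lambda>y. y powr q"]
    unfolding d by simp
  show "g \<in> lp_space N p" using f g unfolding lp_space_def mem_Collect_eq e i by blast
  show "lp_norm N p g = lp_norm M p f" by (simp add: lp_norm_def e n)
qed

lemma lp_norm_cong_AE:
  assumes f: "f \<in> lp_space M p" and g: "g \<in> lp_space M p" and e: "AE x in M. f x = g x"
  shows "lp_norm M p f = lp_norm M p g"
proof -
  note [measurable] = lp_space_measurable[OF f] lp_space_measurable[OF g]
  have "distr M borel (\<lambda>x. norm (f x)) = distr M borel (\<lambda>x. norm (g x))"
    by (rule distr_cong_AE) (use e in \<open>auto elim!: eventually_mono\<close>)
  then show ?thesis using lp_space_norm_distr(2)[OF f lp_space_measurable[OF g]] by simp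
qed

section \<open>Dirichlet groups\<close>

lemma lifts_frequency_unique:
  fixes \<beta> :: "real \<Rightarrow> 'g::{topological_ab_group_add,t2_space}"
  assumes "dirichlet_group \<beta>" "lifts_frequency \<beta> x \<gamma>" "lifts_frequency \<beta> x \<delta>"
  shows "\<gamma> = \<delta>"
proof -
  have "closed {z. \<gamma> z = \<delta> z}"
    using assms by (intro closed_Collect_eq character_continuous) (auto simp: lifts_frequency_def)
  moreover have "range \<beta> \<subseteq> {z. \<gamma> z = \<delta> z}" using assms by (auto simp: lifts_frequency_def)
  ultimately have "closure (range \<beta>) \<subseteq> {z. \<gamma> z = \<delta> z}" by (intro closure_minimal)
  then show ?thesis using assms(1) by (auto simp: dirichlet_group_def)
qed

lemma freq_character_eq:
  fixes \<beta> :: "real \<Rightarrow> 'g::{topological_ab_group_add,t2_space}"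
  assumes "dirichlet_group \<beta>" "lifts_frequency \<beta> x \<gamma>"
  shows "freq_character \<beta> x = \<gamma>"
  unfolding freq_character_def using assms lifts_frequency_unique by blast

lemma lifts_freq_character:
  fixes \<beta> :: "real \<Rightarrow> 'g::{topological_ab_group_add,t2_space}"
  assumes "freq_dirichlet_group \<beta> l"
  shows "lifts_frequency \<beta> (l n) (freq_character \<beta> (l n))"
  using assms freq_character_eq by (metis freq_dirichlet_group_def)

lemma lifts_frequency_zero: "lifts_frequency \<beta> 0 (\<lambda>_. 1)"
  by (simp add: lifts_frequency_def is_character_one)

lemma lifts_frequency_add:
  "lifts_frequency \<beta> x \<gamma> \<Longrightarrow> lifts_frequency \<beta> y \<delta> \<Longrightarrow> lifts_frequency \<beta> (x + y) (\<lambda>z. \<gamma> z * \<delta> z)"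
  by (simp add: lifts_frequency_def is_character_mult exp_add[symmetric] algebra_simps)

lemma lifts_frequency_minus:
  "lifts_frequency \<beta> x \<gamma> \<Longrightarrow> lifts_frequency \<beta> (- x) (\<lambda>z. cnj (\<gamma> z))"
  by (simp add: lifts_frequency_def is_character_cnj exp_cnj)

lemma lifts_frequency_trivial_iff:
  fixes \<beta> :: "real \<Rightarrow> 'g::{topological_ab_group_add,t2_space}"
  assumes "dirichlet_group \<beta>" "lifts_frequency \<beta> x \<gamma>"
  shows "\<gamma> = (\<lambda>_. 1) \<longleftrightarrow> x = 0"
proof
  assume "x = 0"
  then show "\<gamma> = (\<lambda>_. 1)" using lifts_frequency_unique[OF assms(1)] assms(2) lifts_frequency_zero by blast
next
  assume 1: "\<gamma> = (\<lambda>_. 1)"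
  show "x = 0"
  proof (rule ccontr)
    assume "x \<noteq> 0"
    have "exp (- \<i> * complex_of_real (x * (pi / x))) = 1"
      using assms(2) unfolding lifts_frequency_def 1 by metis
    moreover have "x * (pi / x) = pi" using \<open>x \<noteq> 0\<close> by simp
    ultimately show False by (simp only:) (simp add: exp_minus)
  qed
qed

context compact_haar
begin

section \<open>Hardy spaces\<close>

lemma fourier_coeff_add:
  assumes "integrable m f" "integrable m g" "is_character \<gamma>"
  shows "fourier_coeff m (\<lambda>x. f x + g x) \<gamma> = fourier_coeff m f \<gamma> + fourier_coeff m g \<gamma>"
  unfolding fourier_coeff_def distrib_right
  by (intro Bochner_Integration.integral_add integrable_mult_continuous assms continuous_intros character_continuous)

lemma fourier_coeff_diff:
  assumes "integrable m f" "integrable m g" "is_character \<gamma>"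
  shows "fourier_coeff m (\<lambda>x. f x - g x) \<gamma> = fourier_coeff m f \<gamma> - fourier_coeff m g \<gamma>"
  unfolding fourier_coeff_def left_diff_distrib
  by (intro Bochner_Integration.integral_diff integrable_mult_continuous assms continuous_intros character_continuous)

lemma fourier_coeff_scale: "fourier_coeff m (\<lambda>x. c * f x) \<gamma> = c * fourier_coeff m f \<gamma>"
  by (simp add: fourier_coeff_def mult.assoc)

lemma norm_fourier_coeff_le:
  assumes "is_character \<gamma>"
  shows "norm (fourier_coeff m f \<gamma>) \<le> (\<integral>x. norm (f x) \<partial>m)"
proof -
  have "norm (fourier_coeff m f \<gamma>) \<le> (\<integral>x. norm (f x * cnj (\<gamma> x)) \<partial>m)"
    unfolding fourier_coeff_def by (rule integral_norm_bound)
  then show ?thesis by (simp add: norm_mult character_norm[OF assms])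
qed

lemma hardy_functions_integrable: "1 \<le> p \<Longrightarrow> f \<in> hardy_functions m \<beta> p l \<Longrightarrow> integrable m f"
  using lp_space_integrable[OF prob_space_axioms] by (simp add: hardy_functions_def)

text \<open>
  Two functions that represent the same series agree almost everywhere by \<open>fourier_uniqueness\<close>,
  which makes the definite description in \<open>hardy_norm\<close> meaningful.
\<close>

lemma hardy_norm_eq:
  assumes p: "1 \<le> p" and f: "f \<in> hardy_functions m \<beta> p l" "has_dirichlet_coeffs m \<beta> l f a"
  shows "hardy_norm m \<beta> p l a = lp_norm m p f"
  unfolding hardy_norm_def
proof (rule the_equality)
  show "\<exists>f'\<in>hardy_functions m \<beta> p l. has_dirichlet_coeffs m \<beta> l f' a \<and> lp_norm m p f = lp_norm m p f'"
    using f by blast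
  fix r assume "\<exists>g\<in>hardy_functions m \<beta> p l. has_dirichlet_coeffs m \<beta> l g a \<and> r = lp_norm m p g"
  then obtain g where g: "g \<in> hardy_functions m \<beta> p l" "has_dirichlet_coeffs m \<beta> l g a" "r = lp_norm m p g"
    by blast
  have i: "integrable m f" "integrable m g" using hardy_functions_integrable[OF p] f g by auto
  have "AE x in m. f x - g x = 0"
  proof (rule fourier_uniqueness)
    fix \<gamma> :: "'g \<Rightarrow> complex" assume \<gamma>: "is_character \<gamma>"
    have "fourier_coeff m f \<gamma> = fourier_coeff m g \<gamma>"
    proof (cases "\<exists>n. \<gamma> = freq_character \<beta> (l n)")
      case True then show ?thesis using f g by (auto simp: has_dirichlet_coeffs_def)
    next
      case False then show ?thesis using f g \<gamma> by (simp add: hardy_functions_def)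
    qed
    then show "fourier_coeff m (\<lambda>x. f x - g x) \<gamma> = 0"
      using fourier_coeff_diff[OF i \<gamma>] by simp
  qed (use i in simp)
  then have "AE x in m. f x = g x" by simp
  then show "r = lp_norm m p f"
    using f(1) g(1,3) lp_norm_cong_AE[of f m p g] by (simp add: hardy_functions_def)
qed

lemma hardy_series_add:
  assumes \<beta>: "freq_dirichlet_group \<beta> l" and p: "1 \<le> p"
    and a: "a \<in> hardy_series m \<beta> p l" "b \<in> hardy_series m \<beta> p l"
  shows "(\<lambda>n. a n + b n) \<in> hardy_series m \<beta> p l"
proof -
  obtain f g where f: "f \<in> hardy_functions m \<beta> p l" "has_dirichlet_coeffs m \<beta> l f a"
    and g: "g \<in> hardy_functions m \<beta> p l" "has_dirichlet_coeffs m \<beta> l g b"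
    using a by (auto simp: hardy_series_def)
  have i: "integrable m f" "integrable m g" using hardy_functions_integrable[OF p] f g by auto
  have ch: "is_character (freq_character \<beta> (l n))" for n
    using lifts_freq_character[OF \<beta>] by (simp add: lifts_frequency_def)
  have "(\<lambda>x. f x + g x) \<in> hardy_functions m \<beta> p l"
    using f g by (auto simp: hardy_functions_def fourier_coeff_add[OF i] intro: lp_space_add)
  moreover have "has_dirichlet_coeffs m \<beta> l (\<lambda>x. f x + g x) (\<lambda>n. a n + b n)"
    using f g by (simp add: has_dirichlet_coeffs_def fourier_coeff_add[OF i ch])
  ultimately show ?thesis by (auto simp: hardy_series_def)
qed

lemma hardy_series_scale:
  assumes a: "a \<in> hardy_series m \<beta> p l"
  shows "(\<lambda>n. c * a n) \<in> hardy_series m \<beta> p l"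
proof -
  obtain f where f: "f \<in> hardy_functions m \<beta> p l" "has_dirichlet_coeffs m \<beta> l f a"
    using a by (auto simp: hardy_series_def)
  have "(\<lambda>x. c * f x) \<in> hardy_functions m \<beta> p l"
    using f by (auto simp: hardy_functions_def fourier_coeff_scale intro: lp_space_scale)
  moreover have "has_dirichlet_coeffs m \<beta> l (\<lambda>x. c * f x) (\<lambda>n. c * a n)"
    using f by (simp add: has_dirichlet_coeffs_def fourier_coeff_scale)
  ultimately show ?thesis by (auto simp: hardy_series_def)
qed

end

section \<open>Frequencies and logarithms of primes\<close>

abbreviation nth_prime :: "nat \<Rightarrow> nat" where
  "nth_prime \<equiv> enumerate {q::nat. prime q}"

lemma prime_nth_prime: "prime (nth_prime j)"
  using enumerate_in_set[OF primes_infinite, of j] by simp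

lemma nth_prime_eq_iff: "nth_prime i = nth_prime j \<longleftrightarrow> i = j"
  using strict_mono_eq[OF strict_mono_enumerate[OF primes_infinite]] .

lemma prime_monomial_pos: "prime_monomial \<alpha> > 0"
  unfolding prime_monomial_def using prime_gt_0_nat[OF prime_nth_prime] by (auto intro!: prod_pos)

lemma ln_prime_monomial:
  assumes "finite {j. \<alpha> j \<noteq> 0}"
  shows "ln (real (prime_monomial \<alpha>)) = (\<Sum>j | \<alpha> j \<noteq> 0. real (\<alpha> j) * ln (real (nth_prime j)))"
proof -
  have "real (nth_prime j) > 0" for j using prime_gt_0_nat[OF prime_nth_prime, of j] by simp
  then show ?thesis
    unfolding prime_monomial_def of_nat_prod of_nat_power
    by (subst ln_prod) (use assms in \<open>auto simp: ln_realpow\<close>)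
qed

text \<open>
  Separating positive from negative coefficients turns the relation into an equality of two
  products of prime powers, and unique factorisation compares the exponents.
\<close>

lemma ln_primes_independent:
  fixes k :: "nat \<Rightarrow> int"
  assumes J: "finite J" and s: "(\<Sum>j\<in>J. of_int (k j) * ln (real (nth_prime j))) = 0" and i: "i \<in> J"
  shows "k i = 0"
proof -
  have pos: "real (nth_prime j) > 0" for j using prime_gt_0_nat[OF prime_nth_prime, of j] by simp
  define P where "P e = (\<Prod>j\<in>J. nth_prime j ^ e j)" for e
  have lnP: "ln (real (P e)) = (\<Sum>j\<in>J. real (e j) * ln (real (nth_prime j)))" for e
    unfolding P_def of_nat_prod of_nat_power
    using pos by (subst ln_prod) (auto simp: ln_realpow J less_imp_neq[symmetric])
  have Ppos: "real (P e) > 0" for e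
    unfolding P_def using pos by (simp add: prod_pos)
  have "real_of_int (k j) = real (nat (k j)) - real (nat (- k j))" for j by simp
  then have "ln (real (P (\<lambda>j. nat (k j)))) = ln (real (P (\<lambda>j. nat (- k j))))"
    using s by (simp add: lnP left_diff_distrib sum_subtractf)
  then have eq: "P (\<lambda>j. nat (k j)) = P (\<lambda>j. nat (- k j))" using Ppos by simp
  have mult: "multiplicity (nth_prime i) (P e) = e i" for e
  proof -
    define r where "r = inv_into UNIV nth_prime"
    have r: "r (nth_prime j) = j" for j
      unfolding r_def by (rule inv_f_f) (auto simp: inj_def nth_prime_eq_iff)
    have P: "P e = (\<Prod>x\<in>nth_prime ` J. x ^ e (r x))"
      unfolding P_def by (subst prod.reindex) (auto simp: inj_on_def nth_prime_eq_iff r)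
    then show ?thesis
      using i J by (subst P, subst multiplicity_prod_prime_powers) (auto simp: prime_nth_prime r)
  qed
  have "nat (k i) = nat (- k i)" using mult[of "\<lambda>j. nat (k j)"] mult[of "\<lambda>j. nat (- k j)"] eq by simp
  then show ?thesis by simp
qed

text \<open>
  The graph of the additive map with \<open>B j \<mapsto> ln (nth_prime j)\<close> on the integer combinations of \<open>B\<close>.
  The coefficients vanish outside \<open>J\<close> so that two combinations can be added over the union of their
  index sets.
\<close>

definition matched_frequencies :: "enat \<Rightarrow> (nat \<Rightarrow> real) \<Rightarrow> (real \<times> real) set" where
  "matched_frequencies L B =
     {(\<Sum>j\<in>J. of_int (k j) * B j, \<Sum>j\<in>J. of_int (k j) * ln (real (nth_prime j))) | J k.
        finite J \<and> (\<forall>j\<in>J. enat j < L) \<and> (\<forall>j. j \<notin> J \<longrightarrow> k j = (0::int))}"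

lemma matched_frequencies_zero: "(0, 0) \<in> matched_frequencies L B"
  unfolding matched_frequencies_def by (auto intro!: exI[of _ "{}"] exI[of _ "\<lambda>_. 0"])

lemma matched_frequencies_add:
  assumes "(x, x') \<in> matched_frequencies L B" "(y, y') \<in> matched_frequencies L B"
  shows "(x + y, x' + y') \<in> matched_frequencies L B"
proof -
  obtain J k where J: "finite J" "\<forall>j\<in>J. enat j < L" "\<forall>j. j \<notin> J \<longrightarrow> k j = (0::int)"
    "x = (\<Sum>j\<in>J. of_int (k j) * B j)" "x' = (\<Sum>j\<in>J. of_int (k j) * ln (real (nth_prime j)))"
    using assms(1) by (auto simp: matched_frequencies_def)
  obtain I i where I: "finite I" "\<forall>j\<in>I. enat j < L" "\<forall>j. j \<notin> I \<longrightarrow> i j = (0::int)"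
    "y = (\<Sum>j\<in>I. of_int (i j) * B j)" "y' = (\<Sum>j\<in>I. of_int (i j) * ln (real (nth_prime j)))"
    using assms(2) by (auto simp: matched_frequencies_def)
  have "(\<Sum>j\<in>J. of_int (k j) * b j) + (\<Sum>j\<in>I. of_int (i j) * b j) = (\<Sum>j\<in>J \<union> I. of_int (k j + i j) * b j)"
    for b :: "nat \<Rightarrow> real"
  proof -
    have "(\<Sum>j\<in>J. of_int (k j) * b j) = (\<Sum>j\<in>J \<union> I. of_int (k j) * b j)"
      using J I by (intro sum.mono_neutral_left) auto
    moreover have "(\<Sum>j\<in>I. of_int (i j) * b j) = (\<Sum>j\<in>J \<union> I. of_int (i j) * b j)"
      using J I by (intro sum.mono_neutral_left) auto
    ultimately show ?thesis by (simp add: distrib_right sum.distrib)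
  qed
  then have "x + y = (\<Sum>j\<in>J \<union> I. of_int (k j + i j) * B j)"
    "x' + y' = (\<Sum>j\<in>J \<union> I. of_int (k j + i j) * ln (real (nth_prime j)))"
    using J I by auto
  moreover have "finite (J \<union> I)" "\<forall>j\<in>J \<union> I. enat j < L" "\<forall>j. j \<notin> J \<union> I \<longrightarrow> k j + i j = 0"
    using J I by auto
  ultimately show ?thesis
    unfolding matched_frequencies_def by (intro CollectI exI[of _ "J \<union> I"] exI[of _ "\<lambda>j. k j + i j"]) simp
qed

lemma matched_frequencies_minus:
  assumes "(x, x') \<in> matched_frequencies L B"
  shows "(- x, - x') \<in> matched_frequencies L B"
proof -
  obtain J k where J: "finite J" "\<forall>j\<in>J. enat j < L" "\<forall>j. j \<notin> J \<longrightarrow> k j = (0::int)"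
    "x = (\<Sum>j\<in>J. of_int (k j) * B j)" "x' = (\<Sum>j\<in>J. of_int (k j) * ln (real (nth_prime j)))"
    using assms(1) by (auto simp: matched_frequencies_def)
  then show ?thesis
    unfolding matched_frequencies_def
    by (intro CollectI exI[of _ J] exI[of _ "\<lambda>j. - k j"]) (simp add: sum_negf)
qed

text \<open>
  One direction is independence of the basis and says that the correspondence is well defined; the
  other is independence of the logarithms of the primes and says that it is injective.
\<close>

lemma matched_frequencies_zero_iff:
  assumes B: "rat_independent L B" and xy: "(x, y) \<in> matched_frequencies L B"
  shows "x = 0 \<longleftrightarrow> y = 0"
proof -
  obtain J k where J: "finite J" "\<forall>j\<in>J. enat j < L"
    and x: "x = (\<Sum>j\<in>J. of_int (k j) * B j)" and y: "y = (\<Sum>j\<in>J. of_int (k j) * ln (real (nth_prime j)))"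
    using xy by (auto simp: matched_frequencies_def)
  show ?thesis
  proof
    assume "x = 0"
    then have "(\<Sum>j\<in>J. real_of_rat (of_int (k j)) * B j) = 0" by (simp add: x)
    then have "\<forall>j\<in>J. (of_int (k j) :: rat) = 0"
      using B[unfolded rat_independent_def, THEN spec[of _ J], THEN spec[of _ "\<lambda>j. of_int (k j)"]] J
      by (simp only:) blast
    then show "y = 0" by (simp add: y)
  next
    assume "y = 0"
    then have "\<forall>j\<in>J. k j = 0" using ln_primes_independent[OF J(1), of k] y by simp
    then show "x = 0" by (simp add: x)
  qed
qed

lemma natural_decomposition_matched:
  assumes "natural_decomposition l L B R"
  shows "(l n, ln (real (prime_monomial (R n)))) \<in> matched_frequencies L B"
proof -
  have "represents l L B (\<lambda>n k. of_nat (R n k))"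
    using assms by (simp add: natural_decomposition_def bohr_matrix_def)
  then have fin: "finite {k. R n k \<noteq> 0}" and L: "\<forall>k. R n k \<noteq> 0 \<longrightarrow> enat k < L"
    and l: "l n = (\<Sum>k | R n k \<noteq> 0. real (R n k) * B k)"
    by (auto simp: represents_def)
  show ?thesis
    unfolding matched_frequencies_def ln_prime_monomial[OF fin] l
    by (intro CollectI exI[of _ "{k. R n k \<noteq> 0}"] exI[of _ "\<lambda>k. int (R n k)"]) (use fin L in simp)
qed

section \<open>Transfer of the coefficients\<close>

lemma transfers_coeffs_unique:
  assumes "transfers_coeffs R a b" "transfers_coeffs R a b'"
  shows "b = b'"
proof
  fix i
  have "ordinary_coeff b (Suc i) = ordinary_coeff b' (Suc i)"
  proof (cases "\<exists>n. Suc i = prime_monomial (R n)")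
    case True then show ?thesis using assms by (auto simp: transfers_coeffs_def)
  next
    case False then show ?thesis using assms by (simp add: transfers_coeffs_def)
  qed
  then show "b i = b' i" by (simp add: ordinary_coeff_def)
qed

text \<open>
  The function that represents \<open>a\<close> is approximated by polynomials in its own characters \<open>h n\<close>. Each
  \<open>h n\<close> is matched with the character \<open>h' n\<close> of frequency \<open>ln (prime_monomial (R n))\<close>, and
  \<open>transfer_L1_limit\<close> yields a function \<open>g\<close> whose modulus has the same distribution. The coefficient
  of \<open>g\<close> at \<open>h' n\<close> is that of the original function at \<open>h n\<close>, because on the approximants both are
  integrals of a matched polynomial.
\<close>

lemma transfer_exists:
  fixes \<beta> :: "real \<Rightarrow> 'g::{topological_ab_group_add,t2_space}" and m :: "'g measure"
    and \<beta>' :: "real \<Rightarrow> 'h::{topological_ab_group_add,t2_space}" and m' :: "'h measure"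
  assumes p: "1 \<le> p" and dec: "natural_decomposition l L B R"
    and \<beta>: "freq_dirichlet_group \<beta> l" and m: "haar_measure m"
    and \<beta>': "freq_dirichlet_group \<beta>' log_freq" and m': "haar_measure m'"
    and a: "a \<in> hardy_series m \<beta> p l"
  shows "\<exists>b\<in>hardy_series m' \<beta>' p log_freq. transfers_coeffs R a b \<and>
    hardy_norm m' \<beta>' p log_freq b = hardy_norm m \<beta> p l a"
proof -
  have dg: "dirichlet_group \<beta>" and dg': "dirichlet_group \<beta>'"
    using \<beta> \<beta>' by (auto simp: freq_dirichlet_group_def)
  interpret G: compact_haar m
    using dg m by unfold_locales (auto simp: dirichlet_group_def)
  interpret H: compact_haar m'
    using dg' m' by unfold_locales (auto simp: dirichlet_group_def)
  define X where "X = {(\<gamma>, \<gamma>'). \<exists>x y. (x, y) \<in> matched_frequencies L B \<and>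
    lifts_frequency \<beta> x \<gamma> \<and> lifts_frequency \<beta>' y \<gamma>'}"
  have XI: "(\<gamma>, \<gamma>') \<in> X" if "(x, y) \<in> matched_frequencies L B"
    "lifts_frequency \<beta> x \<gamma>" "lifts_frequency \<beta>' y \<gamma>'" for x y \<gamma> \<gamma>'
    unfolding X_def using that by blast
  have ind: "rat_independent L B"
    using dec by (simp add: natural_decomposition_def bohr_matrix_def is_basis_def)
  interpret paired_groups m m' X
  proof
    fix \<gamma> \<gamma>' assume "(\<gamma>, \<gamma>') \<in> X"
    then obtain x y where xy: "(x, y) \<in> matched_frequencies L B"
      "lifts_frequency \<beta> x \<gamma>" "lifts_frequency \<beta>' y \<gamma>'" by (auto simp: X_def)
    show "is_character \<gamma> \<and> is_character \<gamma>'" using xy by (simp add: lifts_frequency_def)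
    show "((\<lambda>x. cnj (\<gamma> x)), (\<lambda>x. cnj (\<gamma>' x))) \<in> X"
      by (rule XI[OF matched_frequencies_minus[OF xy(1)] lifts_frequency_minus[OF xy(2)]
          lifts_frequency_minus[OF xy(3)]])
    show "\<gamma> = (\<lambda>_. 1) \<longleftrightarrow> \<gamma>' = (\<lambda>_. 1)"
      using matched_frequencies_zero_iff[OF ind xy(1)] lifts_frequency_trivial_iff[OF dg xy(2)]
        lifts_frequency_trivial_iff[OF dg' xy(3)] by simp
    fix \<delta> \<delta>' assume "(\<delta>, \<delta>') \<in> X"
    then obtain u v where uv: "(u, v) \<in> matched_frequencies L B"
      "lifts_frequency \<beta> u \<delta>" "lifts_frequency \<beta>' v \<delta>'" by (auto simp: X_def)
    show "((\<lambda>x. \<gamma> x * \<delta> x), (\<lambda>x. \<gamma>' x * \<delta>' x)) \<in> X"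
      by (rule XI[OF matched_frequencies_add[OF xy(1) uv(1)] lifts_frequency_add[OF xy(2) uv(2)]
          lifts_frequency_add[OF xy(3) uv(3)]])
  next
    show "((\<lambda>_. 1), (\<lambda>_. 1)) \<in> X"
      by (rule XI[OF matched_frequencies_zero lifts_frequency_zero lifts_frequency_zero])
  qed
  define h where "h n = freq_character \<beta> (l n)" for n
  \<comment> \<open>\<open>log_freq\<close> is indexed from 0, so the frequency \<open>ln k\<close> sits at index \<open>k - 1\<close>.\<close>
  define h' where "h' n = freq_character \<beta>' (log_freq (prime_monomial (R n) - 1))" for n
  have log: "log_freq (prime_monomial (R n) - 1) = ln (real (prime_monomial (R n)))" for n
    using prime_monomial_pos[of "R n"] by (simp add: log_freq_def)
  have hX: "(h n, h' n) \<in> X" for n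
    unfolding h_def h'_def
    by (rule XI[OF natural_decomposition_matched[OF dec, of n, folded log]
        lifts_freq_character[OF \<beta>] lifts_freq_character[OF \<beta>']])
  have hc: "is_character (h n)" "is_character (h' n)" for n using character[OF hX] by auto
  obtain f where f: "f \<in> hardy_functions m \<beta> p l" "has_dirichlet_coeffs m \<beta> l f a"
    using a by (auto simp: hardy_series_def)
  have fi: "integrable m f" by (rule G.hardy_functions_integrable[OF p f(1)])
  have fa: "fourier_coeff m f (h n) = a n" for n using f(2) by (simp add: has_dirichlet_coeffs_def h_def)
  have f0: "fourier_coeff m f \<gamma> = 0" if "is_character \<gamma>" "\<forall>n. \<gamma> \<noteq> h n" for \<gamma>
    using f(1) that by (simp add: hardy_functions_def h_def)
  have "\<forall>k. \<exists>w. w \<in> paired_polys \<and> (\<integral>x. norm (f x - w (Inl x)) \<partial>m) < (1/2) ^ k \<and>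
    (\<forall>\<delta>. is_character \<delta> \<and> (\<forall>n. \<delta> \<noteq> h' n) \<longrightarrow> fourier_coeff m' (\<lambda>x. w (Inr x)) \<delta> = 0)"
  proof
    fix k
    have e: "(0::real) < (1/2) ^ k" by simp
    obtain F c where F: "finite F" "\<And>\<gamma>. \<gamma> \<in> F \<Longrightarrow> is_character \<gamma>"
      "\<And>\<gamma>. \<gamma> \<in> F \<Longrightarrow> fourier_coeff m f \<gamma> = 0 \<Longrightarrow> c \<gamma> = 0"
      and close: "(\<integral>x. norm (f x - (\<Sum>\<gamma>\<in>F. c \<gamma> * \<gamma> x)) \<partial>m) < (1/2) ^ k"
      using G.spectral_approximation[OF fi e] by blast
    define F' where "F' = {\<gamma>\<in>F. \<exists>n. \<gamma> = h n}"
    define idx where "idx \<gamma> = (SOME n. \<gamma> = h n)" for \<gamma>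
    have idx: "h (idx \<gamma>) = \<gamma>" if "\<gamma> \<in> F'" for \<gamma>
      using that someI_ex[of "\<lambda>n. \<gamma> = h n"] by (auto simp: F'_def idx_def)
    have F': "finite F'" using F by (simp add: F'_def)
    define w where "w z = (\<Sum>\<gamma>\<in>F'. c \<gamma> * case_sum (h (idx \<gamma>)) (h' (idx \<gamma>)) z)" for z
    have "w \<in> paired_polys"
      unfolding w_def
      by (intro cspan_sum F' cspan_scale cspan_base paired_charactersI hX)
    moreover have "(\<Sum>\<gamma>\<in>F. c \<gamma> * \<gamma> x) = w (Inl x)" for x
    proof -
      have "(\<Sum>\<gamma>\<in>F. c \<gamma> * \<gamma> x) = (\<Sum>\<gamma>\<in>F'. c \<gamma> * \<gamma> x)"
        using F f0 by (intro sum.mono_neutral_right) (auto simp: F'_def)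
      then show ?thesis by (simp add: w_def idx)
    qed
    moreover have "fourier_coeff m' (\<lambda>x. w (Inr x)) \<delta> = 0" if "is_character \<delta>" "\<forall>n. \<delta> \<noteq> h' n" for \<delta>
    proof -
      have i: "integrable m' (\<lambda>x. h' n x * cnj (\<delta> x))" for n
        by (intro H.integrable_continuous continuous_intros character_continuous hc that)
      have "fourier_coeff m' (\<lambda>x. w (Inr x)) \<delta> = (\<Sum>\<gamma>\<in>F'. c \<gamma> * fourier_coeff m' (h' (idx \<gamma>)) \<delta>)"
        using i by (simp add: fourier_coeff_def w_def sum_distrib_right mult.assoc)
      also have "\<dots> = 0"
      proof (intro sum.neutral ballI)
        fix \<gamma>
        have "h' (idx \<gamma>) \<noteq> \<delta>" using that(2) by metis
        then show "c \<gamma> * fourier_coeff m' (h' (idx \<gamma>)) \<delta> = 0"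
          using H.fourier_coeff_character[OF hc(2) that(1)] by simp
      qed
      finally show ?thesis .
    qed
    ultimately show "\<exists>w. w \<in> paired_polys \<and> (\<integral>x. norm (f x - w (Inl x)) \<partial>m) < (1/2) ^ k \<and>
        (\<forall>\<delta>. is_character \<delta> \<and> (\<forall>n. \<delta> \<noteq> h' n) \<longrightarrow> fourier_coeff m' (\<lambda>x. w (Inr x)) \<delta> = 0)"
      using close by (intro exI[of _ w]) simp
  qed
  from choice[OF this] obtain w where w_all: "\<forall>k. w k \<in> paired_polys \<and>
      (\<integral>x. norm (f x - w k (Inl x)) \<partial>m) < (1/2) ^ k \<and>
      (\<forall>\<delta>. is_character \<delta> \<and> (\<forall>n. \<delta> \<noteq> h' n) \<longrightarrow> fourier_coeff m' (\<lambda>x. w k (Inr x)) \<delta> = 0)"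
    by (rule exE)
  have w: "w k \<in> paired_polys" and close: "(\<integral>x. norm (f x - w k (Inl x)) \<partial>m) < (1/2) ^ k" for k
    using w_all by auto
  have w0: "fourier_coeff m' (\<lambda>x. w k (Inr x)) \<delta> = 0" if "is_character \<delta>" "\<forall>n. \<delta> \<noteq> h' n" for k \<delta>
    using w_all that by blast
  from transfer_L1_limit[OF w fi close] obtain g where gi: "integrable m' g"
    and lim_all: "\<forall>\<delta>. is_character \<delta> \<longrightarrow> (\<lambda>k. fourier_coeff m' (\<lambda>x. w k (Inr x)) \<delta>) \<longlonglongrightarrow> fourier_coeff m' g \<delta>"
    and law: "distr m borel (\<lambda>x. norm (f x)) = distr m' borel (\<lambda>x. norm (g x))"
    by (elim exE conjE)
  note lim = lim_all[rule_format]
  have g0: "fourier_coeff m' g \<delta> = 0" if "is_character \<delta>" "\<forall>n. \<delta> \<noteq> h' n" for \<delta>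
    using lim[OF that(1)] unfolding w0[OF that] by (rule LIMSEQ_unique[OF _ tendsto_const])
  have ga: "fourier_coeff m' g (h' n) = a n" for n
  proof (rule LIMSEQ_unique[OF lim[OF hc(2)]])
    have eq: "fourier_coeff m' (\<lambda>x. w k (Inr x)) (h' n) = fourier_coeff m (\<lambda>x. w k (Inl x)) (h n)" for k
    proof -
      have "(\<lambda>z. w k z * cnj (case_sum (h n) (h' n) z)) \<in> paired_polys"
        by (intro paired_poly_mult paired_poly_cnj w cspan_base paired_charactersI hX)
      from paired_poly_integral[OF this] show ?thesis by (simp add: fourier_coeff_def)
    qed
    have wi: "integrable m (\<lambda>x. w k (Inl x))" for k
      using paired_poly_continuous[OF w] by (blast intro: G.integrable_continuous)
    have "(\<lambda>k. fourier_coeff m (\<lambda>x. w k (Inl x)) (h n) - a n) \<longlonglongrightarrow> 0"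
    proof (rule tendsto_norm_zero_cancel, rule real_tendsto_sandwich[of "\<lambda>_. 0"])
      have "norm (fourier_coeff m (\<lambda>x. w k (Inl x)) (h n) - a n) \<le> (1/2) ^ k" for k
      proof -
        have "norm (a n - fourier_coeff m (\<lambda>x. w k (Inl x)) (h n))
            = norm (fourier_coeff m (\<lambda>x. f x - w k (Inl x)) (h n))"
          using G.fourier_coeff_diff[OF fi wi hc(1)] by (simp add: fa)
        also have "\<dots> \<le> (1/2) ^ k"
          using G.norm_fourier_coeff_le[OF hc(1)] close[of k] by (rule order_trans[OF _ less_imp_le])
        finally show ?thesis by (simp only: norm_minus_commute)
      qed
      then show "eventually (\<lambda>k. norm (fourier_coeff m (\<lambda>x. w k (Inl x)) (h n) - a n) \<le> (1/2) ^ k) sequentially"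
        by simp
      show "(\<lambda>k. (1/2 :: real) ^ k) \<longlonglongrightarrow> 0" by (rule LIMSEQ_realpow_zero) auto
    qed auto
    then show "(\<lambda>k. fourier_coeff m' (\<lambda>x. w k (Inr x)) (h' n)) \<longlonglongrightarrow> a n"
      unfolding eq by (simp add: LIM_zero_iff)
  qed
  have flp: "f \<in> lp_space m p" using f by (simp add: hardy_functions_def)
  have gm: "g \<in> borel_measurable m'" using gi by (rule borel_measurable_integrable)
  have glp: "g \<in> lp_space m' p" "lp_norm m' p g = lp_norm m p f"
    using lp_space_norm_distr[OF flp gm law] by auto
  define b where "b i = fourier_coeff m' g (freq_character \<beta>' (log_freq i))" for i
  have "g \<in> hardy_functions m' \<beta>' p log_freq"
    using glp g0 by (auto simp: hardy_functions_def h'_def)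
  moreover have "has_dirichlet_coeffs m' \<beta>' log_freq g b"
    by (simp add: has_dirichlet_coeffs_def b_def)
  moreover have "transfers_coeffs R a b"
    unfolding transfers_coeffs_def
  proof (intro conjI allI impI)
    show "ordinary_coeff b (prime_monomial (R n)) = a n" for n
      using ga[of n] by (simp add: ordinary_coeff_def b_def h'_def)
    fix k :: nat assume k: "1 \<le> k" "\<forall>n. k \<noteq> prime_monomial (R n)"
    define \<delta> where "\<delta> = freq_character \<beta>' (log_freq (k - 1))"
    have lift: "lifts_frequency \<beta>' (log_freq i) (freq_character \<beta>' (log_freq i))" for i
      by (rule lifts_freq_character[OF \<beta>'])
    have "\<delta> \<noteq> h' n" for n
    proof
      assume eq: "\<delta> = h' n"
      have "lifts_frequency \<beta>' (log_freq (k - 1) + - log_freq (prime_monomial (R n) - 1)) (\<lambda>x. \<delta> x * cnj (h' n x))"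
        unfolding \<delta>_def h'_def by (intro lifts_frequency_add lifts_frequency_minus lift)
      moreover have "(\<lambda>x. \<delta> x * cnj (h' n x)) = (\<lambda>_. 1)"
        unfolding eq by (rule ext, rule character_cnj_mult(2)[OF hc(2)])
      ultimately have "log_freq (k - 1) = log_freq (prime_monomial (R n) - 1)"
        using lifts_frequency_trivial_iff[OF dg'] by fastforce
      then have "k = prime_monomial (R n)"
        using k(1) prime_monomial_pos[of "R n"] by (simp add: log_freq_def)
      then show False using k(2) by blast
    qed
    moreover have "is_character \<delta>" using lift by (simp add: \<delta>_def lifts_frequency_def)
    ultimately show "ordinary_coeff b k = 0"
      using g0 by (simp add: ordinary_coeff_def b_def \<delta>_def)
  qed
  ultimately show ?thesis
    using G.hardy_norm_eq[OF p f] H.hardy_norm_eq[OF p] glp(2) unfolding hardy_series_def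
    by (intro bexI[of _ b]) auto
qed

theorem corollary3p32:
  fixes p :: ennreal
    and l B :: "nat \<Rightarrow> real" and L :: enat and R :: "nat \<Rightarrow> nat \<Rightarrow> nat"
    and \<beta> :: "real \<Rightarrow> 'g::{topological_ab_group_add,t2_space}" and m :: "'g measure"
    and \<beta>' :: "real \<Rightarrow> 'h::{topological_ab_group_add,t2_space}" and m' :: "'h measure"
  assumes "1 \<le> p"
    and "frequency l" and "natural_decomposition l L B R"
    and "freq_dirichlet_group \<beta> l" and "haar_measure m"
    and "freq_dirichlet_group \<beta>' log_freq" and "haar_measure m'"
  shows "\<exists>!\<psi>. into_isometry (hardy_series m \<beta> p l) (hardy_norm m \<beta> p l)
                (hardy_series m' \<beta>' p log_freq) (hardy_norm m' \<beta>' p log_freq) \<psi> \<and>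
              (\<forall>a\<in>hardy_series m \<beta> p l. transfers_coeffs R a (\<psi> a))"
proof -
  let ?X = "hardy_series m \<beta> p l" and ?Y = "hardy_series m' \<beta>' p log_freq"
  interpret G: compact_haar m
    using assms(4,5) by unfold_locales (auto simp: freq_dirichlet_group_def dirichlet_group_def)
  have ex: "\<exists>b\<in>?Y. transfers_coeffs R a b \<and> hardy_norm m' \<beta>' p log_freq b = hardy_norm m \<beta> p l a"
    if "a \<in> ?X" for a
    by (rule transfer_exists[OF assms(1,3-7) that])
  define \<psi> where "\<psi> = (\<lambda>a\<in>?X. THE b. transfers_coeffs R a b)"
  have \<psi>_eq: "\<psi> a = b" if "a \<in> ?X" "transfers_coeffs R a b" for a b
    using that transfers_coeffs_unique by (auto simp: \<psi>_def)
  have \<psi>: "\<psi> a \<in> ?Y" "transfers_coeffs R a (\<psi> a)"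
    "hardy_norm m' \<beta>' p log_freq (\<psi> a) = hardy_norm m \<beta> p l a" if "a \<in> ?X" for a
    using ex[OF that] \<psi>_eq[OF that] by auto
  have iso: "into_isometry ?X (hardy_norm m \<beta> p l) ?Y (hardy_norm m' \<beta>' p log_freq) \<psi>"
    unfolding into_isometry_def
  proof (intro conjI ballI allI)
    show "\<psi> \<in> ?X \<rightarrow>\<^sub>E ?Y"
      using \<psi>(1) by (auto simp: PiE_def \<psi>_def)
    fix a assume a: "a \<in> ?X"
    show "hardy_norm m' \<beta>' p log_freq (\<psi> a) = hardy_norm m \<beta> p l a" by (rule \<psi>(3)[OF a])
    show "\<psi> (\<lambda>n. c * a n) = (\<lambda>n. c * \<psi> a n)" for c
    proof (rule \<psi>_eq)
      show "(\<lambda>n. c * a n) \<in> ?X" by (rule G.hardy_series_scale[OF a])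
      show "transfers_coeffs R (\<lambda>n. c * a n) (\<lambda>n. c * \<psi> a n)"
        using \<psi>(2)[OF a] by (simp add: transfers_coeffs_def ordinary_coeff_def)
    qed
    fix a' assume a': "a' \<in> ?X"
    show "\<psi> (\<lambda>n. a n + a' n) = (\<lambda>n. \<psi> a n + \<psi> a' n)"
    proof (rule \<psi>_eq)
      show "(\<lambda>n. a n + a' n) \<in> ?X" by (rule G.hardy_series_add[OF assms(4,1) a a'])
      show "transfers_coeffs R (\<lambda>n. a n + a' n) (\<lambda>n. \<psi> a n + \<psi> a' n)"
        using \<psi>(2)[OF a] \<psi>(2)[OF a'] by (simp add: transfers_coeffs_def ordinary_coeff_def)
    qed
  qed
  have unique: "\<phi> = \<psi>" if "into_isometry ?X (hardy_norm m \<beta> p l) ?Y (hardy_norm m' \<beta>' p log_freq) \<phi>"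
    "\<forall>a\<in>?X. transfers_coeffs R a (\<phi> a)" for \<phi>
  proof
    fix a
    show "\<phi> a = \<psi> a"
    proof (cases "a \<in> ?X")
      case True then show ?thesis using \<psi>_eq[OF True, of "\<phi> a"] that(2) by simp
    next
      case False
      have "\<phi> \<in> ?X \<rightarrow>\<^sub>E ?Y" using that(1) by (simp only: into_isometry_def)
      then show ?thesis using PiE_arb[of \<phi> ?X _ a] False by (simp add: \<psi>_def)
    qed
  qed
  show ?thesis
  proof (rule ex1I[of _ \<psi>])
    show "into_isometry ?X (hardy_norm m \<beta> p l) ?Y (hardy_norm m' \<beta>' p log_freq) \<psi> \<and>
        (\<forall>a\<in>?X. transfers_coeffs R a (\<psi> a))"
      using iso \<psi>(2) by blast
  qed (rule unique; simp)
qed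

end
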